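(* Let $H$ be a finite dimensional Hopf algebra over a field $k$, let $G=\mathrm{Aut}_{Hopf}(H)\times \mathrm{Aut}_{Hopf}(H)$ with multiplication $(\alpha,\beta)*(\gamma,\delta)=(\delta\alpha\delta^{-1}\gamma,\delta\beta)$, and let $CT(H)=\{H^{*op}\bowtie H(\alpha,\beta)\}_{(\alpha,\beta)\in G}$ be the Turaev $G$-algebra described in the context. Then $CT(H)$ is a crossed Turaev $G$-algebra with crossing $\psi$ given by $$\psi_{(\alpha,\beta)}:H^{*op}\bowtie H(\gamma,\delta)\to H^{*op}\bowtie H\bigl((\alpha,\beta)*(\gamma,\delta)*(\alpha,\beta)^{-1}\bigr),$$ $$p\bowtie h\mapsto p\circ\alpha^{-1}\beta\bowtie\beta^{-1}\delta\alpha\delta^{-1}(h).$$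
   Context: $\mathrm{Aut}_{Hopf}(H)$ is the group of Hopf algebra automorphisms of $H$ under composition. In $G$ the unit is $(id,id)$ and $(\alpha,\beta)^{-1}=(\beta^{-1}\alpha^{-1}\beta,\beta^{-1})$. The antipode $S$ of $H$ is bijective since $H$ is finite dimensional. On $H^*$ juxtaposition denotes the convolution product $(pq)(h)=p(h_1)q(h_2)$ (with unit $\varepsilon$), $p\mapsto p_1\otimes p_2$ is determined by $p(hh')=p_1(h)p_2(h')$, and $S^{-1*}(p)=p\circ S^{-1}$. $H^{*op}$ is $H^*$ with opposite multiplication; all products of elements of $H^*$ written in formulas are convolution products. $\{h_i\},\{h^i\}$ are dual bases of $H$ and $H^*$. The Turaev $G$-algebra $CT(H)$: the component $CT(H)_{(\alpha,\beta)}=H^{*op}\bowtie H(\alpha,\beta)$ is the vector space $H^*\otimes H$ (elements $p\bowtie h$) with coalgebra structure $$\bar\Delta(p\bowtie h)=\sum_{i,j}\bigl(p_1\bowtie\beta(h_j)h_1S^{-1}\alpha(h_i)\bigr)\otimes\bigl(h^ip_2h^j\bowtie h_2\bigr),\qquad\bar\varepsilon(p\bowtie h)=p(1)\varepsilon(h),$$ where $h_1\otimes h_2=\Delta(h)$; the multiplication is, for $p\bowtie h\in CT(H)_{(\alpha,\beta)}$ and $q\bowtie h'\in CT(H)_{(\gamma,\delta)}$, $$(p\bowtie h)(q\bowtie h')=qp\bowtie\delta(h)\,\delta\alpha\delta^{-1}(h')\in CT(H)_{(\alpha,\beta)*(\gamma,\delta)};$$ the unit is $\varepsilon\bowtie1$;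 the antipode is $$S_{(\alpha,\beta)}(p\bowtie h)=\sum_{i,j}h^iS^{-1*}(p)S^{-1*}(h^j)\bowtie\beta^{-1}(h_j)\,\beta^{-1}\alpha^{-1}S(h)\,\beta^{-1}\alpha^{-1}\beta(h_i)\in CT(H)_{(\alpha,\beta)^{-1}}.$$ For a group $G$ with unit $1$, a Turaev $G$-algebra is a family $A=\{A_a\}_{a\in G}$ of coalgebras $(A_a,\Delta_a,\varepsilon_a)$ with coalgebra maps $m_{a,b}:A_a\otimes A_b\to A_{ab}$ and $\eta:k\to A_1$ that are associative and unital, and linear maps $S_a:A_a\to A_{a^{-1}}$ with $m_{a,a^{-1}}(id\otimes S_a)\Delta_a=\varepsilon_a1=m_{a^{-1},a}(S_a\otimes id)\Delta_a$. It is crossed if it has a family of coalgebra isomorphisms $\psi_b:A_a\to A_{bab^{-1}}$ ($a,b\in G$) such that (i) $\psi_a\psi_b=\psi_{ab}$; (ii) $m_{cac^{-1},cbc^{-1}}(\psi_c\otimes\psi_c)=\psi_cm_{a,b}$; (iii) $\psi_c\eta=\eta$; (iv) $\psi_bS_a=S_{bab^{-1}}\psi_b$. *)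

theory Defs
  imports Complex_Main "HOL-Algebra.Group" "HOL-Library.Function_Algebras"
begin

section \<open>Vector spaces and their tensor products\<close>

text \<open>
  A vector space over the field \<^typ>\<open>'k\<close> is a subspace of an ambient vector space: the addition is
  that of the ambient type, the scalar multiplication is part of the structure.
\<close>

record ('k, 'v) vspace =
  vcarrier :: "'v set"
  vscale :: "'k \<Rightarrow> 'v \<Rightarrow> 'v"

locale vspace =
  fixes V :: "('k::field, 'v::ab_group_add, 'z) vspace_scheme"
  assumes ambient: "vector_space (vscale V)"
    and subspace: "module.subspace (vscale V) (vcarrier V)"

definition lin_map ::
  "('k::field, 'v::ab_group_add, 'y) vspace_scheme \<Rightarrow> ('k, 'w::ab_group_add, 'z) vspace_scheme
    \<Rightarrow> ('v \<Rightarrow> 'w) \<Rightarrow> bool" where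
  "lin_map V W f \<longleftrightarrow>
     (\<forall>x\<in>vcarrier V. f x \<in> vcarrier W) \<and>
     (\<forall>x\<in>vcarrier V. \<forall>y\<in>vcarrier V. f (x + y) = f x + f y) \<and>
     (\<forall>c. \<forall>x\<in>vcarrier V. f (vscale V c x) = vscale W c (f x))"

definition bilin_map ::
  "('k::field, 'v::ab_group_add, 'x) vspace_scheme \<Rightarrow> ('k, 'w::ab_group_add, 'y) vspace_scheme
    \<Rightarrow> ('k, 'u::ab_group_add, 'z) vspace_scheme \<Rightarrow> ('v \<Rightarrow> 'w \<Rightarrow> 'u) \<Rightarrow> bool" where
  "bilin_map V W U b \<longleftrightarrow>
     (\<forall>w\<in>vcarrier W. lin_map V U (\<lambda>v. b v w)) \<and> (\<forall>v\<in>vcarrier V. lin_map W U (b v))"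

definition ground :: "('k::field, 'k) vspace" where
  "ground = \<lparr>vcarrier = UNIV, vscale = (*)\<rparr>"

definition fun_scale :: "'k::field \<Rightarrow> ('a \<Rightarrow> 'k) \<Rightarrow> 'a \<Rightarrow> 'k" where
  "fun_scale c f = (\<lambda>x. c * f x)"

text \<open>
  The tensor product is realized inside the linear functionals on the space of bilinear forms:
  \<open>v \<otimes> w\<close> evaluates a bilinear form at \<open>(v, w)\<close>, and \<open>V \<otimes> W\<close> is the span of these functionals. The
  universal property is proved below in \<open>lin_map_tensor_lift\<close>, \<open>tensor_lift_tensor\<close> and
  \<open>lin_map_tensor_unique\<close>.
\<close>

type_synonym ('v, 'w, 'k) tensor = "('v \<Rightarrow> 'w \<Rightarrow> 'k) \<Rightarrow> 'k"

definition tensor ::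
  "('k::field, 'v::ab_group_add, 'y) vspace_scheme \<Rightarrow> ('k, 'w::ab_group_add, 'z) vspace_scheme
    \<Rightarrow> 'v \<Rightarrow> 'w \<Rightarrow> ('v, 'w, 'k) tensor" where
  "tensor V W v w = (\<lambda>b. if bilin_map V W ground b then b v w else 0)"

definition tensor_space ::
  "('k::field, 'v::ab_group_add, 'y) vspace_scheme \<Rightarrow> ('k, 'w::ab_group_add, 'z) vspace_scheme
    \<Rightarrow> ('k, ('v, 'w, 'k) tensor) vspace" where
  "tensor_space V W =
     \<lparr>vcarrier = module.span fun_scale {tensor V W v w | v w. v \<in> vcarrier V \<and> w \<in> vcarrier W},
      vscale = fun_scale\<rparr>"

text \<open>
  The linear map on \<open>V \<otimes> W\<close> induced by a bilinear map into \<open>U\<close>; in Sweedler notation,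
  \<open>tensor_lift V W U (\<lambda>x\<^sub>1 x\<^sub>2. b x\<^sub>1 x\<^sub>2) (\<Delta> x)\<close> is \<open>b x\<^sub>1 x\<^sub>2\<close>.
\<close>

definition tensor_lift ::
  "('k::field, 'v::ab_group_add, 'x) vspace_scheme \<Rightarrow> ('k, 'w::ab_group_add, 'y) vspace_scheme
    \<Rightarrow> ('k, 'u::ab_group_add, 'z) vspace_scheme \<Rightarrow> ('v \<Rightarrow> 'w \<Rightarrow> 'u) \<Rightarrow> ('v, 'w, 'k) tensor \<Rightarrow> 'u" where
  "tensor_lift V W U b =
     (SOME f. lin_map (tensor_space V W) U f \<and>
        (\<forall>v\<in>vcarrier V. \<forall>w\<in>vcarrier W. f (tensor V W v w) = b v w))"

lemma vector_space_fun_scale: "vector_space (fun_scale :: 'k::field \<Rightarrow> ('a \<Rightarrow> 'k) \<Rightarrow> 'a \<Rightarrow> 'k)"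
  by unfold_locales (rule ext, simp add: fun_scale_def algebra_simps)+

interpretation fun_vs: vector_space "fun_scale :: 'k::field \<Rightarrow> ('a \<Rightarrow> 'k) \<Rightarrow> 'a \<Rightarrow> 'k"
  by (rule vector_space_fun_scale)

lemma vspace_ground: "vspace (ground :: ('k::field, 'k) vspace)"
proof -
  interpret v: vector_space "(*) :: 'k \<Rightarrow> 'k \<Rightarrow> 'k"
    by unfold_locales (auto simp: algebra_simps)
  show ?thesis
    unfolding vspace_def ground_def by (simp add: v.vector_space_axioms v.subspace_UNIV)
qed

lemma vspace_tensor_space: "vspace (tensor_space V W)"
  unfolding vspace_def tensor_space_def
  by (simp add: vector_space_fun_scale)

lemma tensor_in_tensor_space:
  "v \<in> vcarrier V \<Longrightarrow> w \<in> vcarrier W \<Longrightarrow> tensor V W v w \<in> vcarrier (tensor_space V W)"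
  unfolding tensor_space_def by (auto intro!: fun_vs.span_base)

lemma lin_map_tensor_unique:
  fixes V :: "('k::field, 'v::ab_group_add, 'x) vspace_scheme"
    and W :: "('k, 'w::ab_group_add, 'y) vspace_scheme"
    and U :: "('k, 'u::ab_group_add, 'z) vspace_scheme"
  assumes "lin_map (tensor_space V W) U f" and "lin_map (tensor_space V W) U g"
    and "\<And>v w. v \<in> vcarrier V \<Longrightarrow> w \<in> vcarrier W \<Longrightarrow> f (tensor V W v w) = g (tensor V W v w)"
    and "t \<in> vcarrier (tensor_space V W)"
  shows "f t = g t"
proof -
  let ?P = "{tensor V W v w | v w. v \<in> vcarrier V \<and> w \<in> vcarrier W}"
  have car: "vcarrier (tensor_space V W) = fun_vs.span ?P"
    and scl: "vscale (tensor_space V W) = fun_scale"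
    by (simp_all add: tensor_space_def)
  have "t \<in> fun_vs.span ?P"
    using assms(4) car by simp
  then have "t \<in> fun_vs.span ?P \<and> f t = g t"
  proof (induction rule: fun_vs.span_induct_alt)
    case base
    have zero: "0 \<in> vcarrier (tensor_space V W)"
      unfolding car by (rule fun_vs.span_zero)
    have "f (0 + 0) = f 0 + f 0" "g (0 + 0) = g 0 + g 0"
      using assms(1,2) zero unfolding lin_map_def by blast+
    then have "f 0 = 0" "g 0 = 0"
      by (simp_all only: add_0_left add_cancel_right_right)
    then show ?case using fun_vs.span_zero by (simp only: simp_thms)
  next
    case (step c x y)
    have x: "x \<in> vcarrier (tensor_space V W)"
      unfolding car using step(1) by (rule fun_vs.span_base)
    have y: "y \<in> vcarrier (tensor_space V W)"
      unfolding car using step(2) by blast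
    have cx: "fun_scale c x \<in> vcarrier (tensor_space V W)"
      using x unfolding car by (rule fun_vs.span_scale)
    have "f x = g x" using step(1) assms(3) by auto
    moreover have "f (fun_scale c x + y) = vscale U c (f x) + f y"
      using assms(1) cx x y unfolding lin_map_def scl by simp
    moreover have "g (fun_scale c x + y) = vscale U c (g x) + g y"
      using assms(2) cx x y unfolding lin_map_def scl by simp
    moreover have "fun_scale c x + y \<in> fun_vs.span ?P"
      using cx y unfolding car by (rule fun_vs.span_add)
    ultimately show ?case using step(2) by (simp only: simp_thms)
  qed
  then show ?thesis by blast
qed

lemma (in vector_space) functionals_separate:
  assumes "\<And>\<phi>. Vector_Spaces.linear scale (*) \<phi> \<Longrightarrow> \<phi> u = \<phi> u'"
  shows "u = u'"
proof -
  obtain B where B': "independent B" "UNIV \<subseteq> span B"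
    using maximal_independent_subset[of UNIV] by blast
  note B = B'(1) antisym[OF subset_UNIV B'(2)]
  have "representation B u b = representation B u' b" for b
    by (rule assms[OF linear_representation[OF B]])
  then have rep: "representation B u = representation B u'"
    by (rule ext)
  have sum: "(\<Sum>b | representation B v b \<noteq> 0. representation B v b *s b) = v" for v
    by (rule sum_nonzero_representation_eq[OF B(1)]) (simp only: B(2) UNIV_I)
  have "u = (\<Sum>b | representation B u b \<noteq> 0. representation B u b *s b)"
    by (rule sum[symmetric])
  also have "\<dots> = u'"
    unfolding rep by (rule sum)
  finally show ?thesis .
qed

lemma tensor_lift_exists:
  fixes V :: "('k::field, 'v::ab_group_add, 'x) vspace_scheme"
    and W :: "('k, 'w::ab_group_add, 'y) vspace_scheme"
    and U :: "('k, 'u::ab_group_add, 'z) vspace_scheme"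
  assumes U: "vspace U" and b: "bilin_map V W U b"
  shows "\<exists>f. lin_map (tensor_space V W) U f \<and>
    (\<forall>v\<in>vcarrier V. \<forall>w\<in>vcarrier W. f (tensor V W v w) = b v w)"
proof -
  let ?s = "vscale U"
  let ?P = "{tensor V W v w | v w. v \<in> vcarrier V \<and> w \<in> vcarrier W}"
  interpret u: vector_space ?s using U by (rule vspace.ambient)
  have sub: "u.subspace (vcarrier U)" using U by (rule vspace.subspace)
  have phi_add: "\<phi> (x + y) = \<phi> x + \<phi> y" and phi_scale: "\<phi> (?s c x) = c * \<phi> x"
    and phi_0: "\<phi> 0 = 0" if "Vector_Spaces.linear ?s (*) \<phi>" for \<phi> :: "'u \<Rightarrow> 'k" and x y c
  proof -
    interpret p: Vector_Spaces.linear ?s "(*)" \<phi> by (rule that)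
    show "\<phi> (x + y) = \<phi> x + \<phi> y" "\<phi> (?s c x) = c * \<phi> x" "\<phi> 0 = 0"
      by (rule p.add p.scale p.zero)+
  qed
  define R where "R t u \<longleftrightarrow> u \<in> vcarrier U \<and>
    (\<forall>\<phi>. Vector_Spaces.linear ?s (*) \<phi> \<longrightarrow> \<phi> u = t (\<lambda>v w. \<phi> (b v w)))"
    for t :: "('v, 'w, 'k) tensor" and u
  have uniq: "u = u'" if "R t u" "R t u'" for t u u'
  proof (rule u.functionals_separate)
    fix \<phi> :: "'u \<Rightarrow> 'k" assume p: "Vector_Spaces.linear ?s (*) \<phi>"
    have "\<phi> u = t (\<lambda>v w. \<phi> (b v w))" "\<phi> u' = t (\<lambda>v w. \<phi> (b v w))"
      using that p unfolding R_def by blast+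
    then show "\<phi> u = \<phi> u'" by (simp only:)
  qed
  have R_add: "R (t + t') (u + u')" if "R t u" "R t' u'" for t t' u u'
    unfolding R_def
  proof (intro conjI allI impI)
    show "u + u' \<in> vcarrier U"
      using that unfolding R_def by (intro u.subspace_add[OF sub]) auto
    show "\<phi> (u + u') = (t + t') (\<lambda>v w. \<phi> (b v w))" if p: "Vector_Spaces.linear ?s (*) \<phi>" for \<phi>
      using \<open>R t u\<close> \<open>R t' u'\<close> p phi_add[OF p] unfolding R_def by (simp only: plus_fun_apply)
  qed
  have R_scale: "R (fun_scale c t) (?s c u)" if "R t u" for c t u
    unfolding R_def
  proof (intro conjI allI impI)
    show "?s c u \<in> vcarrier U"
      using that unfolding R_def by (intro u.subspace_scale[OF sub]) auto
    show "\<phi> (?s c u) = fun_scale c t (\<lambda>v w. \<phi> (b v w))" if p: "Vector_Spaces.linear ?s (*) \<phi>" for \<phi>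
      using \<open>R t u\<close> p phi_scale[OF p] unfolding R_def by (simp only: fun_scale_def)
  qed
  have R_tensor: "R (tensor V W v w) (b v w)" if vw: "v \<in> vcarrier V" "w \<in> vcarrier W" for v w
  proof -
    have "bilin_map V W ground (\<lambda>v w. \<phi> (b v w))" if "Vector_Spaces.linear ?s (*) \<phi>" for \<phi>
    proof -
      interpret p: Vector_Spaces.linear ?s "(*)" \<phi> by (rule that)
      show ?thesis
        using b unfolding bilin_map_def lin_map_def ground_def by (simp add: p.add p.scale)
    qed
    moreover have "b v w \<in> vcarrier U"
      using b vw unfolding bilin_map_def lin_map_def by blast
    ultimately show ?thesis
      unfolding R_def tensor_def by simp
  qed
  have R_zero: "R 0 0"
    unfolding R_def
  proof (intro conjI allI impI)
    show "0 \<in> vcarrier U" by (rule u.subspace_0[OF sub])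
    show "\<phi> 0 = 0 (\<lambda>v w. \<phi> (b v w))" if "Vector_Spaces.linear ?s (*) \<phi>" for \<phi>
      using phi_0[OF that] by (simp only: zero_fun_apply)
  qed
  have ex: "\<exists>u. R t u" if "t \<in> fun_vs.span ?P" for t
    using that
  proof (induction rule: fun_vs.span_induct_alt)
    case base
    then show ?case using R_zero by blast
  next
    case (step c x y)
    then obtain v w y' where x: "x = tensor V W v w" and vw: "v \<in> vcarrier V" "w \<in> vcarrier W"
      and y: "R y y'"
      by blast
    have "R (fun_scale c x + y) (?s c (b v w) + y')"
      unfolding x by (rule R_add[OF R_scale[OF R_tensor[OF vw]] y])
    then show ?case by blast
  qed
  define f where "f t = (THE u. R t u)" for t
  have f: "f t = u" if "R t u" for t u
    unfolding f_def by (rule the_equality) (rule that, erule uniq[OF _ that])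
  have Rf: "R t (f t)" if t: "t \<in> fun_vs.span ?P" for t
  proof -
    obtain u where u: "R t u" using ex[OF t] by blast
    show ?thesis unfolding f[OF u] by (rule u)
  qed
  have "lin_map (tensor_space V W) U f"
    unfolding lin_map_def tensor_space_def vspace.simps
  proof (intro conjI ballI allI)
    show "f t \<in> vcarrier U" if "t \<in> fun_vs.span ?P" for t
      using Rf[OF that] unfolding R_def by blast
    show "f (t + t') = f t + f t'" if "t \<in> fun_vs.span ?P" "t' \<in> fun_vs.span ?P" for t t'
      by (rule f[OF R_add[OF Rf[OF that(1)] Rf[OF that(2)]]])
    show "f (fun_scale c t) = ?s c (f t)" if "t \<in> fun_vs.span ?P" for c t
      by (rule f[OF R_scale[OF Rf[OF that]]])
  qed
  moreover have "f (tensor V W v w) = b v w" if "v \<in> vcarrier V" "w \<in> vcarrier W" for v w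
    by (rule f[OF R_tensor[OF that]])
  ultimately show ?thesis by (intro exI[of _ f] conjI ballI)
qed

lemma
  assumes "vspace U" and "bilin_map V W U b"
  shows lin_map_tensor_lift: "lin_map (tensor_space V W) U (tensor_lift V W U b)"
    and tensor_lift_tensor: "v \<in> vcarrier V \<Longrightarrow> w \<in> vcarrier W \<Longrightarrow>
      tensor_lift V W U b (tensor V W v w) = b v w"
proof -
  note * = someI_ex[OF tensor_lift_exists[OF assms]]
  show "lin_map (tensor_space V W) U (tensor_lift V W U b)"
    unfolding tensor_lift_def by (rule conjunct1[OF *])
  show "tensor_lift V W U b (tensor V W v w) = b v w" if "v \<in> vcarrier V" "w \<in> vcarrier W"
    unfolding tensor_lift_def by (rule bspec[OF bspec[OF conjunct2[OF *] that(1)] that(2)])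
qed

definition tensor_map ::
  "('k::field, 'v::ab_group_add, 'y) vspace_scheme \<Rightarrow> ('k, 'w::ab_group_add, 'z) vspace_scheme
    \<Rightarrow> ('k, 'v'::ab_group_add, 'y1) vspace_scheme \<Rightarrow> ('k, 'w'::ab_group_add, 'z1) vspace_scheme
    \<Rightarrow> ('v \<Rightarrow> 'v') \<Rightarrow> ('w \<Rightarrow> 'w') \<Rightarrow> ('v, 'w, 'k) tensor \<Rightarrow> ('v', 'w', 'k) tensor" where
  "tensor_map V W V' W' f g =
     tensor_lift V W (tensor_space V' W') (\<lambda>v w. tensor V' W' (f v) (g w))"

definition tensor_assoc ::
  "('k::field, 'u::ab_group_add, 'x) vspace_scheme \<Rightarrow> ('k, 'v::ab_group_add, 'y) vspace_scheme
    \<Rightarrow> ('k, 'w::ab_group_add, 'z) vspace_scheme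
    \<Rightarrow> (('u, 'v, 'k) tensor, 'w, 'k) tensor \<Rightarrow> ('u, ('v, 'w, 'k) tensor, 'k) tensor" where
  "tensor_assoc U V W =
     tensor_lift (tensor_space U V) W (tensor_space U (tensor_space V W))
       (\<lambda>t w. tensor_lift U V (tensor_space U (tensor_space V W))
          (\<lambda>u v. tensor U (tensor_space V W) u (tensor V W v w)) t)"


section \<open>Coalgebras and Hopf algebras\<close>

record ('k, 'v) coalg = "('k, 'v) vspace" +
  comul :: "'v \<Rightarrow> ('v, 'v, 'k) tensor"
  counit :: "'v \<Rightarrow> 'k"

locale coalgebra = vspace C for C :: "('k::field, 'v::ab_group_add, 'z) coalg_scheme" +
  assumes comul_lin: "lin_map C (tensor_space C C) (comul C)"
    and counit_lin: "lin_map C ground (counit C)"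
    and coassoc: "x \<in> vcarrier C \<Longrightarrow>
      tensor_assoc C C C (tensor_map C C (tensor_space C C) C (comul C) id (comul C x))
        = tensor_map C C C (tensor_space C C) id (comul C) (comul C x)"
    and counit_left: "x \<in> vcarrier C \<Longrightarrow>
      tensor_lift C C C (\<lambda>x\<^sub>1 x\<^sub>2. vscale C (counit C x\<^sub>1) x\<^sub>2) (comul C x) = x"
    and counit_right: "x \<in> vcarrier C \<Longrightarrow>
      tensor_lift C C C (\<lambda>x\<^sub>1 x\<^sub>2. vscale C (counit C x\<^sub>2) x\<^sub>1) (comul C x) = x"

definition coalgebra_map ::
  "('k::field, 'v::ab_group_add, 'y) coalg_scheme \<Rightarrow> ('k, 'w::ab_group_add, 'z) coalg_scheme
    \<Rightarrow> ('v \<Rightarrow> 'w) \<Rightarrow> bool" where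
  "coalgebra_map C D f \<longleftrightarrow>
     lin_map C D f \<and>
     (\<forall>x\<in>vcarrier C. comul D (f x) = tensor_map C C D D f f (comul C x)) \<and>
     (\<forall>x\<in>vcarrier C. counit D (f x) = counit C x)"

definition coalgebra_iso ::
  "('k::field, 'v::ab_group_add, 'y) coalg_scheme \<Rightarrow> ('k, 'w::ab_group_add, 'z) coalg_scheme
    \<Rightarrow> ('v \<Rightarrow> 'w) \<Rightarrow> bool" where
  "coalgebra_iso C D f \<longleftrightarrow> coalgebra_map C D f \<and> bij_betw f (vcarrier C) (vcarrier D)"

definition ground_coalg :: "('k::field, 'k) coalg" where
  "ground_coalg =
     \<lparr>vcarrier = UNIV, vscale = (*), comul = (\<lambda>c. tensor ground ground c 1), counit = id\<rparr>"

text \<open>\<open>(c \<otimes> c') \<otimes> (d \<otimes> d') \<mapsto> (c \<otimes> d) \<otimes> (c' \<otimes> d')\<close>\<close>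

definition middle_swap ::
  "('k::field, 'v::ab_group_add, 'y) vspace_scheme \<Rightarrow> ('k, 'w::ab_group_add, 'z) vspace_scheme
    \<Rightarrow> (('v, 'v, 'k) tensor, ('w, 'w, 'k) tensor, 'k) tensor
    \<Rightarrow> (('v, 'w, 'k) tensor, ('v, 'w, 'k) tensor, 'k) tensor" where
  "middle_swap C D = (let CD = tensor_space C D; T = tensor_space CD CD in
     tensor_lift (tensor_space C C) (tensor_space D D) T
       (\<lambda>s t. tensor_lift C C T
          (\<lambda>c c'. tensor_lift D D T
             (\<lambda>d d'. tensor CD CD (tensor C D c d) (tensor C D c' d')) t) s))"

definition tensor_coalg ::
  "('k::field, 'v::ab_group_add, 'y) coalg_scheme \<Rightarrow> ('k, 'w::ab_group_add, 'z) coalg_scheme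
    \<Rightarrow> ('k, ('v, 'w, 'k) tensor) coalg" where
  "tensor_coalg C D =
     \<lparr>vcarrier = vcarrier (tensor_space C D), vscale = vscale (tensor_space C D),
      comul = middle_swap C D \<circ>
        tensor_map C D (tensor_space C C) (tensor_space D D) (comul C) (comul D),
      counit = tensor_lift C D ground (\<lambda>c d. counit C c * counit D d)\<rparr>"

text \<open>
  For a Hopf algebra the carrier is the whole ambient type, whose ring operations are the algebra
  structure; the nonzero unit of \<^class>\<open>ring_1\<close> is no restriction because the counit maps \<open>1\<close> to \<open>1\<close>.
\<close>

record ('k, 'h) hopf = "('k, 'h) coalg" +
  antipode :: "'h \<Rightarrow> 'h"

locale hopf_algebra = coalgebra H for H :: "('k::field, 'h::ring_1) hopf" +
  assumes carrier_UNIV: "vcarrier H = UNIV"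
    and scale_mult_left: "vscale H c x * y = vscale H c (x * y)"
    and scale_mult_right: "x * vscale H c y = vscale H c (x * y)"
    and mult_coalgebra_map: "coalgebra_map (tensor_coalg H H) H (tensor_lift H H H (*))"
    and unit_coalgebra_map: "coalgebra_map ground_coalg H (\<lambda>c. vscale H c 1)"
    and antipode_lin: "lin_map H H (antipode H)"
    and antipode_left: "tensor_lift H H H (\<lambda>x\<^sub>1 x\<^sub>2. antipode H x\<^sub>1 * x\<^sub>2) (comul H x)
          = vscale H (counit H x) 1"
    and antipode_right: "tensor_lift H H H (\<lambda>x\<^sub>1 x\<^sub>2. x\<^sub>1 * antipode H x\<^sub>2) (comul H x)
          = vscale H (counit H x) 1"

definition Aut_Hopf :: "('k::field, 'h::ring_1) hopf \<Rightarrow> ('h \<Rightarrow> 'h) set" where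
  "Aut_Hopf H = {f. coalgebra_iso H H f \<and> f 1 = 1 \<and> (\<forall>x y. f (x * y) = f x * f y) \<and>
     (\<forall>x. f (antipode H x) = antipode H (f x))}"

text \<open>The prefix syntax \<open>inv\<close> is taken by \<^theory>\<open>HOL-Algebra.Group\<close>.\<close>

abbreviation fun_inv :: "('a \<Rightarrow> 'b) \<Rightarrow> 'b \<Rightarrow> 'a" (\<open>_\<^sup>-\<^sup>1\<close> [1000] 1000) where
  "f\<^sup>-\<^sup>1 \<equiv> inv_into UNIV f"

definition aut_pairs :: "('k::field, 'h::ring_1) hopf \<Rightarrow> (('h \<Rightarrow> 'h) \<times> ('h \<Rightarrow> 'h)) monoid" where
  "aut_pairs H =
     \<lparr>carrier = Aut_Hopf H \<times> Aut_Hopf H,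
      monoid.mult = (\<lambda>(\<alpha>, \<beta>) (\<gamma>, \<delta>). (\<delta> \<circ> \<alpha> \<circ> \<delta>\<^sup>-\<^sup>1 \<circ> \<gamma>, \<delta> \<circ> \<beta>)),
      one = (id, id)\<rparr>"


section \<open>Turaev group algebras\<close>

record ('g, 'k, 'v) turaev =
  comp :: "'g \<Rightarrow> ('k, 'v) coalg"
  tmult :: "'g \<Rightarrow> 'g \<Rightarrow> ('v, 'v, 'k) tensor \<Rightarrow> 'v"
  tunit :: "'k \<Rightarrow> 'v"
  tantip :: "'g \<Rightarrow> 'v \<Rightarrow> 'v"

locale turaev_algebra = group G
  for G :: "('g, 'y) monoid_scheme" (structure)
    and A :: "('g, 'k::field, 'v::ab_group_add) turaev" +
  assumes comp_coalgebra: "a \<in> carrier G \<Longrightarrow> coalgebra (comp A a)"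
    and tmult_coalgebra_map: "a \<in> carrier G \<Longrightarrow> b \<in> carrier G \<Longrightarrow>
      coalgebra_map (tensor_coalg (comp A a) (comp A b)) (comp A (a \<otimes> b)) (tmult A a b)"
    and tunit_coalgebra_map: "coalgebra_map ground_coalg (comp A \<one>) (tunit A)"
    and tmult_assoc: "a \<in> carrier G \<Longrightarrow> b \<in> carrier G \<Longrightarrow> c \<in> carrier G \<Longrightarrow>
      x \<in> vcarrier (comp A a) \<Longrightarrow> y \<in> vcarrier (comp A b) \<Longrightarrow> z \<in> vcarrier (comp A c) \<Longrightarrow>
      tmult A (a \<otimes> b) c (tensor (comp A (a \<otimes> b)) (comp A c)
          (tmult A a b (tensor (comp A a) (comp A b) x y)) z)
        = tmult A a (b \<otimes> c) (tensor (comp A a) (comp A (b \<otimes> c))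
            x (tmult A b c (tensor (comp A b) (comp A c) y z)))"
    and tmult_unit_left: "a \<in> carrier G \<Longrightarrow> x \<in> vcarrier (comp A a) \<Longrightarrow>
      tmult A \<one> a (tensor (comp A \<one>) (comp A a) (tunit A 1) x) = x"
    and tmult_unit_right: "a \<in> carrier G \<Longrightarrow> x \<in> vcarrier (comp A a) \<Longrightarrow>
      tmult A a \<one> (tensor (comp A a) (comp A \<one>) x (tunit A 1)) = x"
    and tantip_lin: "a \<in> carrier G \<Longrightarrow> lin_map (comp A a) (comp A (inv a)) (tantip A a)"
    and tantip_right: "a \<in> carrier G \<Longrightarrow> x \<in> vcarrier (comp A a) \<Longrightarrow>
      tmult A a (inv a) (tensor_map (comp A a) (comp A a) (comp A a) (comp A (inv a))
          id (tantip A a) (comul (comp A a) x))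
        = tunit A (counit (comp A a) x)"
    and tantip_left: "a \<in> carrier G \<Longrightarrow> x \<in> vcarrier (comp A a) \<Longrightarrow>
      tmult A (inv a) a (tensor_map (comp A a) (comp A a) (comp A (inv a)) (comp A a)
          (tantip A a) id (comul (comp A a) x))
        = tunit A (counit (comp A a) x)"

text \<open>\<open>\<psi> b a\<close> is the component of \<open>\<psi>\<^sub>b\<close> on \<open>A\<^sub>a\<close>.\<close>

locale crossed_turaev_algebra = turaev_algebra G A
  for G :: "('g, 'y) monoid_scheme" (structure)
    and A :: "('g, 'k::field, 'v::ab_group_add) turaev" +
  fixes \<psi> :: "'g \<Rightarrow> 'g \<Rightarrow> 'v \<Rightarrow> 'v"
  assumes crossing_iso: "a \<in> carrier G \<Longrightarrow> b \<in> carrier G \<Longrightarrow>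
      coalgebra_iso (comp A a) (comp A (b \<otimes> a \<otimes> inv b)) (\<psi> b a)"
    and crossing_mult: "a \<in> carrier G \<Longrightarrow> b \<in> carrier G \<Longrightarrow> c \<in> carrier G \<Longrightarrow>
      x \<in> vcarrier (comp A c) \<Longrightarrow>
      \<psi> a (b \<otimes> c \<otimes> inv b) (\<psi> b c x) = \<psi> (a \<otimes> b) c x"
    and crossing_tmult: "a \<in> carrier G \<Longrightarrow> b \<in> carrier G \<Longrightarrow> c \<in> carrier G \<Longrightarrow>
      t \<in> vcarrier (tensor_space (comp A a) (comp A b)) \<Longrightarrow>
      tmult A (c \<otimes> a \<otimes> inv c) (c \<otimes> b \<otimes> inv c)
          (tensor_map (comp A a) (comp A b) (comp A (c \<otimes> a \<otimes> inv c)) (comp A (c \<otimes> b \<otimes> inv c))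
            (\<psi> c a) (\<psi> c b) t)
        = \<psi> c (a \<otimes> b) (tmult A a b t)"
    and crossing_tunit: "c \<in> carrier G \<Longrightarrow> \<psi> c \<one> (tunit A r) = tunit A r"
    and crossing_tantip: "a \<in> carrier G \<Longrightarrow> b \<in> carrier G \<Longrightarrow> x \<in> vcarrier (comp A a) \<Longrightarrow>
      \<psi> b (inv a) (tantip A a x) = tantip A (b \<otimes> a \<otimes> inv b) (\<psi> b a x)"


section \<open>The dual of a Hopf algebra\<close>

definition dual_space :: "('k::field, 'h::ring_1) hopf \<Rightarrow> ('k, 'h \<Rightarrow> 'k) vspace" where
  "dual_space H = \<lparr>vcarrier = {p. lin_map H ground p}, vscale = fun_scale\<rparr>"

definition conv :: "('k::field, 'h::ring_1) hopf \<Rightarrow> ('h \<Rightarrow> 'k) \<Rightarrow> ('h \<Rightarrow> 'k) \<Rightarrow> 'h \<Rightarrow> 'k" where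
  "conv H p q = (\<lambda>h. tensor_lift H H ground (\<lambda>h\<^sub>1 h\<^sub>2. p h\<^sub>1 * q h\<^sub>2) (comul H h))"

definition dual_comul ::
  "('k::field, 'h::ring_1) hopf \<Rightarrow> ('h \<Rightarrow> 'k) \<Rightarrow> ('h \<Rightarrow> 'k, 'h \<Rightarrow> 'k, 'k) tensor" where
  "dual_comul H p = (THE t. t \<in> vcarrier (tensor_space (dual_space H) (dual_space H)) \<and>
     (\<forall>h h'. tensor_lift (dual_space H) (dual_space H) ground (\<lambda>p\<^sub>1 p\<^sub>2. p\<^sub>1 h * p\<^sub>2 h') t = p (h * h')))"

text \<open>
  A basis \<open>B\<close> is indexed by itself: in sums over \<open>i \<in> B\<close>, the basis vector \<open>h\<^sub>i\<close> is \<open>i\<close> and its dual \<open>h\<^sup>i\<close>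
  is \<open>dual_basis H B i\<close>.
\<close>

definition dual_basis :: "('k::field, 'h::ring_1) hopf \<Rightarrow> 'h set \<Rightarrow> 'h \<Rightarrow> 'h \<Rightarrow> 'k" where
  "dual_basis H B b = (\<lambda>x. module.representation (vscale H) B x b)"


section \<open>The Turaev algebra \<open>CT(H)\<close>\<close>

text \<open>
  All components \<open>H\<^sup>*\<^sup>o\<^sup>p \<bowtie> H(\<alpha>, \<beta>)\<close> share the underlying vector space \<open>H\<^sup>* \<otimes> H\<close>. The inverse of the
  antipode used below is a two-sided inverse because the antipode of a finite-dimensional Hopf
  algebra is bijective.
\<close>

type_synonym ('k, 'h) ct = "('h \<Rightarrow> 'k, 'h, 'k) tensor"

definition CT_space :: "('k::field, 'h::ring_1) hopf \<Rightarrow> ('k, ('k, 'h) ct) vspace" where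
  "CT_space H = tensor_space (dual_space H) H"

definition bowtie :: "('k::field, 'h::ring_1) hopf \<Rightarrow> ('h \<Rightarrow> 'k) \<Rightarrow> 'h \<Rightarrow> ('k, 'h) ct" where
  "bowtie H p h = tensor (dual_space H) H p h"

definition CT_lift :: "('k::field, 'h::ring_1) hopf \<Rightarrow> ('k, 'u::ab_group_add, 'z) vspace_scheme
    \<Rightarrow> (('h \<Rightarrow> 'k) \<Rightarrow> 'h \<Rightarrow> 'u) \<Rightarrow> ('k, 'h) ct \<Rightarrow> 'u" where
  "CT_lift H U b = tensor_lift (dual_space H) H U b"

definition CT_comul :: "('k::field, 'h::ring_1) hopf \<Rightarrow> 'h set \<Rightarrow> ('h \<Rightarrow> 'h) \<times> ('h \<Rightarrow> 'h)
    \<Rightarrow> ('k, 'h) ct \<Rightarrow> (('k, 'h) ct, ('k, 'h) ct, 'k) tensor" where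
  "CT_comul H B = (\<lambda>(\<alpha>, \<beta>). let T = tensor_space (CT_space H) (CT_space H) in
     CT_lift H T (\<lambda>p h.
       tensor_lift (dual_space H) (dual_space H) T (\<lambda>p\<^sub>1 p\<^sub>2.
         tensor_lift H H T (\<lambda>h\<^sub>1 h\<^sub>2.
           \<Sum>i\<in>B. \<Sum>j\<in>B. tensor (CT_space H) (CT_space H)
             (bowtie H p\<^sub>1 (\<beta> j * h\<^sub>1 * (antipode H)\<^sup>-\<^sup>1 (\<alpha> i)))
             (bowtie H (conv H (conv H (dual_basis H B i) p\<^sub>2) (dual_basis H B j)) h\<^sub>2))
           (comul H h))
         (dual_comul H p)))"

definition CT_counit :: "('k::field, 'h::ring_1) hopf \<Rightarrow> ('k, 'h) ct \<Rightarrow> 'k" where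
  "CT_counit H = CT_lift H ground (\<lambda>p h. p 1 * counit H h)"

definition CT_mult :: "('k::field, 'h::ring_1) hopf
    \<Rightarrow> ('h \<Rightarrow> 'h) \<times> ('h \<Rightarrow> 'h) \<Rightarrow> ('h \<Rightarrow> 'h) \<times> ('h \<Rightarrow> 'h)
    \<Rightarrow> (('k, 'h) ct, ('k, 'h) ct, 'k) tensor \<Rightarrow> ('k, 'h) ct" where
  "CT_mult H = (\<lambda>(\<alpha>, \<beta>) (\<gamma>, \<delta>).
     tensor_lift (CT_space H) (CT_space H) (CT_space H) (\<lambda>x y.
       CT_lift H (CT_space H) (\<lambda>p h.
         CT_lift H (CT_space H) (\<lambda>q h'.
           bowtie H (conv H q p) (\<delta> h * (\<delta> \<circ> \<alpha> \<circ> \<delta>\<^sup>-\<^sup>1) h'))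
         y) x))"

definition CT_unit :: "('k::field, 'h::ring_1) hopf \<Rightarrow> 'k \<Rightarrow> ('k, 'h) ct" where
  "CT_unit H c = fun_scale c (bowtie H (counit H) 1)"

definition CT_antipode :: "('k::field, 'h::ring_1) hopf \<Rightarrow> 'h set
    \<Rightarrow> ('h \<Rightarrow> 'h) \<times> ('h \<Rightarrow> 'h) \<Rightarrow> ('k, 'h) ct \<Rightarrow> ('k, 'h) ct" where
  "CT_antipode H B = (\<lambda>(\<alpha>, \<beta>). CT_lift H (CT_space H) (\<lambda>p h.
     \<Sum>i\<in>B. \<Sum>j\<in>B. bowtie H
       (conv H (conv H (dual_basis H B i) (p \<circ> (antipode H)\<^sup>-\<^sup>1)) (dual_basis H B j \<circ> (antipode H)\<^sup>-\<^sup>1))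
       (\<beta>\<^sup>-\<^sup>1 j * (\<beta>\<^sup>-\<^sup>1 \<circ> \<alpha>\<^sup>-\<^sup>1 \<circ> antipode H) h * (\<beta>\<^sup>-\<^sup>1 \<circ> \<alpha>\<^sup>-\<^sup>1 \<circ> \<beta>) i)))"

definition CT :: "('k::field, 'h::ring_1) hopf \<Rightarrow> 'h set
    \<Rightarrow> (('h \<Rightarrow> 'h) \<times> ('h \<Rightarrow> 'h), 'k, ('k, 'h) ct) turaev" where
  "CT H B =
     \<lparr>comp = (\<lambda>a. \<lparr>vcarrier = vcarrier (CT_space H), vscale = vscale (CT_space H),
        comul = CT_comul H B a, counit = CT_counit H\<rparr>),
      tmult = CT_mult H,
      tunit = CT_unit H,
      tantip = CT_antipode H B\<rparr>"

definition CT_crossing :: "('k::field, 'h::ring_1) hopf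
    \<Rightarrow> ('h \<Rightarrow> 'h) \<times> ('h \<Rightarrow> 'h) \<Rightarrow> ('h \<Rightarrow> 'h) \<times> ('h \<Rightarrow> 'h) \<Rightarrow> ('k, 'h) ct \<Rightarrow> ('k, 'h) ct" where
  "CT_crossing H = (\<lambda>(\<alpha>, \<beta>) (\<gamma>, \<delta>). CT_lift H (CT_space H) (\<lambda>p h.
     bowtie H (p \<circ> (\<alpha>\<^sup>-\<^sup>1 \<circ> \<beta>)) ((\<beta>\<^sup>-\<^sup>1 \<circ> \<delta> \<circ> \<alpha> \<circ> \<delta>\<^sup>-\<^sup>1) h)))"

end

theory Submission
  imports Defs
begin

text \<open>
  Elements of a tensor product are functionals on bilinear forms, so an identity in an iterated
  tensor product of components of \<open>CT(H)\<close> can be tested on products of the functionals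
  \<open>p \<bowtie> h \<mapsto> p(x) f(h)\<close> with \<open>x\<close> in \<open>H\<close> and \<open>f\<close> in \<open>H\<^sup>*\<close>. This amounts to regarding
  \<open>p \<bowtie> h\<close> as the linear map \<open>x \<mapsto> p(x) h\<close>: the sums over dual bases collapse, and the
  comultiplication sends \<open>F\<close> to \<open>(x, y) \<mapsto> \<beta>(y\<^sub>3) F(x y\<^sub>2)\<^sub>1 S'(\<alpha>(y\<^sub>1)) \<otimes> F(x y\<^sub>2)\<^sub>2\<close>, where \<open>S'\<close>
  is the inverse antipode. Every axiom becomes a scalar identity in Sweedler notation on \<open>H\<close>
  itself, which follows from coassociativity and cancellations such as \<open>S'(h\<^sub>2) h\<^sub>1 = \<epsilon>(h)\<close>.
\<close>

section \<open>Linear maps and coordinates\<close>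

text \<open>Two obstacles shape the proof. A pure tensor returns 0 on every form that is not
  bilinear, so an element of a tensor product is linear only along bilinear forms, and the lift of a
  map that is not bilinear is unspecified. Each nested lift in the definitions must therefore be
  shown bilinear before it can be evaluated. In the Sweedler calculus the coproduct is replaced by a
  fixed finite sum that tolerates arbitrary forms, which confines linearity conditions to the places
  where the Hopf axioms enter. The coproduct of \<open>CT(H)\<close> multiplies its second
  functional by dual basis elements on both sides. The resulting sum disappears only once the second
  leg is evaluated at a point; where a product or an antipode is applied to that leg, the summation
  has to be carried inwards until the dual basis functional meets its argument. Finite dimension
  makes the tests finite and the coproduct of the dual exist, and it yields the bijectivity of the
  antipode, which is proved and not assumed. The order of the legs, y1 below \<alpha> and y3 below
  \<beta>, comes from the order of the factors of
  \<open>h\<^sup>i p\<^sub>2 h\<^sup>j\<close>.\<close>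

lemma lin_mapI:
  assumes "\<And>x. x \<in> vcarrier V \<Longrightarrow> f x \<in> vcarrier W"
    and "\<And>x y. x \<in> vcarrier V \<Longrightarrow> y \<in> vcarrier V \<Longrightarrow> f (x + y) = f x + f y"
    and "\<And>c x. x \<in> vcarrier V \<Longrightarrow> f (vscale V c x) = vscale W c (f x)"
  shows "lin_map V W f"
  using assms unfolding lin_map_def by blast

lemma lin_map_carrier: "lin_map V W f \<Longrightarrow> x \<in> vcarrier V \<Longrightarrow> f x \<in> vcarrier W"
  and lin_map_add: "lin_map V W f \<Longrightarrow> x \<in> vcarrier V \<Longrightarrow> y \<in> vcarrier V \<Longrightarrow> f (x + y) = f x + f y"
  and lin_map_scale: "lin_map V W f \<Longrightarrow> x \<in> vcarrier V \<Longrightarrow> f (vscale V c x) = vscale W c (f x)"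
  unfolding lin_map_def by blast+

text \<open>A carrier is closed under the operations that \<open>lin_map\<close> tests, so agreement
  on the carrier is enough. Values off the carrier are arbitrary, which makes this the usual way to
  replace one map by another.\<close>

lemma lin_map_cong:
  assumes "\<And>x. x \<in> vcarrier V \<Longrightarrow> f x = g x" "lin_map V W f" "vspace V"
  shows "lin_map V W g"
proof -
  interpret v: vector_space "vscale V" using assms(3) by (rule vspace.ambient)
  have s: "v.subspace (vcarrier V)" using assms(3) by (rule vspace.subspace)
  show ?thesis
    using assms(2) by (auto simp: lin_map_def v.subspace_add[OF s] v.subspace_scale[OF s]
        simp flip: assms(1))
qed

lemma vspace_add: "vspace V \<Longrightarrow> x \<in> vcarrier V \<Longrightarrow> y \<in> vcarrier V \<Longrightarrow> x + y \<in> vcarrier V"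
  and vspace_scale: "vspace V \<Longrightarrow> x \<in> vcarrier V \<Longrightarrow> vscale V c x \<in> vcarrier V"
  and vspace_0: "vspace V \<Longrightarrow> 0 \<in> vcarrier V"
  and vspace_sum: "vspace V \<Longrightarrow> (\<And>i. i \<in> I \<Longrightarrow> g i \<in> vcarrier V) \<Longrightarrow> sum g I \<in> vcarrier V"
  and vscale_add: "vspace V \<Longrightarrow> vscale V c (x + y) = vscale V c x + vscale V c y"
  and vscale_left_add: "vspace V \<Longrightarrow> vscale V (c + d) x = vscale V c x + vscale V d x"
  and vscale_vscale: "vspace V \<Longrightarrow> vscale V c (vscale V d x) = vscale V (c * d) x"
  and vscale_one: "vspace V \<Longrightarrow> vscale V 1 x = x"
  and vscale_zero: "vspace V \<Longrightarrow> vscale V c 0 = 0"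
  and vscale_sum: "vspace V \<Longrightarrow> vscale V c (sum g I) = (\<Sum>i\<in>I. vscale V c (g i))"
proof -
  assume V: "vspace V"
  interpret v: vector_space "vscale V" using V by (rule vspace.ambient)
  have s: "v.subspace (vcarrier V)" using V by (rule vspace.subspace)
  show "x \<in> vcarrier V \<Longrightarrow> y \<in> vcarrier V \<Longrightarrow> x + y \<in> vcarrier V"
    by (rule v.subspace_add[OF s])
  show "x \<in> vcarrier V \<Longrightarrow> vscale V c x \<in> vcarrier V" by (rule v.subspace_scale[OF s])
  show "0 \<in> vcarrier V" by (rule v.subspace_0[OF s])
  show "sum g I \<in> vcarrier V" if "\<And>i. i \<in> I \<Longrightarrow> g i \<in> vcarrier V"
    by (rule v.subspace_sum[OF s]) (rule that)
  show "vscale V c (x + y) = vscale V c x + vscale V c y" by (rule v.scale_right_distrib)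
  show "vscale V (c + d) x = vscale V c x + vscale V d x" by (rule v.scale_left_distrib)
  show "vscale V c (vscale V d x) = vscale V (c * d) x" by simp
  show "vscale V 1 x = x" "vscale V c 0 = 0" by simp_all
  show "vscale V c (sum g I) = (\<Sum>i\<in>I. vscale V c (g i))" by (rule v.scale_sum_right)
qed

lemma ground_simps [simp]: "vcarrier ground = UNIV" "vscale ground = (*)"
  by (simp_all add: ground_def)

lemma lin_map_0: "vspace V \<Longrightarrow> lin_map V W f \<Longrightarrow> f 0 = 0"
  using lin_map_add[of V W f 0 0] vspace_0 by force

lemma lin_map_sum:
  assumes "vspace V" "lin_map V W f" "\<And>i. i \<in> I \<Longrightarrow> g i \<in> vcarrier V"
  shows "f (sum g I) = (\<Sum>i\<in>I. f (g i))"
  using assms(3)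
proof (induction I rule: infinite_finite_induct)
  case (insert i I)
  then have "sum g I \<in> vcarrier V" by (intro vspace_sum[OF assms(1)]) auto
  then show ?case using insert by (simp add: lin_map_add[OF assms(2)])
qed (simp_all add: lin_map_0[OF assms(1,2)])

lemma lin_map_sum_scale:
  assumes "vspace V" "lin_map V W f" "\<And>i. i \<in> I \<Longrightarrow> g i \<in> vcarrier V"
  shows "f (\<Sum>i\<in>I. vscale V (h i) (g i)) = (\<Sum>i\<in>I. vscale W (h i) (f (g i)))"
  by (subst lin_map_sum[OF assms(1,2)])
    (auto intro!: sum.cong vspace_scale[OF assms(1)] assms(3) lin_map_scale[OF assms(2)])

lemma lin_map_id: "lin_map V V (\<lambda>x. x)"
  by (rule lin_mapI) simp_all

lemma lin_map_comp: "lin_map V W g \<Longrightarrow> lin_map W U f \<Longrightarrow> lin_map V U (\<lambda>v. f (g v))"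
  unfolding lin_map_def by simp

lemma lin_map_plus: "vspace U \<Longrightarrow> lin_map V U f \<Longrightarrow> lin_map V U g \<Longrightarrow> lin_map V U (\<lambda>v. f v + g v)"
  unfolding lin_map_def by (simp add: vspace_add vscale_add ac_simps)

lemma lin_map_zero: "vspace U \<Longrightarrow> lin_map V U (\<lambda>v. 0)"
  unfolding lin_map_def by (simp add: vspace_0 vscale_zero)

lemma lin_map_smult: "vspace U \<Longrightarrow> lin_map V U f \<Longrightarrow> lin_map V U (\<lambda>v. vscale U c (f v))"
  unfolding lin_map_def by (simp add: vspace_scale vscale_add vscale_vscale mult.commute)

lemma lin_map_sums:
  "vspace U \<Longrightarrow> (\<And>i. i \<in> I \<Longrightarrow> lin_map V U (f i)) \<Longrightarrow> lin_map V U (\<lambda>v. \<Sum>i\<in>I. f i v)"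
  by (induction I rule: infinite_finite_induct) (simp_all add: lin_map_zero lin_map_plus)

lemma lin_map_functional:
  "vspace U \<Longrightarrow> lin_map V ground \<phi> \<Longrightarrow> u \<in> vcarrier U \<Longrightarrow> lin_map V U (\<lambda>v. vscale U (\<phi> v) u)"
  unfolding lin_map_def by (simp add: vspace_scale vscale_left_add vscale_vscale)

lemma lin_map_mult_right: "lin_map V ground f \<Longrightarrow> lin_map V ground (\<lambda>v. f v * c)"
  and lin_map_mult_left: "lin_map V ground f \<Longrightarrow> lin_map V ground (\<lambda>v. c * f v)"
  unfolding lin_map_def by (simp_all add: algebra_simps)

lemma bilin_mapI:
  "(\<And>w. w \<in> vcarrier W \<Longrightarrow> lin_map V U (\<lambda>v. b v w)) \<Longrightarrow>
   (\<And>v. v \<in> vcarrier V \<Longrightarrow> lin_map W U (\<lambda>w. b v w)) \<Longrightarrow> bilin_map V W U b"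
  unfolding bilin_map_def by simp

lemma bilin_map_left: "bilin_map V W U b \<Longrightarrow> w \<in> vcarrier W \<Longrightarrow> lin_map V U (\<lambda>v. b v w)"
  and bilin_map_right: "bilin_map V W U b \<Longrightarrow> v \<in> vcarrier V \<Longrightarrow> lin_map W U (\<lambda>w. b v w)"
  unfolding bilin_map_def by simp_all

lemma bilin_map_comp:
  "bilin_map V' W' U b \<Longrightarrow> lin_map V V' f \<Longrightarrow> lin_map W W' g \<Longrightarrow> bilin_map V W U (\<lambda>v w. b (f v) (g w))"
  unfolding bilin_map_def lin_map_def by simp

lemma bilin_map_postcomp:
  "bilin_map V W U b \<Longrightarrow> lin_map U X f \<Longrightarrow> bilin_map V W X (\<lambda>v w. f (b v w))"
  unfolding bilin_map_def lin_map_def by simp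

lemma bilin_map_mult:
  "lin_map V ground f \<Longrightarrow> lin_map W ground g \<Longrightarrow> bilin_map V W ground (\<lambda>v w. f v * g w)"
  by (intro bilin_mapI lin_map_mult_right lin_map_mult_left)

section \<open>Tensor products evaluated on bilinear forms\<close>

lemma tensor_space_simps [simp]: "vscale (tensor_space V W) = fun_scale"
  by (simp add: tensor_space_def)

lemma tensor_apply: "bilin_map V W ground b \<Longrightarrow> tensor V W v w b = b v w"
  by (simp add: tensor_def)

lemma lin_map_eval: "lin_map (tensor_space V W) ground (\<lambda>t. t b)"
  by (rule lin_mapI) (simp_all add: fun_scale_def)

lemma bilin_map_tensor: "bilin_map V W (tensor_space V W) (tensor V W)"
proof -
  have *: "bilin_map V W ground b \<Longrightarrow> v \<in> vcarrier V \<Longrightarrow> w \<in> vcarrier W \<Longrightarrow> v' \<in> vcarrier V \<Longrightarrow>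
      w' \<in> vcarrier W \<Longrightarrow> b (v + v') w = b v w + b v' w \<and> b (vscale V c v) w = c * b v w \<and>
      b v (w + w') = b v w + b v w' \<and> b v (vscale W c w) = c * b v w" for b v w v' w' c
    unfolding bilin_map_def lin_map_def by simp
  show ?thesis
    by (intro bilin_mapI lin_mapI; (rule tensor_in_tensor_space; assumption)?)
      (auto intro!: ext simp: tensor_def fun_scale_def *)
qed

text \<open>Neither form has to be bilinear: agreement on the carriers makes bilinearity of one
  equivalent to that of the other, and if both fail, every pure tensor returns 0 on each. Forms can
  thus be rewritten below an element of the tensor product without linearity obligations.\<close>

lemma tensor_form_cong:
  assumes V: "vspace V" and W: "vspace W"
    and t: "t \<in> vcarrier (tensor_space V W)"
    and eq: "\<And>v w. v \<in> vcarrier V \<Longrightarrow> w \<in> vcarrier W \<Longrightarrow> b v w = b' v w"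
  shows "t b = t b'"
proof (rule lin_map_tensor_unique[OF lin_map_eval lin_map_eval _ t])
  fix v w assume "v \<in> vcarrier V" "w \<in> vcarrier W"
  have "lin_map V ground (\<lambda>v. b v w) \<longleftrightarrow> lin_map V ground (\<lambda>v. b' v w)" if "w \<in> vcarrier W" for w
    using that by (intro iffI; elim lin_map_cong[OF _ _ V, rotated]) (simp_all add: eq)
  moreover have "lin_map W ground (b v) \<longleftrightarrow> lin_map W ground (b' v)" if "v \<in> vcarrier V" for v
    using that by (intro iffI; elim lin_map_cong[OF _ _ W, rotated]) (simp_all add: eq)
  ultimately have "bilin_map V W ground b \<longleftrightarrow> bilin_map V W ground b'"
    unfolding bilin_map_def by blast
  then show "tensor V W v w b = tensor V W v w b'"
    using \<open>v \<in> _\<close> \<open>w \<in> _\<close> by (simp add: tensor_def eq)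
qed

text \<open>Every functional on the tensor product is evaluation at a form, namely the bilinear form
  that it induces on pure tensors.\<close>

lemma functional_tensor:
  assumes "lin_map (tensor_space V W) ground \<phi>" "t \<in> vcarrier (tensor_space V W)"
  shows "\<phi> t = t (\<lambda>v w. \<phi> (tensor V W v w))"
  by (rule lin_map_tensor_unique[OF assms(1) lin_map_eval _ assms(2)])
    (simp add: tensor_apply bilin_map_postcomp[OF bilin_map_tensor assms(1)])

text \<open>Makes the lift computable although it is given by choice: followed by a functional, it
  is linear and agrees with an evaluation on pure tensors.\<close>

lemma tensor_lift_eval:
  assumes U: "vspace U" and b: "bilin_map V W U b" and \<phi>: "lin_map U ground \<phi>"
    and t: "t \<in> vcarrier (tensor_space V W)"
  shows "\<phi> (tensor_lift V W U b t) = t (\<lambda>v w. \<phi> (b v w))"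
  by (rule lin_map_tensor_unique[OF lin_map_comp[OF lin_map_tensor_lift[OF U b] \<phi>] lin_map_eval _ t])
    (simp add: tensor_apply bilin_map_postcomp[OF b \<phi>] tensor_lift_tensor[OF U b])

lemma tensor_lift_ground:
  assumes "bilin_map V W ground b" "t \<in> vcarrier (tensor_space V W)"
  shows "tensor_lift V W ground b t = t b"
  using tensor_lift_eval[OF vspace_ground assms(1) lin_map_id assms(2)] .

text \<open>Additivity of \<open>s\<close> cannot be applied to the forms directly: a sum of two
  forms may be bilinear while the summands are not, and then pure tensors do not respect the sum.
  Hence bilinearity is required at every value of the parameter.\<close>

lemma lin_map_form_param:
  assumes Y: "\<And>y. y \<in> vcarrier Y \<Longrightarrow> bilin_map V W ground (\<lambda>v w. b v w y)"
    and l: "\<And>v w. v \<in> vcarrier V \<Longrightarrow> w \<in> vcarrier W \<Longrightarrow> lin_map Y ground (\<lambda>y. b v w y)"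
    and s: "s \<in> vcarrier (tensor_space V W)" and vY: "vspace Y"
  shows "lin_map Y ground (\<lambda>y. s (\<lambda>v w. b v w y))"
proof (rule lin_mapI)
  fix x y assume xy: "x \<in> vcarrier Y" "y \<in> vcarrier Y"
  show "s (\<lambda>v w. b v w (x + y)) = s (\<lambda>v w. b v w x) + s (\<lambda>v w. b v w y)"
    by (rule lin_map_tensor_unique[OF lin_map_eval
          lin_map_plus[OF vspace_ground lin_map_eval lin_map_eval] _ s])
      (simp add: tensor_apply Y xy vspace_add[OF vY] lin_map_add[OF l])
next
  fix c y assume y: "y \<in> vcarrier Y"
  have "s (\<lambda>v w. b v w (vscale Y c y)) = c * s (\<lambda>v w. b v w y)"
    by (rule lin_map_tensor_unique[OF lin_map_eval lin_map_mult_left[OF lin_map_eval] _ s])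
      (simp add: tensor_apply Y y vspace_scale[OF vY] lin_map_scale[OF l])
  then show "s (\<lambda>v w. b v w (vscale Y c y)) = vscale ground c (s (\<lambda>v w. b v w y))" by simp
qed simp

text \<open>The tool for nested lifts, where the inner lift depends on variables of the outer one
  through its form.\<close>

lemma lin_map_lift_param:
  assumes U: "vspace U" and Y: "\<And>y. y \<in> vcarrier Y \<Longrightarrow> bilin_map V W U (\<lambda>v w. b v w y)"
    and l: "\<And>v w. v \<in> vcarrier V \<Longrightarrow> w \<in> vcarrier W \<Longrightarrow> lin_map Y U (\<lambda>y. b v w y)"
    and s: "s \<in> vcarrier (tensor_space V W)" and vY: "vspace Y"
  shows "lin_map Y U (\<lambda>y. tensor_lift V W U (\<lambda>v w. b v w y) s)"
proof (rule lin_mapI)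
  fix y assume y: "y \<in> vcarrier Y"
  show "tensor_lift V W U (\<lambda>v w. b v w y) s \<in> vcarrier U"
    by (rule lin_map_carrier[OF lin_map_tensor_lift[OF U Y[OF y]] s])
next
  fix x y assume xy: "x \<in> vcarrier Y" "y \<in> vcarrier Y"
  note xy' = vspace_add[OF vY xy]
  show "tensor_lift V W U (\<lambda>v w. b v w (x + y)) s
      = tensor_lift V W U (\<lambda>v w. b v w x) s + tensor_lift V W U (\<lambda>v w. b v w y) s"
    by (rule lin_map_tensor_unique[OF lin_map_tensor_lift[OF U Y[OF xy']]
          lin_map_plus[OF U lin_map_tensor_lift[OF U Y[OF xy(1)]] lin_map_tensor_lift[OF U Y[OF xy(2)]]] _ s])
      (simp add: tensor_lift_tensor U Y xy xy' lin_map_add[OF l])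
next
  fix c y assume y: "y \<in> vcarrier Y"
  note cy = vspace_scale[OF vY y, of c]
  show "tensor_lift V W U (\<lambda>v w. b v w (vscale Y c y)) s
      = vscale U c (tensor_lift V W U (\<lambda>v w. b v w y) s)"
    by (rule lin_map_tensor_unique[OF lin_map_tensor_lift[OF U Y[OF cy]]
          lin_map_smult[OF U lin_map_tensor_lift[OF U Y[OF y]]] _ s])
      (simp add: tensor_lift_tensor U Y y cy lin_map_scale[OF l])
qed

lemma lin_map_tensor_map:
  assumes "lin_map V V' f" "lin_map W W' g"
  shows "lin_map (tensor_space V W) (tensor_space V' W') (tensor_map V W V' W' f g)"
  unfolding tensor_map_def
  by (intro lin_map_tensor_lift vspace_tensor_space bilin_map_comp[OF bilin_map_tensor] assms)

lemma tensor_map_tensor: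
  assumes "lin_map V V' f" "lin_map W W' g" "v \<in> vcarrier V" "w \<in> vcarrier W"
  shows "tensor_map V W V' W' f g (tensor V W v w) = tensor V' W' (f v) (g w)"
  unfolding tensor_map_def
  by (intro tensor_lift_tensor vspace_tensor_space bilin_map_comp[OF bilin_map_tensor] assms)

lemma tensor_map_eval:
  assumes "lin_map V V' f" "lin_map W W' g" "lin_map (tensor_space V' W') ground \<phi>"
    and "t \<in> vcarrier (tensor_space V W)"
  shows "\<phi> (tensor_map V W V' W' f g t) = t (\<lambda>v w. \<phi> (tensor V' W' (f v) (g w)))"
  unfolding tensor_map_def
  by (rule tensor_lift_eval[OF vspace_tensor_space bilin_map_comp[OF bilin_map_tensor assms(1,2)] assms(3,4)])

text \<open>The vectors \<open>e i\<close> need not be linearly independent.\<close>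

definition coords :: "('k::field, 'v::ab_group_add, 'z) vspace_scheme \<Rightarrow> 'i set \<Rightarrow> ('i \<Rightarrow> 'v)
    \<Rightarrow> ('i \<Rightarrow> 'v \<Rightarrow> 'k) \<Rightarrow> bool" where
  "coords V I e c \<longleftrightarrow> finite I \<and> (\<forall>i\<in>I. e i \<in> vcarrier V \<and> lin_map V ground (c i)) \<and>
     (\<forall>v\<in>vcarrier V. v = (\<Sum>i\<in>I. vscale V (c i v) (e i)))"

lemma coords_eqI:
  assumes "coords V I e c" "v \<in> vcarrier V" "w \<in> vcarrier V" "\<And>i. i \<in> I \<Longrightarrow> c i v = c i w"
  shows "v = w"
proof -
  have "v = (\<Sum>i\<in>I. vscale V (c i v) (e i))" using assms(1,2) unfolding coords_def by blast
  also have "\<dots> = (\<Sum>i\<in>I. vscale V (c i w) (e i))" using assms(4) by simp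
  also have "w = \<dots>" using assms(1,3) unfolding coords_def by blast
  then have "(\<Sum>i\<in>I. vscale V (c i w) (e i)) = w" by (rule sym)
  finally show ?thesis .
qed

lemma coords_lin_map:
  assumes "coords V I e c" "vspace V" "lin_map V W f" "v \<in> vcarrier V"
  shows "f v = (\<Sum>i\<in>I. vscale W (c i v) (f (e i)))"
proof -
  have "f v = f (\<Sum>i\<in>I. vscale V (c i v) (e i))"
    using assms(1,4) unfolding coords_def by (intro arg_cong[of _ _ f]) blast
  also have "\<dots> = (\<Sum>i\<in>I. vscale W (c i v) (f (e i)))"
    using assms(1) unfolding coords_def by (intro lin_map_sum_scale[OF assms(2,3)]) blast
  finally show ?thesis .
qed

lemma coords_bilin_map:
  assumes V: "coords V I e c" "vspace V" and W: "coords W J f d" "vspace W"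
    and U: "vspace U" and b: "bilin_map V W U b" and v: "v \<in> vcarrier V" and w: "w \<in> vcarrier W"
  shows "b v w = (\<Sum>i\<in>I. \<Sum>j\<in>J. vscale U (c i v * d j w) (b (e i) (f j)))"
proof -
  have "b v w = (\<Sum>i\<in>I. vscale U (c i v) (b (e i) w))"
    by (rule coords_lin_map[OF V bilin_map_left[OF b w] v])
  also have "\<dots> = (\<Sum>i\<in>I. vscale U (c i v) (\<Sum>j\<in>J. vscale U (d j w) (b (e i) (f j))))"
    using V(1) by (intro sum.cong refl arg_cong[of _ _ "vscale U _"] coords_lin_map[OF W _ w])
      (auto simp: coords_def intro: bilin_map_right[OF b])
  finally show ?thesis by (simp add: vscale_sum[OF U] vscale_vscale[OF U])
qed

lemma tensor_lift_coords:
  assumes V: "coords V I e c" "vspace V" and W: "coords W J f d" "vspace W"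
    and U: "vspace U" and b: "bilin_map V W U b" and t: "t \<in> vcarrier (tensor_space V W)"
  shows "tensor_lift V W U b t
    = (\<Sum>i\<in>I. \<Sum>j\<in>J. vscale U (t (\<lambda>v w. c i v * d j w)) (b (e i) (f j)))"
proof (rule lin_map_tensor_unique[OF lin_map_tensor_lift[OF U b] _ _ t])
  have bij: "b (e i) (f j) \<in> vcarrier U" if "i \<in> I" "j \<in> J" for i j
    by (rule lin_map_carrier[OF bilin_map_left[OF b]]) (use that V(1) W(1) in \<open>simp_all add: coords_def\<close>)
  show "lin_map (tensor_space V W) U
      (\<lambda>t. \<Sum>i\<in>I. \<Sum>j\<in>J. vscale U (t (\<lambda>v w. c i v * d j w)) (b (e i) (f j)))"
    by (intro lin_map_sums lin_map_functional lin_map_eval U bij)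
  have bl: "bilin_map V W ground (\<lambda>v w. c i v * d j w)" if "i \<in> I" "j \<in> J" for i j
    using that V(1) W(1) unfolding coords_def by (intro bilin_map_mult) auto
  show "tensor_lift V W U b (tensor V W v w)
      = (\<Sum>i\<in>I. \<Sum>j\<in>J. vscale U (tensor V W v w (\<lambda>v w. c i v * d j w)) (b (e i) (f j)))"
    if "v \<in> vcarrier V" "w \<in> vcarrier W" for v w
    using that coords_bilin_map[OF V W U b that] by (simp add: tensor_lift_tensor[OF U b] tensor_apply bl)
qed

text \<open>The value at a bilinear form is determined by the values at finitely many products of
  coordinates. This finite sum later serves as the definition of \<open>sw\<close>.\<close>

lemma form_coords:
  assumes "coords V I e c" "vspace V" and "coords W J f d" "vspace W"
    and "bilin_map V W ground b" and "t \<in> vcarrier (tensor_space V W)"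
  shows "t b = (\<Sum>i\<in>I. \<Sum>j\<in>J. t (\<lambda>v w. c i v * d j w) * b (e i) (f j))"
  using tensor_lift_coords[OF assms(1-4) vspace_ground assms(5,6)] tensor_lift_ground[OF assms(5,6)]
  by simp

text \<open>Iterating this provides coordinates on threefold tensor products, on which both sides of
  coassociativity can be compared.\<close>

lemma coords_tensor:
  assumes V: "coords V I e c" "vspace V" and W: "coords W J f d" "vspace W"
  shows "coords (tensor_space V W) (I \<times> J) (\<lambda>(i, j). tensor V W (e i) (f j))
    (\<lambda>(i, j) t. t (\<lambda>v w. c i v * d j w))"
  unfolding coords_def
proof (intro conjI ballI)
  show "finite (I \<times> J)" using V W by (simp add: coords_def)
next
  fix ij assume "ij \<in> I \<times> J"
  then show "(case ij of (i, j) \<Rightarrow> tensor V W (e i) (f j)) \<in> vcarrier (tensor_space V W)"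
    using V W by (auto simp: coords_def intro: tensor_in_tensor_space)
  show "lin_map (tensor_space V W) ground (case ij of (i, j) \<Rightarrow> \<lambda>t. t (\<lambda>v w. c i v * d j w))"
    by (auto simp: lin_map_eval split: prod.split)
next
  fix t assume t: "t \<in> vcarrier (tensor_space V W)"
  \<comment> \<open>The identity map is the lift of \<open>tensor V W\<close>, so the coordinate
    expansion of lifts applies to it.\<close>
  have "t = tensor_lift V W (tensor_space V W) (tensor V W) t"
    by (rule lin_map_tensor_unique[OF lin_map_id lin_map_tensor_lift[OF vspace_tensor_space
        bilin_map_tensor] _ t])
      (simp add: tensor_lift_tensor[OF vspace_tensor_space bilin_map_tensor])
  also have "\<dots> = (\<Sum>i\<in>I. \<Sum>j\<in>J. fun_scale (t (\<lambda>v w. c i v * d j w)) (tensor V W (e i) (f j)))"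
    using tensor_lift_coords[OF V W vspace_tensor_space bilin_map_tensor t] by simp
  finally show "t = (\<Sum>ij\<in>I \<times> J. vscale (tensor_space V W)
      ((case ij of (i, j) \<Rightarrow> \<lambda>t. t (\<lambda>v w. c i v * d j w)) t)
      (case ij of (i, j) \<Rightarrow> tensor V W (e i) (f j)))"
    by (simp add: sum.cartesian_product case_prod_unfold)
qed

section \<open>Coalgebras in terms of multilinear forms\<close>

definition trilin :: "('k::field, 'v::ab_group_add, 'z) vspace_scheme \<Rightarrow> ('v \<Rightarrow> 'v \<Rightarrow> 'v \<Rightarrow> 'k) \<Rightarrow> bool" where
  "trilin C t \<longleftrightarrow> (\<forall>x\<in>vcarrier C. \<forall>y\<in>vcarrier C. lin_map C ground (\<lambda>u. t u x y) \<and>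
     lin_map C ground (\<lambda>u. t x u y) \<and> lin_map C ground (\<lambda>u. t x y u))"

text \<open>Makes it possible to evaluate an element of V \<otimes> (V \<otimes> V) at a trilinear
  form on V.\<close>

lemma bilin_map_nested_form:
  assumes V: "vspace V" and t: "trilin V t"
  shows "bilin_map V (tensor_space V V) ground (\<lambda>a s. s (\<lambda>u v. t a u v))"
proof (rule bilin_mapI)
  have tb: "bilin_map V V ground (t y)" if "y \<in> vcarrier V" for y
    using t that unfolding trilin_def bilin_map_def by blast
  have tl: "lin_map V ground (\<lambda>y. t y v w)" if "v \<in> vcarrier V" "w \<in> vcarrier V" for v w
    using t that unfolding trilin_def by blast
  show "lin_map V ground (\<lambda>v. s (t v))" if "s \<in> vcarrier (tensor_space V V)" for s
    using lin_map_form_param[of V V V "\<lambda>u v a. t a u v", OF tb tl that V] .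
  show "lin_map (tensor_space V V) ground (\<lambda>s. s (t v))" for v
    by (rule lin_map_eval)
qed

lemma tensor_assoc_bilin:
  fixes U V W
  defines "T \<equiv> tensor_space U (tensor_space V W)"
  assumes W: "vspace W"
  shows "w \<in> vcarrier W \<Longrightarrow> bilin_map U V T (\<lambda>u v. tensor U (tensor_space V W) u (tensor V W v w))"
    and "bilin_map (tensor_space U V) W T
       (\<lambda>t w. tensor_lift U V T (\<lambda>u v. tensor U (tensor_space V W) u (tensor V W v w)) t)"
proof -
  let ?f = "\<lambda>w u v. tensor U (tensor_space V W) u (tensor V W v w)"
  have T: "vspace T" unfolding T_def by (rule vspace_tensor_space)
  have bT: "bilin_map U (tensor_space V W) T (tensor U (tensor_space V W))"
    unfolding T_def by (rule bilin_map_tensor)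
  show b: "bilin_map U V T (?f w)" if "w \<in> vcarrier W" for w
    using bilin_map_comp[OF bT lin_map_id bilin_map_left[OF bilin_map_tensor that]] .
  have l: "lin_map W T (\<lambda>w. ?f w u v)" if "u \<in> vcarrier U" "v \<in> vcarrier V" for u v
    by (rule lin_map_comp[OF bilin_map_right[OF bilin_map_tensor that(2)] bilin_map_right[OF bT that(1)]])
  show "bilin_map (tensor_space U V) W T (\<lambda>t w. tensor_lift U V T (?f w) t)"
    by (rule bilin_mapI) (rule lin_map_tensor_lift[OF T b], assumption,
        rule lin_map_lift_param[OF T b l _ W])
qed

lemma lin_map_tensor_assoc:
  "vspace W \<Longrightarrow> lin_map (tensor_space (tensor_space U V) W) (tensor_space U (tensor_space V W))
      (tensor_assoc U V W)"
  unfolding tensor_assoc_def by (rule lin_map_tensor_lift[OF vspace_tensor_space tensor_assoc_bilin(2)])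

lemma tensor_assoc_tensor_eval:
  assumes "vspace W" "lin_map (tensor_space U (tensor_space V W)) ground \<phi>"
    and "s \<in> vcarrier (tensor_space U V)" "w \<in> vcarrier W"
  shows "\<phi> (tensor_assoc U V W (tensor (tensor_space U V) W s w))
    = s (\<lambda>u v. \<phi> (tensor U (tensor_space V W) u (tensor V W v w)))"
  unfolding tensor_assoc_def
    tensor_lift_tensor[OF vspace_tensor_space tensor_assoc_bilin(2)[OF assms(1)] assms(3,4)]
  by (rule tensor_lift_eval[OF vspace_tensor_space tensor_assoc_bilin(1)[OF assms(1,4)] assms(2,3)])

context
  fixes C :: "('k::field, 'v::ab_group_add, 'z) coalg_scheme"
  assumes V: "vspace C" and l: "lin_map C (tensor_space C C) (comul C)"
begin

context
  fixes \<phi> assumes \<phi>: "lin_map (tensor_space C (tensor_space C C)) ground \<phi>"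
begin

lemma lin_map_\<phi>_right: "a \<in> vcarrier C \<Longrightarrow> lin_map (tensor_space C C) ground (\<lambda>s. \<phi> (tensor C
    (tensor_space C C) a s))"
  using bilin_map_right[OF bilin_map_postcomp[OF bilin_map_tensor \<phi>]] .

text \<open>Under a functional, \<open>tensor_map\<close> turns into a nested application of
  \<open>comul\<close> to forms, which is Sweedler notation. The left side of coassociativity is
  treated in the same way below.\<close>

lemma coassoc_right_eval:
  assumes x: "x \<in> vcarrier C"
  shows "\<phi> (tensor_map C C C (tensor_space C C) id (comul C) (comul C x))
    = comul C x (\<lambda>a b. comul C b (\<lambda>u v. \<phi> (tensor C (tensor_space C C) a (tensor C C u v))))"
proof -
  have "\<phi> (tensor_map C C C (tensor_space C C) id (comul C) (comul C x))
    = comul C x (\<lambda>a b. \<phi> (tensor C (tensor_space C C) a (comul C b)))"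
    using tensor_map_eval[OF lin_map_id l \<phi> lin_map_carrier[OF l x]] by (simp add: id_def)
  also have "\<dots> = comul C x (\<lambda>a b. comul C b (\<lambda>u v. \<phi> (tensor C (tensor_space C C) a (tensor C C u v))))"
    by (intro tensor_form_cong[OF V V lin_map_carrier[OF l x]] functional_tensor lin_map_\<phi>_right
        lin_map_carrier[OF l])
  finally show ?thesis .
qed

lemma coassoc_left_eval:
  assumes x: "x \<in> vcarrier C"
  shows "\<phi> (tensor_assoc C C C (tensor_map C C (tensor_space C C) C (comul C) id (comul C x)))
    = comul C x (\<lambda>a b. comul C a (\<lambda>u v. \<phi> (tensor C (tensor_space C C) u (tensor C C v b))))"
proof -
  have "\<phi> (tensor_assoc C C C (tensor_map C C (tensor_space C C) C (comul C) id (comul C x)))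
    = comul C x (\<lambda>a b. \<phi> (tensor_assoc C C C (tensor (tensor_space C C) C (comul C a) b)))"
    using tensor_map_eval[OF l lin_map_id lin_map_comp[OF lin_map_tensor_assoc[OF V] \<phi>] lin_map_carrier[OF l x]]
    by (simp add: id_def)
  also have "\<dots> = comul C x (\<lambda>a b. comul C a (\<lambda>u v. \<phi> (tensor C (tensor_space C C) u (tensor C C v b))))"
    by (intro tensor_form_cong[OF V V lin_map_carrier[OF l x]] tensor_assoc_tensor_eval V \<phi>
        lin_map_carrier[OF l])
  finally show ?thesis .
qed

end

lemma coassoc_carriers:
  assumes x: "x \<in> vcarrier C"
  shows "tensor_assoc C C C (tensor_map C C (tensor_space C C) C (comul C) id (comul C x))
      \<in> vcarrier (tensor_space C (tensor_space C C))"
    and "tensor_map C C C (tensor_space C C) id (comul C) (comul C x)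
      \<in> vcarrier (tensor_space C (tensor_space C C))"
proof -
  have id: "lin_map C C id" using lin_map_id[of C] by (simp add: id_def)
  show "tensor_assoc C C C (tensor_map C C (tensor_space C C) C (comul C) id (comul C x))
      \<in> vcarrier (tensor_space C (tensor_space C C))"
    by (rule lin_map_carrier[OF lin_map_comp[OF lin_map_tensor_map[OF l id] lin_map_tensor_assoc[OF V]]
          lin_map_carrier[OF l x]])
  show "tensor_map C C C (tensor_space C C) id (comul C) (comul C x)
      \<in> vcarrier (tensor_space C (tensor_space C C))"
    by (rule lin_map_carrier[OF lin_map_tensor_map[OF id l] lin_map_carrier[OF l x]])
qed

end

text \<open>Both sides are values of one functional, evaluation at the nested form of
  \<open>t\<close>, on the two sides of coassociativity.\<close>

lemma (in coalgebra) coassoc_trilin: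
  assumes x: "x \<in> vcarrier C" and t: "trilin C t"
  shows "comul C x (\<lambda>a b. comul C a (\<lambda>u v. t u v b)) = comul C x (\<lambda>a b. comul C b (\<lambda>u v. t a u v))"
proof -
  note V = vspace_axioms and l = comul_lin
  define \<phi> where "\<phi> r = r (\<lambda>a s. s (\<lambda>u v. t a u v))" for r :: "('v, ('v, 'v, 'k) tensor, 'k) tensor"
  have \<phi>: "lin_map (tensor_space C (tensor_space C C)) ground \<phi>"
    unfolding \<phi>_def by (rule lin_map_eval)
  have tb: "bilin_map C C ground (t u)" if "u \<in> vcarrier C" for u
    using t that unfolding trilin_def bilin_map_def by blast
  have *: "\<phi> (tensor C (tensor_space C C) u (tensor C C v w)) = t u v w"
    if "u \<in> vcarrier C" "v \<in> vcarrier C" "w \<in> vcarrier C" for u v w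
    unfolding \<phi>_def
    by (simp add: tensor_apply[OF bilin_map_nested_form[OF V t]] tensor_apply[OF tb] that)
  have "comul C x (\<lambda>a b. comul C a (\<lambda>u v. t u v b))
      = \<phi> (tensor_assoc C C C (tensor_map C C (tensor_space C C) C (comul C) id (comul C x)))"
    unfolding coassoc_left_eval[OF V l \<phi> x]
    by (rule tensor_form_cong[OF V V lin_map_carrier[OF l x]],
        rule tensor_form_cong[OF V V lin_map_carrier[OF l]], assumption, rule *[symmetric])
  also have "\<dots> = \<phi> (tensor_map C C C (tensor_space C C) id (comul C) (comul C x))"
    by (simp only: coassoc[OF x])
  also have "\<dots> = comul C x (\<lambda>a b. comul C b (\<lambda>u v. t a u v))"
    unfolding coassoc_right_eval[OF V l \<phi> x]
    by (rule tensor_form_cong[OF V V lin_map_carrier[OF l x]],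
        rule tensor_form_cong[OF V V lin_map_carrier[OF l]], assumption, rule *)
  finally show ?thesis .
qed

lemma
  assumes V: "vspace C" and \<epsilon>: "lin_map C ground \<epsilon>" and t: "t \<in> vcarrier (tensor_space C C)"
  shows contract_left_carrier: "tensor_lift C C C (\<lambda>x\<^sub>1 x\<^sub>2. vscale C (\<epsilon> x\<^sub>1) x\<^sub>2) t \<in> vcarrier C"
    and contract_right_carrier: "tensor_lift C C C (\<lambda>x\<^sub>1 x\<^sub>2. vscale C (\<epsilon> x\<^sub>2) x\<^sub>1) t \<in> vcarrier C"
    and contract_left_eval: "lin_map C ground f \<Longrightarrow> f (tensor_lift C C C (\<lambda>x\<^sub>1 x\<^sub>2. vscale C (\<epsilon> x\<^sub>1) x\<^sub>2) t) =
        t (\<lambda>a b. \<epsilon> a * f b)"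
    and contract_right_eval: "lin_map C ground f \<Longrightarrow> f (tensor_lift C C C (\<lambda>x\<^sub>1 x\<^sub>2. vscale C (\<epsilon> x\<^sub>2) x\<^sub>1) t)
        = t (\<lambda>a b. f a * \<epsilon> b)"
proof -
  have b: "bilin_map C C C (\<lambda>x\<^sub>1 x\<^sub>2. vscale C (\<epsilon> x\<^sub>1) x\<^sub>2)" "bilin_map C C C (\<lambda>x\<^sub>1 x\<^sub>2. vscale C (\<epsilon> x\<^sub>2) x\<^sub>1)"
    by (intro bilin_mapI lin_map_functional lin_map_smult lin_map_id V \<epsilon>; assumption)+
  show "tensor_lift C C C (\<lambda>x\<^sub>1 x\<^sub>2. vscale C (\<epsilon> x\<^sub>1) x\<^sub>2) t \<in> vcarrier C" "tensor_lift C C C (\<lambda>x\<^sub>1 x\<^sub>2.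
      vscale C (\<epsilon> x\<^sub>2) x\<^sub>1) t \<in> vcarrier C"
    by (rule lin_map_carrier[OF lin_map_tensor_lift[OF V b(1)] t] lin_map_carrier[OF
        lin_map_tensor_lift[OF V b(2)] t])+
  assume f: "lin_map C ground f"
  show "f (tensor_lift C C C (\<lambda>x\<^sub>1 x\<^sub>2. vscale C (\<epsilon> x\<^sub>1) x\<^sub>2) t) = t (\<lambda>a b. \<epsilon> a * f b)" "f (tensor_lift C C
      C (\<lambda>x\<^sub>1 x\<^sub>2. vscale C (\<epsilon> x\<^sub>2) x\<^sub>1) t) = t (\<lambda>a b. f a * \<epsilon> b)"
    unfolding tensor_lift_eval[OF V b(1) f t] tensor_lift_eval[OF V b(2) f t]
    by (rule tensor_form_cong[OF V V t], simp add: lin_map_scale[OF f])+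
qed

lemma (in coalgebra)
  assumes x: "x \<in> vcarrier C" and f: "lin_map C ground f"
  shows counit_left_form: "comul C x (\<lambda>a b. counit C a * f b) = f x"
    and counit_right_form: "comul C x (\<lambda>a b. f a * counit C b) = f x"
  using contract_left_eval[OF vspace_axioms counit_lin lin_map_carrier[OF comul_lin x] f]
    contract_right_eval[OF vspace_axioms counit_lin lin_map_carrier[OF comul_lin x] f]
  by (simp_all add: counit_left[OF x] counit_right[OF x])

text \<open>With finitely many coordinates, the counit laws are scalar equations for each
  coordinate, and coassociativity is a family of scalar equations indexed by triples of
  coordinates.\<close>

lemma coalgebraI:
  fixes C :: "('k::field, 'v::ab_group_add, 'z) coalg_scheme"
  assumes V: "vspace C" and co: "coords C I e c"
    and l: "lin_map C (tensor_space C C) (comul C)" and l': "lin_map C ground (counit C)"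
    and coassoc: "\<And>x i j k. x \<in> vcarrier C \<Longrightarrow> i \<in> I \<Longrightarrow> j \<in> I \<Longrightarrow> k \<in> I \<Longrightarrow>
      comul C x (\<lambda>a b. comul C a (\<lambda>u v. c i u * c j v) * c k b)
        = comul C x (\<lambda>a b. c i a * comul C b (\<lambda>u v. c j u * c k v))"
    and left: "\<And>x i. x \<in> vcarrier C \<Longrightarrow> i \<in> I \<Longrightarrow> comul C x (\<lambda>a b. counit C a * c i b) = c i x"
    and right: "\<And>x i. x \<in> vcarrier C \<Longrightarrow> i \<in> I \<Longrightarrow> comul C x (\<lambda>a b. c i a * counit C b) = c i x"
  shows "coalgebra C"
proof (intro coalgebra.intro coalgebra_axioms.intro V l l')
  have ci: "lin_map C ground (c i)" if "i \<in> I" for i using co that by (simp add: coords_def)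
  fix x assume x: "x \<in> vcarrier C"
  note lx = lin_map_carrier[OF l x]
  show "tensor_lift C C C (\<lambda>x\<^sub>1 x\<^sub>2. vscale C (counit C x\<^sub>1) x\<^sub>2) (comul C x) = x"
    by (rule coords_eqI[OF co contract_left_carrier[OF V l' lx] x])
      (simp add: contract_left_eval[OF V l' lx ci] left[OF x])
  show "tensor_lift C C C (\<lambda>x\<^sub>1 x\<^sub>2. vscale C (counit C x\<^sub>2) x\<^sub>1) (comul C x) = x"
    by (rule coords_eqI[OF co contract_right_carrier[OF V l' lx] x])
      (simp add: contract_right_eval[OF V l' lx ci] right[OF x])
  let ?T = "tensor_space C (tensor_space C C)"
  have coT: "coords ?T (I \<times> (I \<times> I))
      (\<lambda>(i, jk). tensor C (tensor_space C C) (e i) (case jk of (j, k) \<Rightarrow> tensor C C (e j) (e k)))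
      (\<lambda>(i, jk) r. r (\<lambda>a s. c i a * (case jk of (j, k) \<Rightarrow> \<lambda>t. t (\<lambda>u v. c j u * c k v)) s))"
    by (rule coords_tensor[OF co V coords_tensor[OF co V co V] vspace_tensor_space])
  show "tensor_assoc C C C (tensor_map C C (tensor_space C C) C (comul C) id (comul C x))
      = tensor_map C C C (tensor_space C C) id (comul C) (comul C x)"
  proof (rule coords_eqI[OF coT coassoc_carriers[OF V l x]])
    fix ijk assume "ijk \<in> I \<times> (I \<times> I)"
    then obtain i j k where ijk: "ijk = (i, (j, k))" and i: "i \<in> I" and j: "j \<in> I" and k: "k \<in> I"
      by blast
    define \<phi> where "\<phi> r = r (\<lambda>a s. c i a * s (\<lambda>u v. c j u * c k v))"
      for r :: "('v, ('v, 'v, 'k) tensor, 'k) tensor"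
    have \<phi>: "lin_map (tensor_space C (tensor_space C C)) ground \<phi>"
      unfolding \<phi>_def by (rule lin_map_eval)
    have *: "\<phi> (tensor C (tensor_space C C) u (tensor C C v w)) = c i u * (c j v * c k w)" for u v w
      unfolding \<phi>_def
      by (simp add: tensor_apply[OF bilin_map_mult[OF ci[OF i] lin_map_eval]]
          tensor_apply[OF bilin_map_mult[OF ci[OF j] ci[OF k]]])
    have "\<phi> (tensor_assoc C C C (tensor_map C C (tensor_space C C) C (comul C) id (comul C x)))
        = comul C x (\<lambda>a b. comul C a (\<lambda>u v. c i u * (c j v * c k b)))"
      unfolding coassoc_left_eval[OF V l \<phi> x] * ..
    also have "\<dots> = comul C x (\<lambda>a b. comul C a (\<lambda>u v. c i u * c j v) * c k b)"
    proof (rule tensor_form_cong[OF V V lx])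
      fix a b assume "a \<in> vcarrier C"
      \<comment> \<open>The scalar is moved out by comparing linear maps on pure tensors, since
        \<open>comul C a\<close> is linear only along bilinear forms.\<close>
      show "comul C a (\<lambda>u v. c i u * (c j v * c k b)) = comul C a (\<lambda>u v. c i u * c j v) * c k b"
        by (rule lin_map_tensor_unique[OF lin_map_eval lin_map_mult_right[OF lin_map_eval] _
              lin_map_carrier[OF l \<open>a \<in> _\<close>]])
          (simp add: tensor_apply[OF bilin_map_mult[OF ci[OF i] ci[OF j]]]
            tensor_apply[OF bilin_map_mult[OF ci[OF i] lin_map_mult_right[OF ci[OF j]]]])
    qed
    also have "\<dots> = comul C x (\<lambda>a b. c i a * comul C b (\<lambda>u v. c j u * c k v))"
      by (rule coassoc[OF x i j k])
    also have "\<dots> = comul C x (\<lambda>a b. comul C b (\<lambda>u v. c i a * (c j u * c k v)))"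
    proof (rule tensor_form_cong[OF V V lx])
      fix a b assume "b \<in> vcarrier C"
      show "c i a * comul C b (\<lambda>u v. c j u * c k v) = comul C b (\<lambda>u v. c i a * (c j u * c k v))"
        by (rule lin_map_tensor_unique[OF lin_map_mult_left[OF lin_map_eval] lin_map_eval _
              lin_map_carrier[OF l \<open>b \<in> _\<close>]])
          (simp add: tensor_apply[OF bilin_map_mult[OF ci[OF j] ci[OF k]]]
            tensor_apply[OF bilin_map_mult[OF lin_map_mult_left[OF ci[OF j]] ci[OF k], unfolded mult.assoc]])
    qed
    also have "\<dots> = \<phi> (tensor_map C C C (tensor_space C C) id (comul C) (comul C x))"
      unfolding coassoc_right_eval[OF V l \<phi> x] * ..
    finally show "(case ijk of (i, jk) \<Rightarrow> \<lambda>r. r (\<lambda>a s. c i a * (case jk of (j, k) \<Rightarrow> \<lambda>t. t (\<lambda>u v. c j u *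
        c k v)) s))
          (tensor_assoc C C C (tensor_map C C (tensor_space C C) C (comul C) id (comul C x)))
        = (case ijk of (i, jk) \<Rightarrow> \<lambda>r. r (\<lambda>a s. c i a * (case jk of (j, k) \<Rightarrow> \<lambda>t. t (\<lambda>u v. c j u * c k v)) s))
          (tensor_map C C C (tensor_space C C) id (comul C) (comul C x))"
      by (simp add: ijk \<phi>_def)
  qed
qed

text \<open>Coordinates are asked of the codomain alone, so that the domain may be a tensor
  coalgebra or the ground field.\<close>

lemma coalgebra_mapI:
  assumes co: "coords D I e c" and V: "vspace C" and W: "vspace D"
    and lC: "lin_map C (tensor_space C C) (comul C)" and lD: "lin_map D (tensor_space D D) (comul D)"
    and f: "lin_map C D f"
    and comul: "\<And>x i j. x \<in> vcarrier C \<Longrightarrow> i \<in> I \<Longrightarrow> j \<in> I \<Longrightarrow>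
      comul D (f x) (\<lambda>u v. c i u * c j v) = comul C x (\<lambda>u v. c i (f u) * c j (f v))"
    and counit: "\<And>x. x \<in> vcarrier C \<Longrightarrow> counit D (f x) = counit C x"
  shows "coalgebra_map C D f"
  unfolding coalgebra_map_def
proof (intro conjI ballI f counit; assumption?)
  have ci: "lin_map D ground (c i)" if "i \<in> I" for i using co that by (simp add: coords_def)
  fix x assume x: "x \<in> vcarrier C"
  note lx = lin_map_carrier[OF lC x]
  show "comul D (f x) = tensor_map C C D D f f (comul C x)"
  proof (rule coords_eqI[OF coords_tensor[OF co W co W]])
    show "comul D (f x) \<in> vcarrier (tensor_space D D)"
      by (rule lin_map_carrier[OF lD lin_map_carrier[OF f x]])
    show "tensor_map C C D D f f (comul C x) \<in> vcarrier (tensor_space D D)"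
      by (rule lin_map_carrier[OF lin_map_tensor_map[OF f f] lx])
    fix ij assume "ij \<in> I \<times> I"
    then obtain i j where ij: "ij = (i, j)" and i: "i \<in> I" and j: "j \<in> I" by blast
    have "tensor_map C C D D f f (comul C x) (\<lambda>u v. c i u * c j v)
        = comul C x (\<lambda>u v. tensor D D (f u) (f v) (\<lambda>u v. c i u * c j v))"
      by (rule tensor_map_eval[OF f f lin_map_eval lx])
    also have "\<dots> = comul C x (\<lambda>u v. c i (f u) * c j (f v))"
      by (simp add: tensor_apply[OF bilin_map_mult[OF ci[OF i] ci[OF j]]])
    finally show "(case ij of (i, j) \<Rightarrow> \<lambda>t. t (\<lambda>v w. c i v * c j w)) (comul D (f x))
        = (case ij of (i, j) \<Rightarrow> \<lambda>t. t (\<lambda>v w. c i v * c j w)) (tensor_map C C D D f f (comul C x))"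
      by (simp add: ij comul[OF x i j])
  qed
qed

lemma coalgebra_map_comul_form:
  assumes "coalgebra_map C D f" "x \<in> vcarrier C" "bilin_map D D ground b"
    and l: "lin_map C (tensor_space C C) (comul C)"
  shows "comul D (f x) b = comul C x (\<lambda>u v. b (f u) (f v))"
proof -
  have f: "lin_map C D f" and "comul D (f x) = tensor_map C C D D f f (comul C x)"
    using assms unfolding coalgebra_map_def by auto
  then show ?thesis
    using tensor_map_eval[OF f f lin_map_eval lin_map_carrier[OF l assms(2)]]
    by (simp add: tensor_apply[OF assms(3)])
qed

section \<open>The tensor product of two coalgebras\<close>

context
  fixes C :: "('k::field, 'v::ab_group_add, 'y) coalg_scheme"
    and D :: "('k, 'w::ab_group_add, 'z) coalg_scheme"
  assumes VC: "vspace C" and VD: "vspace D"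
    and lC: "lin_map C (tensor_space C C) (comul C)" and lD: "lin_map D (tensor_space D D) (comul D)"
begin

lemma middle_swap_bilin:
  defines "CD \<equiv> tensor_space C D"
  defines "T \<equiv> tensor_space CD CD"
  shows "c \<in> vcarrier C \<Longrightarrow> c' \<in> vcarrier C \<Longrightarrow>
      bilin_map D D T (\<lambda>d d'. tensor CD CD (tensor C D c d) (tensor C D c' d'))"
    and "t \<in> vcarrier (tensor_space D D) \<Longrightarrow> bilin_map C C T (\<lambda>c c'. tensor_lift D D T
             (\<lambda>d d'. tensor CD CD (tensor C D c d) (tensor C D c' d')) t)"
    and "bilin_map (tensor_space C C) (tensor_space D D) T
       (\<lambda>s t. tensor_lift C C T
          (\<lambda>c c'. tensor_lift D D T
             (\<lambda>d d'. tensor CD CD (tensor C D c d) (tensor C D c' d')) t) s)"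
proof -
  have T: "vspace T" and CD: "vspace CD" unfolding T_def CD_def by (rule vspace_tensor_space)+
  have b: "bilin_map CD CD T (tensor CD CD)" unfolding T_def by (rule bilin_map_tensor)
  have b': "bilin_map C D CD (tensor C D)" unfolding CD_def by (rule bilin_map_tensor)
  have in_CD: "tensor C D c d \<in> vcarrier CD" if "c \<in> vcarrier C" "d \<in> vcarrier D" for c d
    unfolding CD_def by (rule tensor_in_tensor_space[OF that])
  show 1: "bilin_map D D T (\<lambda>d d'. tensor CD CD (tensor C D c d) (tensor C D c' d'))"
    if "c \<in> vcarrier C" "c' \<in> vcarrier C" for c c'
    by (rule bilin_map_comp[OF b bilin_map_right[OF b' that(1)] bilin_map_right[OF b' that(2)]])
  show 2: "bilin_map C C T (\<lambda>c c'. tensor_lift D D T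
             (\<lambda>d d'. tensor CD CD (tensor C D c d) (tensor C D c' d')) t)"
    if "t \<in> vcarrier (tensor_space D D)" for t
  proof (rule bilin_mapI)
    fix c assume c: "c \<in> vcarrier C"
    have l: "lin_map C T (\<lambda>x. tensor CD CD (tensor C D x d) (tensor C D c d'))"
      "lin_map C T (\<lambda>x. tensor CD CD (tensor C D c d) (tensor C D x d'))"
      if "d \<in> vcarrier D" "d' \<in> vcarrier D" for d d'
      by (rule lin_map_comp[OF bilin_map_left[OF b' that(1)] bilin_map_left[OF b in_CD[OF c that(2)]]]
          lin_map_comp[OF bilin_map_left[OF b' that(2)] bilin_map_right[OF b in_CD[OF c that(1)]]])+
    show "lin_map C T (\<lambda>x. tensor_lift D D T (\<lambda>d d'. tensor CD CD (tensor C D x d) (tensor C D c d')) t)"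
      by (rule lin_map_lift_param[OF T 1[OF _ c] l(1) that VC])
    show "lin_map C T (\<lambda>x. tensor_lift D D T (\<lambda>d d'. tensor CD CD (tensor C D c d) (tensor C D x d')) t)"
      by (rule lin_map_lift_param[OF T 1[OF c] l(2) that VC])
  qed
  show "bilin_map (tensor_space C C) (tensor_space D D) T
       (\<lambda>s t. tensor_lift C C T
          (\<lambda>c c'. tensor_lift D D T
             (\<lambda>d d'. tensor CD CD (tensor C D c d) (tensor C D c' d')) t) s)"
    by (rule bilin_mapI)
      (rule lin_map_tensor_lift[OF T 2], assumption,
       rule lin_map_lift_param[OF T 2 lin_map_tensor_lift[OF T 1] _ vspace_tensor_space])
qed

lemma lin_map_comul_tensor_coalg:
  "lin_map (tensor_space C D) (tensor_space (tensor_space C D) (tensor_space C D))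
    (comul (tensor_coalg C D))"
proof -
  have "lin_map (tensor_space (tensor_space C C) (tensor_space D D))
     (tensor_space (tensor_space C D) (tensor_space C D)) (middle_swap C D)"
    unfolding middle_swap_def Let_def
    by (rule lin_map_tensor_lift[OF vspace_tensor_space middle_swap_bilin(3)])
  from lin_map_comp[OF lin_map_tensor_map[OF lC lD] this]
  show ?thesis by (simp add: tensor_coalg_def o_def)
qed

text \<open>The two nested lifts of \<open>middle_swap\<close> are opened one after the other by
  \<open>tensor_lift_eval\<close>; what remains is the Sweedler rule for the tensor product of
  coalgebras.\<close>

lemma comul_tensor_coalg_form:
  assumes x: "x \<in> vcarrier C" and y: "y \<in> vcarrier D"
    and b: "bilin_map (tensor_space C D) (tensor_space C D) ground b"
  shows "comul (tensor_coalg C D) (tensor C D x y) b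
    = comul C x (\<lambda>c c'. comul D y (\<lambda>d d'. b (tensor C D c d) (tensor C D c' d')))"
proof -
  let ?CD = "tensor_space C D" and ?T = "tensor_space (tensor_space C D) (tensor_space C D)"
  note cx = lin_map_carrier[OF lC x] and cy = lin_map_carrier[OF lD y]
  have "comul (tensor_coalg C D) (tensor C D x y)
      = middle_swap C D (tensor (tensor_space C C) (tensor_space D D) (comul C x) (comul D y))"
    by (simp add: tensor_coalg_def tensor_map_tensor[OF lC lD x y])
  also have "\<dots> = tensor_lift C C ?T
          (\<lambda>c c'. tensor_lift D D ?T
             (\<lambda>d d'. tensor ?CD ?CD (tensor C D c d) (tensor C D c' d')) (comul D y)) (comul C x)"
    unfolding middle_swap_def Let_def
    by (rule tensor_lift_tensor[OF vspace_tensor_space middle_swap_bilin(3) cx cy])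
  finally have "comul (tensor_coalg C D) (tensor C D x y) b = tensor_lift C C ?T
          (\<lambda>c c'. tensor_lift D D ?T
             (\<lambda>d d'. tensor ?CD ?CD (tensor C D c d) (tensor C D c' d')) (comul D y)) (comul C x) b"
    by (rule fun_cong)
  also have "\<dots> = comul C x (\<lambda>c c'. tensor_lift D D ?T
             (\<lambda>d d'. tensor ?CD ?CD (tensor C D c d) (tensor C D c' d')) (comul D y) b)"
    by (rule tensor_lift_eval[OF vspace_tensor_space middle_swap_bilin(2)[OF cy] lin_map_eval cx])
  also have "\<dots> = comul C x (\<lambda>c c'. comul D y (\<lambda>d d'. tensor ?CD ?CD (tensor C D c d) (tensor C D c' d') b))"
  proof (rule tensor_form_cong[OF VC VC cx])
    fix c c' assume "c \<in> vcarrier C" "c' \<in> vcarrier C"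
    from tensor_lift_eval[OF vspace_tensor_space middle_swap_bilin(1)[OF this] lin_map_eval cy]
    show "tensor_lift D D ?T (\<lambda>d d'. tensor ?CD ?CD (tensor C D c d) (tensor C D c' d')) (comul D y) b
      = comul D y (\<lambda>d d'. tensor ?CD ?CD (tensor C D c d) (tensor C D c' d') b)" .
  qed
  finally show ?thesis by (simp add: tensor_apply[OF b])
qed

end

text \<open>Only carrier and scaling matter for these notions, so a coalgebra may be replaced by its
  bare vector space.\<close>

lemma
  assumes "vcarrier V = vcarrier V'" "vscale V = vscale V'" "vcarrier W = vcarrier W'" "vscale W = vscale W'"
  shows lin_map_space_cong: "lin_map V W = lin_map V' W'"
    and tensor_cong: "tensor V W = tensor V' W'"
    and tensor_space_cong: "tensor_space V W = tensor_space V' W'"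
proof -
  show "lin_map V W = lin_map V' W'"
    by (intro ext) (simp add: lin_map_def assms)
  have b: "bilin_map V W ground = bilin_map V' W' ground"
    by (intro ext) (simp add: bilin_map_def lin_map_def assms)
  then show t: "tensor V W = tensor V' W'"
    by (intro ext) (simp add: tensor_def)
  show "tensor_space V W = tensor_space V' W'"
    by (simp add: tensor_space_def t assms)
qed

text \<open>A basis of \<open>W\<close> is mapped to an independent set of the same size; a vector
  of \<open>W\<close> outside the image would enlarge it beyond the dimension. The statement is
  relative to a subspace because it will be applied inside a space of all functions, which need not
  be finite dimensional.\<close>

lemma (in vector_space) injective_endo_onto:
  assumes F: "finite F" "W \<subseteq> span F" and W: "subspace W"
    and L: "Vector_Spaces.linear scale scale L" "inj_on L W" "L ` W \<subseteq> W"
  shows "L ` W = W"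
proof
  interpret L: Vector_Spaces.linear scale scale L by (rule L)
  interpret vector_space_pair scale scale by unfold_locales
  obtain A where A: "A \<subseteq> W" "independent A" "W \<subseteq> span A"
    using maximal_independent_subset[of W] by blast
  have sA: "span A = W" using A span_minimal[OF A(1) W] by blast
  have fA: "finite A" using independent_span_bound[OF F(1) A(2)] A(1) F(2) by blast
  have iA: "inj_on L A" using inj_on_subset[OF L(2) A(1)] .
  have ind: "independent (L ` A)"
    using linear_independent_injective_image[OF L(1) A(2)] L(2) sA by simp
  show "W \<subseteq> L ` W"
  proof (rule ccontr)
    assume "\<not> W \<subseteq> L ` W"
    then obtain y where y: "y \<in> W" "y \<notin> L ` W" by blast
    have "y \<notin> span (L ` A)" using y(2) by (simp add: L.span_image sA)
    then have "independent (insert y (L ` A))"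
      using ind independent_insertI by blast
    moreover have "insert y (L ` A) \<subseteq> span A" using y(1) A(1) L(3) sA by blast
    ultimately have "card (insert y (L ` A)) \<le> card A"
      using independent_span_bound[OF fA] by blast
    moreover have "y \<notin> L ` A" using y(2) A(1) by blast
    ultimately show False using fA by (simp add: card_image[OF iA])
  qed
qed (rule L(3))

lemma sum_fun_apply: "(\<Sum>i\<in>I. f i) x = (\<Sum>i\<in>I. f i x)"
  for f :: "'i \<Rightarrow> 'a \<Rightarrow> 'b::comm_monoid_add"
  by (induction I rule: infinite_finite_induct) simp_all

lemma ground_coalg_simps:
  "vcarrier ground_coalg = UNIV" "vscale ground_coalg = (*)" "counit ground_coalg = id"
  by (simp_all add: ground_coalg_def)

lemma lin_map_ground_coalg_comul:
  "lin_map ground_coalg (tensor_space ground_coalg ground_coalg) (comul (ground_coalg :: ('k::field, 'k)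
      coalg))"
proof -
  let ?G = "ground_coalg :: ('k, 'k) coalg"
  have "tensor_space ?G ?G = tensor_space ground ground"
    by (rule tensor_space_cong) (simp_all add: ground_coalg_simps)
  moreover have "lin_map ?G = (lin_map ground :: ('k, ('k, 'k, 'k) tensor) vspace \<Rightarrow> _)"
    by (intro ext lin_map_space_cong[THEN fun_cong]) (simp_all add: ground_coalg_simps)
  ultimately show ?thesis
    using bilin_map_left[OF bilin_map_tensor[of ground ground], of 1] by (simp add: ground_coalg_def)
qed

lemma ground_coalg_comul_form: "bilin_map ground ground ground b \<Longrightarrow> comul ground_coalg c b = b c 1"
  by (simp add: ground_coalg_def tensor_apply)

lemma tensor_lift_cong:
  assumes "vcarrier V = vcarrier V'" "vscale V = vscale V'" "vcarrier W = vcarrier W'" "vscale W = vscale W'"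
  shows "tensor_lift V W U b = tensor_lift V' W' U b"
  unfolding tensor_lift_def tensor_cong[OF assms] tensor_space_cong[OF assms] assms ..

section \<open>Sweedler calculus in a finite-dimensional Hopf algebra\<close>

locale fin_hopf = hopf_algebra H + finite_dimensional_vector_space "vscale H" B
  for H :: "('k::field, 'h::ring_1) hopf" and B :: "'h set"
begin

abbreviation lin :: "('h \<Rightarrow> 'k) \<Rightarrow> bool" where "lin \<equiv> lin_map H ground"
abbreviation lin_end :: "('h \<Rightarrow> 'h) \<Rightarrow> bool" where "lin_end \<equiv> lin_map H H"
abbreviation e :: "'h \<Rightarrow> 'h \<Rightarrow> 'k" where "e \<equiv> dual_basis H B"
abbreviation \<epsilon> :: "'h \<Rightarrow> 'k" where "\<epsilon> \<equiv> counit H"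
abbreviation S :: "'h \<Rightarrow> 'h" where "S \<equiv> antipode H"
abbreviation S' :: "'h \<Rightarrow> 'h" where "S' \<equiv> S\<^sup>-\<^sup>1"
abbreviation Aut :: "('h \<Rightarrow> 'h) set" where "Aut \<equiv> Aut_Hopf H"

text \<open>\<open>sw h (\<lambda>h\<^sub>1 h\<^sub>2. b h\<^sub>1 h\<^sub>2)\<close> is \<open>b h\<^sub>1 h\<^sub>2\<close> in Sweedler notation. It agrees with \<open>comul H h b\<close> for bilinear
  \<open>b\<close> but, being a fixed finite sum, is linear in \<open>b\<close> for all functions \<open>b\<close>.\<close>

definition sw :: "'h \<Rightarrow> ('h \<Rightarrow> 'h \<Rightarrow> 'k) \<Rightarrow> 'k" where
  "sw h b = (\<Sum>i\<in>B. \<Sum>j\<in>B. comul H h (\<lambda>x y. e i x * e j y) * b i j)"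

lemma carrier_simp [simp]: "vcarrier H = UNIV" by (rule carrier_UNIV)

lemma finite_B [simp]: "finite B" by (rule finite_Basis)

lemma vspace_H: "vspace H" by (rule vspace_axioms)

lemma lin_e: "lin (e b)"
  unfolding lin_map_def dual_basis_def
  using linear_representation[OF independent_Basis span_Basis, of b]
  by (simp add: representation_add independent_Basis span_Basis representation_scale)

lemma sum_e: "(\<Sum>b\<in>B. vscale H (e b x) b) = x"
  unfolding dual_basis_def
  by (rule sum_representation_eq[OF independent_Basis]) (simp_all add: span_Basis)

lemma coords_H: "coords H B (\<lambda>b. b) e"
  unfolding coords_def by (simp add: lin_e sum_e)

lemma lin_expand: "lin f \<Longrightarrow> (\<Sum>b\<in>B. e b x * f b) = f x"
  using coords_lin_map[OF coords_H vspace_H, of ground f x] by simp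

lemma functional_eqI: "(\<And>f. lin f \<Longrightarrow> f x = f y) \<Longrightarrow> x = y"
  using coords_eqI[OF coords_H, of x y] lin_e by simp

lemma lin_mult_left: "lin f \<Longrightarrow> lin (\<lambda>x. c * f x)"
  and lin_mult_right: "lin f \<Longrightarrow> lin (\<lambda>x. f x * c)"
  by (rule lin_map_mult_left lin_map_mult_right, assumption)+

lemma lin_sw_fixed: "lin (\<lambda>x. sw x b)"
  unfolding sw_def
  by (intro lin_map_sums vspace_ground lin_mult_right lin_map_comp[OF comul_lin lin_map_eval])

lemma lin_sw: "lin_end g \<Longrightarrow> lin (\<lambda>x. sw (g x) b)"
  by (rule lin_map_comp[OF _ lin_sw_fixed])

lemma lin_sw_arg: "(\<And>a b. lin (\<lambda>x. t x a b)) \<Longrightarrow> lin (\<lambda>x. sw h (t x))"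
  unfolding sw_def by (intro lin_map_sums vspace_ground lin_mult_left)

lemma lin_sum: "(\<And>i. i \<in> I \<Longrightarrow> lin (f i)) \<Longrightarrow> lin (\<lambda>x. \<Sum>i\<in>I. f i x)"
  by (intro lin_map_sums vspace_ground)

lemma lin_counit: "lin_end g \<Longrightarrow> lin (\<lambda>x. \<epsilon> (g x))"
  by (rule lin_map_comp[OF _ counit_lin])

lemma lin_end_id: "lin_end (\<lambda>x. x)"
  by (rule lin_map_id)

lemma lin_end_mult: "lin_end g \<Longrightarrow> lin_end (\<lambda>x. c * g x)" "lin_end g \<Longrightarrow> lin_end (\<lambda>x. g x * c)"
  unfolding lin_map_def by (simp_all add: algebra_simps scale_mult_left scale_mult_right)

lemma lin_end_S: "lin_end g \<Longrightarrow> lin_end (\<lambda>x. S (g x))"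
  by (rule lin_map_comp[OF _ antipode_lin])

lemmas lin_intros = lin_mult_left lin_mult_right lin_sw lin_sw_arg lin_sum lin_counit
  lin_end_id lin_end_mult lin_end_S

lemma comul_sw:
  assumes "\<And>y. lin (\<lambda>x. b x y)" "\<And>x. lin (\<lambda>y. b x y)"
  shows "comul H h b = sw h b"
  unfolding sw_def
  by (rule form_coords[OF coords_H vspace_H coords_H vspace_H])
    (simp_all add: bilin_map_def assms lin_map_carrier[OF comul_lin])

lemma sw_mult_left: "c * sw h b = sw h (\<lambda>x y. c * b x y)"
  and sw_mult_right: "sw h b * c = sw h (\<lambda>x y. b x y * c)"
  by (simp_all add: sw_def sum_distrib_left sum_distrib_right ac_simps)

lemma sw_sum: "(\<Sum>i\<in>I. sw h (b i)) = sw h (\<lambda>x y. \<Sum>i\<in>I. b i x y)"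
  unfolding sw_def sum_distrib_left
  by (subst sum.swap, intro sum.cong refl, subst sum.swap, intro sum.cong refl)

text \<open>Free of linearity conditions, because both sides are the same finite fourfold
  sum.\<close>

lemma sw_swap: "sw x (\<lambda>a b. sw y (t a b)) = sw y (\<lambda>c d. sw x (\<lambda>a b. t a b c d))"
  by (simp add: sw_def[of y] flip: sw_sum sw_mult_left)

lemma sw_coassoc:
  assumes "\<And>y z. lin (\<lambda>x. t x y z)" "\<And>x z. lin (\<lambda>y. t x y z)" "\<And>x y. lin (\<lambda>z. t x y z)"
  shows "sw x (\<lambda>a b. sw a (\<lambda>u v. t u v b)) = sw x (\<lambda>a b. sw b (t a))"
proof -
  have t: "trilin H t" unfolding trilin_def using assms by simp
  have "sw x (\<lambda>a b. sw a (\<lambda>u v. t u v b)) = comul H x (\<lambda>a b. comul H a (\<lambda>u v. t u v b))"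
    by (simp add: comul_sw lin_sw_fixed lin_sw_arg assms)
  also have "\<dots> = comul H x (\<lambda>a b. comul H b (\<lambda>u v. t a u v))"
    by (rule coassoc_trilin[OF _ t]) simp
  also have "\<dots> = sw x (\<lambda>a b. sw b (t a))"
    by (simp add: comul_sw lin_sw_fixed lin_sw_arg assms)
  finally show ?thesis .
qed

lemma sw_counit_left: "lin f \<Longrightarrow> sw x (\<lambda>a b. \<epsilon> a * f b) = f x"
  and sw_counit_right: "lin f \<Longrightarrow> sw x (\<lambda>a b. f a * \<epsilon> b) = f x"
  using counit_left_form[of x f] counit_right_form[of x f]
  by (simp_all add: comul_sw lin_mult_left lin_mult_right counit_lin)

lemma tensor_coalg_simps [simp]:
  "vcarrier (tensor_coalg C D) = vcarrier (tensor_space C D)"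
  "vscale (tensor_coalg C D) = fun_scale"
  by (simp_all add: tensor_coalg_def)

lemma bilin_map_times: "bilin_map H H H (*)"
  by (intro bilin_mapI lin_end_mult lin_map_id)

lemma mult_lift: "tensor_lift H H H (*) (tensor H H x y) = x * y"
  by (rule tensor_lift_tensor[OF vspace_H bilin_map_times]) simp_all

lemma counit_mult: "\<epsilon> (x * y) = \<epsilon> x * \<epsilon> y"
proof -
  have "\<epsilon> (tensor_lift H H H (*) (tensor H H x y)) = counit (tensor_coalg H H) (tensor H H x y)"
    using mult_coalgebra_map unfolding coalgebra_map_def
    by (simp add: tensor_in_tensor_space)
  also have "\<dots> = \<epsilon> x * \<epsilon> y"
    by (simp add: tensor_coalg_def tensor_lift_tensor[OF vspace_ground bilin_map_mult] counit_lin)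
  finally show ?thesis by (simp add: mult_lift)
qed

text \<open>This is \<open>mult_coalgebra_map\<close> at the pure tensor x \<otimes> y, unfolded by
  the Sweedler rule for a tensor coalgebra.\<close>

lemma sw_mult:
  assumes "\<And>y. lin (\<lambda>x. b x y)" "\<And>x. lin (\<lambda>y. b x y)"
  shows "sw (x * y) b = sw x (\<lambda>x1 x2. sw y (\<lambda>y1 y2. b (x1 * y1) (x2 * y2)))"
proof -
  note l = lin_map_comp[of H H, OF _ assms(1)] lin_map_comp[of H H, OF _ assms(2)]
  note TS = tensor_space_cong[of "tensor_coalg H H" "tensor_space H H" "tensor_coalg H H" "tensor_space H H"]
  have lc: "lin_map (tensor_coalg H H) (tensor_space (tensor_coalg H H) (tensor_coalg H H)) (comul
      (tensor_coalg H H))"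
    using lin_map_comul_tensor_coalg[OF vspace_H vspace_H comul_lin comul_lin]
    by (simp add: TS lin_map_space_cong[of "tensor_coalg H H" "tensor_space H H"])
  have b: "bilin_map H H ground b" by (simp add: bilin_map_def assms)
  have lm: "lin_map (tensor_space H H) H (tensor_lift H H H (*))"
    by (rule lin_map_tensor_lift[OF vspace_H bilin_map_times])
  have "sw (x * y) b = comul H (tensor_lift H H H (*) (tensor H H x y)) b"
    by (simp add: comul_sw assms mult_lift)
  also have "\<dots> = comul (tensor_coalg H H) (tensor H H x y)
      (\<lambda>u v. b (tensor_lift H H H (*) u) (tensor_lift H H H (*) v))"
    by (rule coalgebra_map_comul_form[OF mult_coalgebra_map _ b lc]) (simp add: tensor_in_tensor_space)
  also have "\<dots> = comul H x (\<lambda>x1 x2. comul H y (\<lambda>y1 y2. b (x1 * y1) (x2 * y2)))"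
    by (subst comul_tensor_coalg_form[OF vspace_H vspace_H comul_lin comul_lin _ _ bilin_map_comp[OF b lm lm]])
      (simp_all add: mult_lift)
  finally show ?thesis
    by (simp add: comul_sw lin_intros l)
qed

lemma counit_one [simp]: "\<epsilon> 1 = 1"
  and sw_one: "(\<And>y. lin (\<lambda>x. b x y)) \<Longrightarrow> (\<And>x. lin (\<lambda>y. b x y)) \<Longrightarrow> sw 1 b = b 1 1"
proof -
  note u = unit_coalgebra_map[unfolded coalgebra_map_def ground_coalg_def, simplified]
  show "\<epsilon> 1 = 1" using u by (metis id_apply vscale_one[OF vspace_H])
next
  assume l: "\<And>y. lin (\<lambda>x. b x y)" "\<And>x. lin (\<lambda>y. b x y)"
  have b: "bilin_map H H ground b" by (simp add: bilin_map_def l)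
  have l1: "lin_map ground H (\<lambda>c. vscale H c 1)"
    by (rule lin_map_functional[OF vspace_H lin_map_id]) simp
  have "comul H (vscale H 1 1) b = comul ground_coalg 1 (\<lambda>u v. b (vscale H u 1) (vscale H v 1))"
    by (rule coalgebra_map_comul_form[OF unit_coalgebra_map _ b lin_map_ground_coalg_comul])
      (simp add: ground_coalg_simps)
  also have "\<dots> = b (vscale H 1 1) (vscale H 1 1)"
    by (rule ground_coalg_comul_form[OF bilin_map_comp[OF b l1 l1]])
  finally show "sw 1 b = b 1 1" by (simp add: comul_sw l vscale_one[OF vspace_H])
qed

lemma sw_antipode_left: "sw x (\<lambda>a b. f (S a * b)) = \<epsilon> x * f 1"
  and sw_antipode_right: "sw x (\<lambda>a b. f (a * S b)) = \<epsilon> x * f 1" if f: "lin f"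
proof -
  note l = lin_map_comp[of H H, OF _ f]
  have b: "bilin_map H H H (\<lambda>x y. S x * y)" "bilin_map H H H (\<lambda>x y. x * S y)"
    by (auto intro!: bilin_mapI lin_intros)
  note e = tensor_lift_eval[OF vspace_H b(1) f lin_map_carrier[OF comul_lin], of x]
    tensor_lift_eval[OF vspace_H b(2) f lin_map_carrier[OF comul_lin], of x]
  show "sw x (\<lambda>a b. f (S a * b)) = \<epsilon> x * f 1" "sw x (\<lambda>a b. f (a * S b)) = \<epsilon> x * f 1"
    using e by (simp_all add: antipode_left antipode_right lin_map_scale[OF f] comul_sw l lin_intros)
qed

lemma sw_cong: "(\<And>a b. t a b = t' a b) \<Longrightarrow> sw x t = sw x t'"
  by (simp add: sw_def)

subsection \<open>Bijectivity of the antipode\<close>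

text \<open>Both sides are convolution inverses of the multiplication. Explicitly, S(x1 y1) x2 y2
  S(y3) S(x3) becomes S(x y) when its tail cancels and S(y) S(x) when its head cancels.\<close>

lemma antipode_mult: "S (x * y) = S y * S x"
proof (rule functional_eqI)
  fix f assume f: "lin f"
  note l = lin_intros lin_map_comp[of H H, OF _ f]
  have 1: "sw y (\<lambda>y2 y3. f (c * (d * (y2 * (S y3 * c'))))) = \<epsilon> y * f (c * (d * c'))" for y c d c'
    using sw_antipode_right[of "\<lambda>w. f (c * (d * w * c'))" y] by (simp add: l mult.assoc)
  have 2: "sw x (\<lambda>x2 x3. f (c * (x2 * S x3))) = \<epsilon> x * f c" for x c
    using sw_antipode_right[of "\<lambda>w. f (c * w)" x] by (simp add: l)
  have "f (S (x * y)) = sw x (\<lambda>x1 x'. \<epsilon> x' * sw y (\<lambda>y1 y'. \<epsilon> y' * f (S (x1 * y1))))"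
    by (simp add: mult.commute[of "\<epsilon> _"] sw_counit_right l)
  \<comment> \<open>The two counits are expanded into the tail: \<open>2\<close> replaces the counit
    of x' by x2 S(x3), and \<open>1\<close> the counit of y' by y2 S(y3).\<close>
  also have "\<dots> = sw x (\<lambda>x1 x'. sw y (\<lambda>y1 y'. sw x' (\<lambda>x2 x3. sw y' (\<lambda>y2 y3.
      f (S (x1 * y1) * ((x2 * y2) * (S y3 * S x3)))))))"
    by (simp add: 1 2 mult.assoc[where 'a='h] flip: sw_mult_left)
      (simp add: sw_mult_left mult.left_commute)
  also have "\<dots> = sw x (\<lambda>x1 x'. sw x' (\<lambda>x2 x3. sw y (\<lambda>y1 y'. sw y' (\<lambda>y2 y3.
      f (S (x1 * y1) * ((x2 * y2) * (S y3 * S x3)))))))"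
    by (rule sw_cong) (rule sw_swap)
  also have "\<dots> = sw x (\<lambda>u x3. sw u (\<lambda>x1 x2. sw y (\<lambda>v y3. sw v (\<lambda>y1 y2.
      f (S (x1 * y1) * ((x2 * y2) * (S y3 * S x3)))))))"
    by (simp add: sw_coassoc l)
  \<comment> \<open>After the regrouping, x1 y1 and x2 y2 are the two legs of the product u v, to
    which the left antipode law applies.\<close>
  also have "\<dots> = sw x (\<lambda>u x3. sw y (\<lambda>v y3. sw (u * v) (\<lambda>s t. f (S s * t * (S y3 * S x3)))))"
    by (subst sw_swap[of _ y]) (simp add: sw_mult l mult.assoc)
  also have "\<dots> = f (S y * S x)"
    using sw_antipode_left[of "\<lambda>w. f (w * (S _ * S _))"]
    by (simp add: l counit_mult mult.assoc sw_counit_left flip: sw_mult_left)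
  finally show "f (S (x * y)) = f (S y * S x)" .
qed

lemma antipode_one [simp]: "S 1 = 1"
proof (rule functional_eqI)
  fix f assume f: "lin f"
  show "f (S 1) = f 1"
    using sw_antipode_left[OF f, of 1] by (simp add: sw_one lin_intros lin_map_comp[of H H, OF _ f])
qed

lemma counit_antipode [simp]: "\<epsilon> (S x) = \<epsilon> x"
  using sw_antipode_left[OF counit_lin, of x] sw_counit_right[of "\<lambda>x. \<epsilon> (S x)" x]
  by (simp add: counit_mult lin_intros)

text \<open>The dual of the previous argument: x \<mapsto> \<Delta>(S x) and x \<mapsto> S(x2)
  \<otimes> S(x1) are both convolution inverses of \<Delta>. The mediating expression is \<Delta>(S
  x1) \<Delta>(x2) (S(x4) \<otimes> S(x3)).\<close>

lemma sw_antipode: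
  assumes "\<And>y. lin (\<lambda>x. b x y)" "\<And>x. lin (\<lambda>y. b x y)"
  shows "sw (S x) b = sw x (\<lambda>x1 x2. b (S x2) (S x1))"
proof -
  note l = lin_intros lin_map_comp[of H H, OF _ assms(1)] lin_map_comp[of H H, OF _ assms(2)]
  have 1: "sw q (\<lambda>v x3. b c (d * (v * S x3))) = \<epsilon> q * b c d" for q c d
    using sw_antipode_right[of "\<lambda>w. b c (d * w)" q] by (simp add: l)
  have 2: "sw r (\<lambda>u x4. b (c * (u * S x4)) d) = \<epsilon> r * b c d" for r c d
    using sw_antipode_right[of "\<lambda>w. b (c * w) d" r] by (simp add: l)
  \<comment> \<open>\<open>E\<close> says that x \<mapsto> S(x2) \<otimes> S(x1) is a right inverse
    of \<Delta>, with s and t as spectators. The legs in the second tensor factor are adjacent and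
    cancel first; this brings those in the first factor together.\<close>
  have E: "sw x' (\<lambda>x2 x''. sw x2 (\<lambda>u v. sw x'' (\<lambda>x3 x4. b (s * (u * S x4)) (t * (v * S x3)))))
      = \<epsilon> x' * b s t" for x' s t
  proof -
    have "sw x' (\<lambda>x2 x''. sw x2 (\<lambda>u v. sw x'' (\<lambda>x3 x4. b (s * (u * S x4)) (t * (v * S x3)))))
      = sw x' (\<lambda>u r. sw r (\<lambda>v x''. sw x'' (\<lambda>x3 x4. b (s * (u * S x4)) (t * (v * S x3)))))"
      by (rule sw_coassoc) (intro l)+
    also have "\<dots> = sw x' (\<lambda>u r. sw r (\<lambda>q x4. sw q (\<lambda>v x3. b (s * (u * S x4)) (t * (v * S x3)))))"
      by (rule sw_cong, rule sw_coassoc[symmetric]) (intro l)+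
    also have "\<dots> = sw x' (\<lambda>u r. b (s * (u * S r)) t)"
      by (simp add: 1 sw_counit_left l)
    finally show ?thesis by (simp add: 2)
  qed
  have "sw x (\<lambda>x1 x2. b (S x2) (S x1)) = sw x (\<lambda>y x''. \<epsilon> y * sw x'' (\<lambda>x3 x4. b (S x4) (S x3)))"
    by (simp add: sw_counit_left l)
  also have "\<dots> = sw x (\<lambda>y x''. sw y (\<lambda>x1 x2. sw (S x1 * x2) (\<lambda>u v. sw x'' (\<lambda>x3 x4. b (u * S x4) (v * S x3)))))"
    using sw_antipode_left[of "\<lambda>w. sw w (\<lambda>u v. sw _ (\<lambda>x3 x4. b (u * S x4) (v * S x3)))"]
    by (simp add: l sw_one)
  also have "\<dots> = sw x (\<lambda>x1 x'. sw x' (\<lambda>x2 x''. sw (S x1 * x2) (\<lambda>u v. sw x'' (\<lambda>x3 x4. b (u * S x4) (v * S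
      x3)))))"
    by (rule sw_coassoc) (intro l)+
  also have "\<dots> = sw x (\<lambda>x1 x'. sw x' (\<lambda>x2 x''. sw (S x1) (\<lambda>s t. sw x2 (\<lambda>u v. sw x'' (\<lambda>x3 x4.
      b (s * (u * S x4)) (t * (v * S x3)))))))"
    by (simp add: sw_mult l mult.assoc)
  also have "\<dots> = sw x (\<lambda>x1 x'. sw (S x1) (\<lambda>s t. \<epsilon> x' * b s t))"
    by (subst sw_swap) (simp add: E)
  also have "\<dots> = sw (S x) b"
    by (simp add: sw_counit_right l mult.commute[of "\<epsilon> _"] flip: sw_mult_left sw_mult_right)
  finally show ?thesis ..
qed

text \<open>Under convolution, left multiplication by \<open>S\<close> is injective on the space of linear endomorphisms, with
  inverse given by multiplication by the identity. It maps the endomorphisms that factor through \<open>S\<close>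
  into themselves, because \<open>S\<close> reverses the comultiplication, so by finiteness onto themselves. Among
  these is the convolution unit; hence so is its preimage, the identity.\<close>

lemma bij_antipode: "bij S"
proof -
  let ?sc = "\<lambda>c (w :: 'h \<Rightarrow> 'h) x. vscale H c (w x)"
  interpret fv: vector_space ?sc
    by unfold_locales (auto simp: fun_eq_iff scale_right_distrib scale_left_distrib)
  define W where "W = {\<lambda>x. P (S x) | P. lin_end P}"
  \<comment> \<open>The counterpart of \<open>sw\<close> with values in H; \<open>f_sv\<close> leads
    back to the scalar calculus.\<close>
  define sv where "sv x g = (\<Sum>i\<in>B. \<Sum>j\<in>B. vscale H (comul H x (\<lambda>x y. e i x * e j y)) (g i j))"
    for x and g :: "'h \<Rightarrow> 'h \<Rightarrow> 'h"
  define L where "L w x = sv x (\<lambda>a b. S a * w b)" for w x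
  have f_sv: "f (sv x g) = sw x (\<lambda>a b. f (g a b))" if "lin f" for f x g
    unfolding sv_def sw_def
    by (subst lin_map_sum[OF vspace_H that], simp, rule sum.cong[OF refl],
        subst lin_map_sum[OF vspace_H that]) (simp_all add: lin_map_scale[OF that])
  have lin_endI: "lin_end g" if "\<And>f. lin f \<Longrightarrow> lin (\<lambda>x. f (g x))" for g
  proof (rule lin_mapI)
    show "g (x + y) = g x + g y" for x y
      by (rule functional_eqI) (simp add: lin_map_add[OF that] lin_map_add)
    show "g (vscale H c x) = vscale H c (g x)" for c x
      by (rule functional_eqI) (simp add: lin_map_scale[OF that] lin_map_scale)
  qed simp
  have WD: "lin_end w" if "w \<in> W" for w
    using that lin_map_comp[OF antipode_lin] unfolding W_def by auto
  \<comment> \<open>Convolution with the identity undoes \<open>L\<close>, since x1 S(x2) w(x3) =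
    w(x) by the right antipode law.\<close>
  have inv: "sv x (\<lambda>a b. a * L w b) = w x" if w: "lin_end w" for w x
  proof (rule functional_eqI)
    fix f assume f: "lin f"
    note l = lin_intros lin_map_comp[of H H, OF _ f] lin_map_comp[of H H, OF _ w]
    have 1: "sw y (\<lambda>a c. f (a * (S c * d))) = \<epsilon> y * f d" for y d
      using sw_antipode_right[of "\<lambda>w. f (w * d)" y] by (simp add: l mult.assoc)
    have "f (sv x (\<lambda>a b. a * L w b)) = sw x (\<lambda>a b. sw b (\<lambda>c d. f (a * (S c * w d))))"
      unfolding L_def by (simp add: f_sv f) (simp add: f_sv[of "\<lambda>v. f (_ * v)"] l)
    also have "\<dots> = sw x (\<lambda>y d. sw y (\<lambda>a c. f (a * (S c * w d))))"
      by (rule sw_coassoc[symmetric]) (intro l)+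
    also have "\<dots> = f (w x)" by (simp add: 1 sw_counit_left l)
    finally show "f (sv x (\<lambda>a b. a * L w b)) = f (w x)" .
  qed
  have subW: "fv.subspace W"
  proof (rule fv.subspaceI)
    show "0 \<in> W"
      unfolding W_def using lin_map_zero[OF vspace_H, of H] by (auto intro!: exI[of _ "\<lambda>x. 0"])
    show "u + v \<in> W" if uv: "u \<in> W" "v \<in> W" for u v
    proof -
      obtain P Q where "lin_end P" "lin_end Q" "u = (\<lambda>x. P (S x))" "v = (\<lambda>x. Q (S x))"
        using uv unfolding W_def by blast
      then have "lin_end (\<lambda>x. P x + Q x)" "u + v = (\<lambda>x. P (S x) + Q (S x))"
        by (simp_all add: lin_map_plus[OF vspace_H] fun_eq_iff)
      then show ?thesis unfolding W_def by (intro CollectI exI[of _ "\<lambda>x. P x + Q x"]) simp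
    qed
    show "?sc c u \<in> W" if u: "u \<in> W" for c u
    proof -
      obtain P where "lin_end P" "u = (\<lambda>x. P (S x))" using u unfolding W_def by blast
      then show ?thesis
        using lin_map_smult[OF vspace_H] unfolding W_def
        by (intro CollectI exI[of _ "\<lambda>x. vscale H c (P x)"]) simp
    qed
  qed
  \<comment> \<open>The rank one maps made of a basis vector and a dual basis functional span all
    linear endomorphisms; this is where finiteness comes from.\<close>
  define F where "F = (\<lambda>(b, b') x. vscale H (e b x) b') ` (B \<times> B)"
  have spanW: "W \<subseteq> fv.span F"
  proof
    fix w assume "w \<in> W"
    then have w: "lin_end w" by (rule WD)
    have "w = (\<Sum>b\<in>B. \<Sum>b'\<in>B. ?sc (e b' (w b)) (\<lambda>x. vscale H (e b x) b'))"
    proof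
      fix x
      have "w x = (\<Sum>b\<in>B. vscale H (e b x) (w b))"
        using coords_lin_map[OF coords_H vspace_H w, of x] by simp
      also have "\<dots> = (\<Sum>b\<in>B. vscale H (e b x) (\<Sum>b'\<in>B. vscale H (e b' (w b)) b'))"
        by (simp add: sum_e)
      also have "\<dots> = (\<Sum>b\<in>B. \<Sum>b'\<in>B. ?sc (e b' (w b)) (\<lambda>x. vscale H (e b x) b')) x"
        by (simp add: scale_sum_right mult.commute sum_fun_apply)
      finally show "w x = (\<Sum>b\<in>B. \<Sum>b'\<in>B. ?sc (e b' (w b)) (\<lambda>x. vscale H (e b x) b')) x" .
    qed
    also have "\<dots> \<in> fv.span F"
      unfolding F_def by (intro fv.span_sum fv.span_scale fv.span_base) auto
    finally show "w \<in> fv.span F" .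
  qed
  have linL: "Vector_Spaces.linear ?sc ?sc L"
    by unfold_locales
      (auto simp: L_def sv_def fun_eq_iff distrib_left scale_right_distrib sum.distrib
        scale_mult_right scale_sum_right mult.commute)
  have "L ` W = W"
  proof (rule fv.injective_endo_onto[OF _ spanW subW linL])
    show "finite F" unfolding F_def by simp
    show "inj_on L W"
    proof (rule inj_onI)
      fix u v assume u: "u \<in> W" and v: "v \<in> W" and "L u = L v"
      then show "u = v" using inv[OF WD[OF u]] inv[OF WD[OF v]] by (simp add: fun_eq_iff)
    qed
    show "L ` W \<subseteq> W"
    proof safe
      fix w assume "w \<in> W"
      then obtain P where P: "lin_end P" and w: "w = (\<lambda>x. P (S x))" unfolding W_def by blast
      \<comment> \<open>Since S reverses the coproduct, S(x1) P(S x2) is the product of the second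
        leg of S x with P of the first. It therefore depends on x only through S x.\<close>
      have "L w = (\<lambda>x. sv (S x) (\<lambda>a b. b * P a))"
      proof (rule ext, rule functional_eqI)
        fix x f assume f: "lin f"
        show "f (L w x) = f (sv (S x) (\<lambda>a b. b * P a))"
          unfolding L_def f_sv[OF f] w
          by (simp add: sw_antipode lin_intros lin_map_comp[of H H, OF _ f] lin_map_comp[of H H, OF _ P])
      qed
      moreover have "lin_end (\<lambda>x. sv x (\<lambda>a b. b * P a))"
        by (rule lin_endI) (simp add: f_sv lin_sw_fixed)
      ultimately show "L w \<in> W"
        unfolding W_def by (intro CollectI exI[of _ "\<lambda>x. sv x (\<lambda>a b. b * P a)"]) simp
    qed
  qed
  \<comment> \<open>The convolution unit factors through S because the counit is invariant under
    S.\<close>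
  moreover have "(\<lambda>x. vscale H (\<epsilon> x) 1) \<in> W"
    unfolding W_def by (auto intro!: exI[of _ "\<lambda>x. vscale H (\<epsilon> x) 1"] lin_map_functional vspace_H counit_lin)
  ultimately obtain w where w: "w \<in> W" and Lw: "L w = (\<lambda>x. vscale H (\<epsilon> x) 1)"
    by (metis (no_types, lifting) imageE)
  have "w x = x" for x
  proof (rule functional_eqI)
    fix f assume f: "lin f"
    have "f (w x) = sw x (\<lambda>a b. f (a * vscale H (\<epsilon> b) 1))"
      using arg_cong[OF inv[OF WD[OF w], of x], of f] unfolding f_sv[OF f] Lw by (rule sym)
    also have "\<dots> = sw x (\<lambda>a b. f a * \<epsilon> b)"
    proof (rule sw_cong)
      fix a b
      have "f (vscale H (\<epsilon> b) a) = \<epsilon> b * f a" using lin_map_scale[OF f, of a "\<epsilon> b"] by simp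
      then show "f (a * vscale H (\<epsilon> b) 1) = f a * \<epsilon> b"
        by (simp add: scale_mult_right mult.commute)
    qed
    also have "\<dots> = f x" by (rule sw_counit_right[OF f])
    finally show "f (w x) = f x" .
  qed
  \<comment> \<open>The identity now has the form P \<circ> S, so S has a left inverse.\<close>
  then have "inj S"
    using w unfolding W_def inj_def by auto (metis (full_types))
  moreover have "Vector_Spaces.linear (vscale H) (vscale H) S"
    using antipode_lin by unfold_locales (auto simp: lin_map_def)
  ultimately show "bij S"
    using linear_inj_imp_surj by (auto simp: bij_def)
qed

subsection \<open>The inverse antipode and Hopf automorphisms\<close>

lemma S'_S [simp]: "S' (S x) = x" and S_S' [simp]: "S (S' x) = x"
  using bij_antipode by (simp_all add: bij_is_inj bij_is_surj surj_f_inv_f)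

lemma S'_eqI: "S y = x \<Longrightarrow> S' x = y"
  by auto

lemma lin_end_S': "lin_end g \<Longrightarrow> lin_end (\<lambda>x. S' (g x))"
  by (rule lin_map_comp)
    (auto intro!: lin_mapI S'_eqI simp: lin_map_add[OF antipode_lin] lin_map_scale[OF antipode_lin])

lemma S'_mult: "S' (x * y) = S' y * S' x"
  by (rule S'_eqI) (simp add: antipode_mult)

lemma S'_one [simp]: "S' 1 = 1"
  by (rule S'_eqI) simp

lemma counit_S' [simp]: "\<epsilon> (S' x) = \<epsilon> x"
  by (metis counit_antipode S_S')

lemma sw_S':
  assumes "\<And>y. lin (\<lambda>x. b x y)" "\<And>x. lin (\<lambda>y. b x y)"
  shows "sw (S' x) b = sw x (\<lambda>x1 x2. b (S' x2) (S' x1))"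
  using sw_antipode[of "\<lambda>x1 x2. b (S' x2) (S' x1)" "S' x"]
  by (simp add: lin_map_comp[of H H, OF lin_end_S'[OF lin_end_id] assms(1)]
      lin_map_comp[of H H, OF lin_end_S'[OF lin_end_id] assms(2)])

text \<open>Applying \<open>S'\<close>, which reverses products, to the antipode laws exchanges the
  positions of the legs: here the second leg stands to the left of the first.\<close>

lemma sw_S'_left: "sw x (\<lambda>a b. f (S' b * a)) = \<epsilon> x * f 1"
  and sw_S'_right: "sw x (\<lambda>a b. f (b * S' a)) = \<epsilon> x * f 1" if f: "lin f"
  using sw_antipode_left[of "\<lambda>x. f (S' x)" x] sw_antipode_right[of "\<lambda>x. f (S' x)" x]
  by (simp_all add: S'_mult lin_map_comp[of H H, OF lin_end_S'[OF lin_end_id] f])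

lemma
  assumes "\<alpha> \<in> Aut"
  shows Aut_mult: "\<alpha> (x * y) = \<alpha> x * \<alpha> y"
    and Aut_one: "\<alpha> 1 = 1"
    and Aut_S: "\<alpha> (S x) = S (\<alpha> x)"
    and Aut_S': "\<alpha> (S' x) = S' (\<alpha> x)"
    and Aut_counit: "\<epsilon> (\<alpha> x) = \<epsilon> x"
    and Aut_bij: "bij \<alpha>"
    and Aut_inv1: "\<alpha>\<^sup>-\<^sup>1 (\<alpha> x) = x"
    and Aut_inv2: "\<alpha> (\<alpha>\<^sup>-\<^sup>1 x) = x"
    and lin_end_Aut: "lin_end g \<Longrightarrow> lin_end (\<lambda>x. \<alpha> (g x))"
    and sw_Aut: "(\<And>y. lin (\<lambda>x. b x y)) \<Longrightarrow> (\<And>x. lin (\<lambda>y. b x y)) \<Longrightarrow>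
      sw (\<alpha> x) b = sw x (\<lambda>x1 x2. b (\<alpha> x1) (\<alpha> x2))"
proof -
  have a: "coalgebra_map H H \<alpha>" "bij \<alpha>" "\<alpha> 1 = 1" "\<And>x y. \<alpha> (x * y) = \<alpha> x * \<alpha> y" "\<And>x. \<alpha> (S x) = S (\<alpha> x)"
    using assms unfolding Aut_Hopf_def coalgebra_iso_def by auto
  then have l: "lin_end \<alpha>" and c: "\<And>x. \<epsilon> (\<alpha> x) = \<epsilon> x" unfolding coalgebra_map_def by auto
  show "\<alpha> (x * y) = \<alpha> x * \<alpha> y" "\<alpha> 1 = 1" "\<alpha> (S x) = S (\<alpha> x)" "\<epsilon> (\<alpha> x) = \<epsilon> x" "bij \<alpha>"
    by (rule a c)+
  show "\<alpha> (S' x) = S' (\<alpha> x)" by (rule S'_eqI[symmetric]) (simp flip: a(5))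
  show "\<alpha>\<^sup>-\<^sup>1 (\<alpha> x) = x" "\<alpha> (\<alpha>\<^sup>-\<^sup>1 x) = x"
    using a(2) by (simp_all add: bij_is_inj bij_is_surj surj_f_inv_f)
  show "lin_end (\<lambda>x. \<alpha> (g x))" if "lin_end g" by (rule lin_map_comp[OF that l])
  show "sw (\<alpha> x) b = sw x (\<lambda>x1 x2. b (\<alpha> x1) (\<alpha> x2))"
    if b: "\<And>y. lin (\<lambda>x. b x y)" "\<And>x. lin (\<lambda>y. b x y)"
    using coalgebra_map_comul_form[OF a(1) _ _ comul_lin, of x b] b
      lin_map_comp[OF l b(1)] lin_map_comp[OF l b(2)]
    by (simp add: comul_sw bilin_map_def)
qed

text \<open>The coproduct is compared on product forms only, which suffices by
  \<open>coalgebra_mapI\<close>.\<close>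

lemma Aut_HopfI:
  assumes l: "lin_end \<alpha>" and b: "bij \<alpha>" and m: "\<And>x y. \<alpha> (x * y) = \<alpha> x * \<alpha> y" and "\<alpha> 1 = 1"
    and "\<And>x. \<alpha> (S x) = S (\<alpha> x)" and "\<And>x. \<epsilon> (\<alpha> x) = \<epsilon> x"
    and sw: "\<And>f g x. lin f \<Longrightarrow> lin g \<Longrightarrow> sw (\<alpha> x) (\<lambda>x y. f x * g y) = sw x (\<lambda>x1 x2. f (\<alpha> x1) * g (\<alpha> x2))"
  shows "\<alpha> \<in> Aut"
proof -
  have "coalgebra_map H H \<alpha>"
    by (rule coalgebra_mapI[OF coords_H vspace_H vspace_H comul_lin comul_lin l])
      (simp_all add: comul_sw lin_e lin_intros lin_map_comp[OF l lin_e] sw assms)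
  then show ?thesis
    using assms unfolding Aut_Hopf_def coalgebra_iso_def by simp
qed

lemma Aut_id: "id \<in> Aut"
  by (rule Aut_HopfI) (simp_all add: id_def lin_end_id bij_id[unfolded id_def])

lemma Aut_comp:
  assumes "\<alpha> \<in> Aut" "\<beta> \<in> Aut"
  shows "\<alpha> \<circ> \<beta> \<in> Aut"
proof (rule Aut_HopfI)
  note l = lin_intros assms[THEN lin_end_Aut]
  show "lin_end (\<alpha> \<circ> \<beta>)" unfolding o_def by (intro l)
  show "bij (\<alpha> \<circ> \<beta>)" by (intro bij_comp Aut_bij assms)
  fix f g x assume fg: "lin f" "lin g"
  show "sw ((\<alpha> \<circ> \<beta>) x) (\<lambda>x y. f x * g y) = sw x (\<lambda>x1 x2. f ((\<alpha> \<circ> \<beta>) x1) * g ((\<alpha> \<circ> \<beta>) x2))"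
    by (simp add: assms[THEN sw_Aut] l lin_map_comp[of H H, OF _ fg(1)] lin_map_comp[of H H, OF _ fg(2)])
qed (simp_all add: assms[THEN Aut_mult] assms[THEN Aut_one] assms[THEN Aut_S] assms[THEN Aut_counit])

lemma Aut_inv:
  assumes "\<alpha> \<in> Aut"
  shows "\<alpha>\<^sup>-\<^sup>1 \<in> Aut"
proof (rule Aut_HopfI)
  note inj = inj_eq[OF bij_is_inj[OF Aut_bij[OF assms]], THEN iffD1]
  have la: "lin_end \<alpha>" using lin_end_Aut[OF assms lin_end_id] .
  note i = Aut_inv1[OF assms] Aut_inv2[OF assms]
  show l: "lin_end (\<alpha>\<^sup>-\<^sup>1)"
    by (rule lin_mapI; (rule inj)?) (simp_all add: i lin_map_add[OF la] lin_map_scale[OF la])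
  show "bij (\<alpha>\<^sup>-\<^sup>1)" by (rule bij_imp_bij_inv[OF Aut_bij[OF assms]])
  show "\<alpha>\<^sup>-\<^sup>1 (x * y) = \<alpha>\<^sup>-\<^sup>1 x * \<alpha>\<^sup>-\<^sup>1 y" "\<alpha>\<^sup>-\<^sup>1 1 = 1" "\<alpha>\<^sup>-\<^sup>1 (S x) = S (\<alpha>\<^sup>-\<^sup>1 x)" for x y
    by (rule inj, simp add: i Aut_mult[OF assms] Aut_one[OF assms] Aut_S[OF assms])+
  show "\<epsilon> (\<alpha>\<^sup>-\<^sup>1 x) = \<epsilon> x" for x
    using Aut_counit[OF assms, of "\<alpha>\<^sup>-\<^sup>1 x"] by (simp add: i)
  fix f g x assume fg: "lin f" "lin g"
  note fl = lin_map_comp[OF l fg(1)] lin_map_comp[OF l fg(2)]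
  show "sw (\<alpha>\<^sup>-\<^sup>1 x) (\<lambda>x y. f x * g y) = sw x (\<lambda>x1 x2. f (\<alpha>\<^sup>-\<^sup>1 x1) * g (\<alpha>\<^sup>-\<^sup>1 x2))"
    using sw_Aut[OF assms, of "\<lambda>x1 x2. f (\<alpha>\<^sup>-\<^sup>1 x1) * g (\<alpha>\<^sup>-\<^sup>1 x2)" "\<alpha>\<^sup>-\<^sup>1 x"]
    by (simp add: i lin_intros fl)
qed

text \<open>The prefixes refer to a product, an inverse and a conjugate in \<open>aut_pairs\<close>,
  the suffixes to the component; the conjugate is that of (\<gamma>, \<delta>) by (\<alpha>,
  \<beta>).\<close>

abbreviation (input) "mult_fst \<alpha> \<gamma> \<delta> \<equiv> \<delta> \<circ> \<alpha> \<circ> \<delta>\<^sup>-\<^sup>1 \<circ> \<gamma>"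
abbreviation (input) "inv_fst \<alpha> \<beta> \<equiv> \<beta>\<^sup>-\<^sup>1 \<circ> \<alpha>\<^sup>-\<^sup>1 \<circ> \<beta>"
abbreviation (input) "conj_fst \<alpha> \<beta> \<gamma> \<delta> \<equiv> \<beta>\<^sup>-\<^sup>1 \<circ> \<delta> \<circ> \<alpha> \<circ> \<delta>\<^sup>-\<^sup>1 \<circ> \<gamma> \<circ> \<alpha>\<^sup>-\<^sup>1 \<circ> \<beta>"
abbreviation (input) "conj_snd \<beta> \<delta> \<equiv> \<beta>\<^sup>-\<^sup>1 \<circ> \<delta> \<circ> \<beta>"

lemma aut_pairs_simps [simp]:
  "carrier (aut_pairs H) = Aut \<times> Aut"
  "(\<alpha>, \<beta>) \<otimes>\<^bsub>aut_pairs H\<^esub> (\<gamma>, \<delta>) = (mult_fst \<alpha> \<gamma> \<delta>, \<delta> \<circ> \<beta>)"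
  "\<one>\<^bsub>aut_pairs H\<^esub> = (id, id)"
  by (simp_all add: aut_pairs_def)

lemma group_aut_pairs: "group (aut_pairs H)"
  and inv_aut_pairs: "\<alpha> \<in> Aut \<Longrightarrow> \<beta> \<in> Aut \<Longrightarrow>
    inv\<^bsub>aut_pairs H\<^esub> (\<alpha>, \<beta>) = (inv_fst \<alpha> \<beta>, \<beta>\<^sup>-\<^sup>1)"
proof -
  show g: "group (aut_pairs H)"
  proof (rule groupI)
    show "\<exists>y\<in>carrier (aut_pairs H). y \<otimes>\<^bsub>aut_pairs H\<^esub> x = \<one>\<^bsub>aut_pairs H\<^esub>"
      if G: "x \<in> carrier (aut_pairs H)" for x
    proof -
      obtain \<alpha> \<beta> where x: "x = (\<alpha>, \<beta>)" and ab: "\<alpha> \<in> Aut" "\<beta> \<in> Aut" using G by auto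
      then show ?thesis
        by (intro bexI[of _ "(inv_fst \<alpha> \<beta>, \<beta>\<^sup>-\<^sup>1)"])
          (simp_all add: x fun_eq_iff ab[THEN Aut_inv1] ab[THEN Aut_inv2] Aut_inv Aut_comp)
    qed
  qed (auto simp: fun_eq_iff o_inv_distrib Aut_bij Aut_inv1 Aut_inv2 intro!: Aut_comp Aut_inv Aut_id)
  show "inv\<^bsub>aut_pairs H\<^esub> (\<alpha>, \<beta>) = (inv_fst \<alpha> \<beta>, \<beta>\<^sup>-\<^sup>1)"
    if ab: "\<alpha> \<in> Aut" "\<beta> \<in> Aut"
    by (rule group.inv_equality[OF g])
      (simp_all add: fun_eq_iff ab[THEN Aut_inv1] ab[THEN Aut_inv2] ab Aut_inv Aut_comp)
qed

subsection \<open>Iterated comultiplication\<close>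

text \<open>Named because the coproduct and the antipode of \<open>CT(H)\<close> both split an
  element of H into three legs.\<close>

definition sw3 :: "'h \<Rightarrow> ('h \<Rightarrow> 'h \<Rightarrow> 'h \<Rightarrow> 'k) \<Rightarrow> 'k" where
  "sw3 x t = sw x (\<lambda>a r. sw r (t a))"

lemma lin_sw3: "lin_end g \<Longrightarrow> lin (\<lambda>x. sw3 (g x) t)"
  unfolding sw3_def by (rule lin_sw)

lemma lin_sw3_arg: "(\<And>a b c. lin (\<lambda>x. t x a b c)) \<Longrightarrow> lin (\<lambda>x. sw3 h (t x))"
  unfolding sw3_def by (intro lin_sw_arg)

lemma sw3_mult_left: "c * sw3 h t = sw3 h (\<lambda>x y z. c * t x y z)"
  and sw3_mult_right: "sw3 h t * c = sw3 h (\<lambda>x y z. t x y z * c)"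
  by (simp_all add: sw3_def sw_mult_left sw_mult_right)

lemma sw3_sum: "(\<Sum>i\<in>I. sw3 h (t i)) = sw3 h (\<lambda>x y z. \<Sum>i\<in>I. t i x y z)"
  by (simp add: sw3_def sw_sum)

lemma sw3_cong: "(\<And>a b c. t a b c = t' a b c) \<Longrightarrow> sw3 x t = sw3 x t'"
  by (rule arg_cong[of t t' "sw3 x"]) (intro ext)

lemma sw_sw3: "sw x (\<lambda>a b. sw3 y (t a b)) = sw3 y (\<lambda>c d e. sw x (\<lambda>a b. t a b c d e))"
  unfolding sw3_def by (subst sw_swap) (rule sw_cong, rule sw_swap)

lemma sw3_sw3: "sw3 x (\<lambda>a b c. sw3 y (t a b c)) = sw3 y (\<lambda>u v w. sw3 x (\<lambda>a b c. t a b c u v w))"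
  unfolding sw3_def[of x] by (simp add: sw_sw3)

lemmas lin_intros3 = lin_intros lin_end_S' lin_sw3 lin_sw3_arg

context
  fixes t
  assumes t: "\<And>y z. lin (\<lambda>x. t x y z)" "\<And>x z. lin (\<lambda>y. t x y z)" "\<And>x y. lin (\<lambda>z. t x y z)"
begin

lemma sw3_left: "sw x (\<lambda>r c. sw r (\<lambda>a b. t a b c)) = sw3 x t"
  unfolding sw3_def by (rule sw_coassoc) (intro t)+

text \<open>The legs of the right factor are put outside and those of the left factor inside, so
  that the inner sum can be abbreviated when coassociativity is proved.\<close>

lemma sw3_mult: "sw3 (y * z) t = sw3 z (\<lambda>z1 z2 z3. sw3 y (\<lambda>y1 y2 y3. t (y1 * z1) (y2 * z2) (y3 * z3)))"
proof -
  note l = lin_intros t[THEN lin_map_comp[of H H, rotated]]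
  have "sw3 (y * z) t = sw y (\<lambda>y1 y'. sw z (\<lambda>z1 z'. sw y' (\<lambda>y2 y3. sw z' (\<lambda>z2 z3. t (y1 * z1) (y2 * z2)
      (y3 * z3)))))"
    unfolding sw3_def by (simp add: sw_mult l)
  also have "\<dots> = sw z (\<lambda>z1 z'. sw y (\<lambda>y1 y'. sw z' (\<lambda>z2 z3. sw y' (\<lambda>y2 y3. t (y1 * z1) (y2 * z2) (y3 * z3)))))"
    by (subst sw_swap) (rule sw_cong, rule sw_cong, rule sw_swap)
  also have "\<dots> = sw z (\<lambda>z1 z'. sw z' (\<lambda>z2 z3. sw y (\<lambda>y1 y'. sw y' (\<lambda>y2 y3. t (y1 * z1) (y2 * z2) (y3 * z3)))))"
    by (rule sw_cong, rule sw_swap)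
  finally show ?thesis by (simp add: sw3_def)
qed

lemma sw3_Aut:
  assumes "\<alpha> \<in> Aut"
  shows "sw3 (\<alpha> x) t = sw3 x (\<lambda>x1 x2 x3. t (\<alpha> x1) (\<alpha> x2) (\<alpha> x3))"
  unfolding sw3_def
  by (simp add: sw_Aut[OF assms] lin_intros t lin_end_Aut[OF assms] t[THEN lin_map_comp[of H H, rotated]])

lemma sw3_S': "sw3 (S' x) t = sw3 x (\<lambda>x1 x2 x3. t (S' x3) (S' x2) (S' x1))"
proof -
  note l = lin_intros3 t t[THEN lin_map_comp[of H H, rotated]]
  have "sw3 (S' x) t = sw x (\<lambda>r x3. sw r (\<lambda>x1 x2. t (S' x3) (S' x2) (S' x1)))"
    unfolding sw3_def by (simp add: sw_S' l)
  also have "\<dots> = sw x (\<lambda>x1 r. sw r (\<lambda>x2 x3. t (S' x3) (S' x2) (S' x1)))"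
    by (rule sw_coassoc) (intro l)+
  finally show ?thesis by (simp add: sw3_def)
qed

end

subsection \<open>The dual space\<close>

abbreviation "D \<equiv> dual_space H"

lemma dual_simps [simp]: "vcarrier D = {p. lin p}" "vscale D = fun_scale"
  by (simp_all add: dual_space_def)

lemma vspace_dual: "vspace D"
  unfolding vspace_def
proof
  show "vector_space (vscale D)" by (simp add: vector_space_fun_scale)
  have "fun_vs.subspace {p. lin p}"
    by (rule fun_vs.subspaceI)
      (auto simp: zero_fun_def plus_fun_def fun_scale_def
        intro: lin_map_zero[OF vspace_ground] lin_map_plus[OF vspace_ground] lin_mult_left)
  then show "module.subspace (vscale D) (vcarrier D)" by simp
qed

lemma lin_eval: "lin_map D ground (\<lambda>p. p x)"
  by (rule lin_mapI) (simp_all add: fun_scale_def)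

text \<open>In the dual the roles are exchanged: the dual basis supplies the vectors, evaluation at
  basis elements the coordinates.\<close>

lemma coords_D: "coords D B e (\<lambda>b p. p b)"
  unfolding coords_def
proof (intro conjI ballI)
  fix p assume "p \<in> vcarrier D"
  then have "(\<Sum>b\<in>B. vscale D (p b) (e b)) x = p x" for x
    using lin_expand[of p x] by (simp add: sum_fun_apply fun_scale_def mult.commute)
  then show "p = (\<Sum>b\<in>B. vscale D (p b) (e b))"
    by (intro ext) (rule sym)
qed (simp_all add: lin_e lin_eval)

lemma functional_dual: "lin_map D ground \<phi> \<Longrightarrow> lin p \<Longrightarrow> \<phi> p = (\<Sum>b\<in>B. p b * \<phi> (e b))"
  using coords_lin_map[OF coords_D vspace_dual, of ground \<phi> p] by simp

lemma conv_sw: "lin p \<Longrightarrow> lin q \<Longrightarrow> conv H p q x = sw x (\<lambda>a b. p a * q b)"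
  unfolding conv_def
  using tensor_lift_ground[OF bilin_map_mult, of H p H q "comul H x"]
  by (simp add: lin_map_carrier[OF comul_lin] comul_sw lin_intros)

lemma lin_map_cong': "(\<And>x. x \<in> vcarrier V \<Longrightarrow> f x = g x) \<Longrightarrow> vspace V \<Longrightarrow> lin_map V W g \<Longrightarrow> lin_map V W f"
  by (rule lin_map_cong[of V g f W]) auto

lemma lin_conv: "lin p \<Longrightarrow> lin q \<Longrightarrow> lin (conv H p q)"
  by (rule lin_map_cong'[OF conv_sw vspace_H lin_sw_fixed])

lemma conv3_sw: "lin p \<Longrightarrow> lin q \<Longrightarrow> lin r \<Longrightarrow>
    conv H (conv H p q) r x = sw3 x (\<lambda>a b c. p a * q b * r c)"
  by (subst sw3_left[symmetric]) (simp_all add: conv_sw lin_conv lin_intros sw_mult_right)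

lemma lin_map_dualI:
  assumes "\<And>y. y \<in> vcarrier V \<Longrightarrow> lin (f y)" "\<And>x. lin_map V ground (\<lambda>y. f y x)"
  shows "lin_map V D f"
  by (rule lin_mapI)
    (simp_all add: assms(1) fun_eq_iff fun_scale_def lin_map_add[OF assms(2)] lin_map_scale[OF assms(2)])

lemma lin_map_conv:
  assumes q: "lin q"
  shows "lin_map D D (\<lambda>p. conv H p q)" "lin_map D D (conv H q)"
proof -
  have "lin_map D ground (\<lambda>p. sw x (\<lambda>a b. p a * q b))" "lin_map D ground (\<lambda>p. sw x (\<lambda>a b. q a * p b))" for x
    unfolding sw_def by (intro lin_map_sums vspace_ground lin_map_mult_left lin_map_mult_right lin_eval)+
  from lin_map_cong'[OF _ vspace_dual this(1)] lin_map_cong'[OF _ vspace_dual this(2)]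
  have "lin_map D ground (\<lambda>p. conv H p q x)" "lin_map D ground (\<lambda>p. conv H q p x)" for x
    by (simp_all add: conv_sw q)
  then show "lin_map D D (\<lambda>p. conv H p q)" "lin_map D D (conv H q)"
    by (intro lin_map_dualI; simp add: lin_conv q)+
qed

text \<open>The definite description is resolved here. Existence follows by expanding both arguments
  of p(h h') in the basis; uniqueness holds because evaluations at pairs of basis elements are
  coordinates on the tensor square of the dual.\<close>

lemma dual_comul_eq:
  assumes p: "lin p"
  shows "dual_comul H p = (\<Sum>i\<in>B. \<Sum>j\<in>B. fun_scale (p (i * j)) (tensor D D (e i) (e j)))" (is "_ = ?t")
  unfolding dual_comul_def
proof (rule the_equality)
  have T: "?t \<in> vcarrier (tensor_space D D)"
  proof (intro vspace_sum vspace_tensor_space)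
    fix i j
    show "fun_scale (p (i * j)) (tensor D D (e i) (e j)) \<in> vcarrier (tensor_space D D)"
      using vspace_scale[OF vspace_tensor_space tensor_in_tensor_space[of "e i" D "e j" D]]
      by (simp add: lin_e)
  qed
  have b: "bilin_map D D ground (\<lambda>p1 p2. p1 h * p2 h')" for h h' by (intro bilin_map_mult lin_eval)
  have ev: "tensor_lift D D ground (\<lambda>p1 p2. p1 h * p2 h') t = t (\<lambda>p1 p2. p1 h * p2 h')"
    if "t \<in> vcarrier (tensor_space D D)" for t h h'
    by (rule tensor_lift_ground[OF b that])
  have "?t (\<lambda>p1 p2. p1 h * p2 h') = p (h * h')" for h h'
  proof -
    have "?t (\<lambda>p1 p2. p1 h * p2 h') = (\<Sum>i\<in>B. e i h * (\<Sum>j\<in>B. e j h' * p (i * j)))"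
      by (simp add: sum_fun_apply fun_scale_def tensor_apply[OF b] sum_distrib_left ac_simps)
    also have "\<dots> = (\<Sum>i\<in>B. e i h * p (i * h'))"
      by (intro sum.cong refl arg_cong2[of _ _ _ _ "(*)"] lin_expand[of "\<lambda>j. p (_ * j)"])
        (intro lin_map_comp[OF _ p] lin_intros)
    also have "\<dots> = p (h * h')"
      by (rule lin_expand[of "\<lambda>i. p (i * h')"]) (intro lin_map_comp[OF _ p] lin_intros)
    finally show ?thesis .
  qed
  then show *: "?t \<in> vcarrier (tensor_space D D) \<and>
      (\<forall>h h'. tensor_lift D D ground (\<lambda>p1 p2. p1 h * p2 h') ?t = p (h * h'))"
    using T by (simp add: ev)
  fix t assume t: "t \<in> vcarrier (tensor_space D D) \<and>
      (\<forall>h h'. tensor_lift D D ground (\<lambda>p1 p2. p1 h * p2 h') t = p (h * h'))"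
  show "t = ?t"
  proof (rule coords_eqI[OF coords_tensor[OF coords_D vspace_dual coords_D vspace_dual] _ T])
    have "t (\<lambda>p1 p2. p1 i * p2 j) = p (i * j)" "?t (\<lambda>p1 p2. p1 i * p2 j) = p (i * j)" for i j
      using t * ev[of t i j] ev[of ?t i j] by metis+
    then show "(case ij of (i, j) \<Rightarrow> \<lambda>t. t (\<lambda>v w. v i * w j)) t
        = (case ij of (i, j) \<Rightarrow> \<lambda>t. t (\<lambda>v w. v i * w j)) ?t" for ij :: "'h \<times> 'h"
      by (simp only: split: prod.split) blast
  qed (use t in simp)
qed

lemma lin_map_dual_comul: "lin_map D (tensor_space D D) (dual_comul H)"
proof (rule lin_map_cong'[OF dual_comul_eq vspace_dual])
  have "lin_map D (tensor_space D D) (\<lambda>p. \<Sum>i\<in>B. \<Sum>j\<in>B. vscale (tensor_space D D) (p (i * j)) (tensor D D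
      (e i) (e j)))"
    by (intro lin_map_sums lin_map_functional vspace_tensor_space lin_eval tensor_in_tensor_space)
      (simp_all add: lin_e)
  then show "lin_map D (tensor_space D D) (\<lambda>p. \<Sum>i\<in>B. \<Sum>j\<in>B. fun_scale (p (i * j)) (tensor D D (e i) (e j)))"
    by simp
qed simp

lemma dual_comul_form:
  "lin p \<Longrightarrow> bilin_map D D ground b \<Longrightarrow> dual_comul H p b = (\<Sum>i\<in>B. \<Sum>j\<in>B. p (i * j) * b (e i) (e j))"
  by (simp add: dual_comul_eq sum_fun_apply fun_scale_def tensor_apply)

subsection \<open>The space \<open>H\<^sup>* \<otimes> H\<close>\<close>

abbreviation "V \<equiv> CT_space H"

definition ev :: "'h \<Rightarrow> ('h \<Rightarrow> 'k) \<Rightarrow> ('k, 'h) ct \<Rightarrow> 'k" where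
  "ev x f X = X (\<lambda>p h. p x * f h)"

lemma vspace_V: "vspace V"
  by (simp add: CT_space_def vspace_tensor_space)

lemma vscale_V [simp]: "vscale V = fun_scale"
  by (simp add: CT_space_def)

lemma bilin_bowtie: "bilin_map D H V (bowtie H)"
  using bilin_map_tensor[of D H] by (simp add: CT_space_def bowtie_def[abs_def])

lemma bowtie_in_V: "lin p \<Longrightarrow> bowtie H p h \<in> vcarrier V"
  by (simp add: CT_space_def bowtie_def tensor_in_tensor_space)

lemma lin_map_bowtie: "lin p \<Longrightarrow> lin_map H V (bowtie H p)" "lin_map D V (\<lambda>p. bowtie H p h)"
  using bilin_map_left[OF bilin_bowtie] bilin_map_right[OF bilin_bowtie] by simp_all

lemma lin_map_ev: "lin_map V ground (ev x f)"
  unfolding ev_def[abs_def] CT_space_def by (rule lin_map_eval)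

lemma ev_bowtie: "lin p \<Longrightarrow> lin f \<Longrightarrow> ev x f (bowtie H p h) = p x * f h"
  unfolding ev_def bowtie_def
  by (subst tensor_apply) (auto intro!: bilin_map_mult lin_eval)

abbreviation coord_V :: "'h \<times> 'h \<Rightarrow> ('k, 'h) ct \<Rightarrow> 'k" where
  "coord_V \<equiv> \<lambda>(i, j). ev i (e j)"

lemma coords_V: "coords V (B \<times> B) (\<lambda>(i, j). bowtie H (e i) j) coord_V"
  using coords_tensor[OF coords_D vspace_dual coords_H vspace_H]
  by (simp add: CT_space_def bowtie_def ev_def[abs_def])

lemma V_eqI:
  assumes "X \<in> vcarrier V" "Y \<in> vcarrier V" "\<And>x f. lin f \<Longrightarrow> ev x f X = ev x f Y"
  shows "X = Y"
  by (rule coords_eqI[OF coords_V assms(1,2)]) (auto simp: assms(3) lin_e)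

lemma V_map_eqI:
  assumes "lin_map V U F" "lin_map V U G"
    and "\<And>p h. lin p \<Longrightarrow> F (bowtie H p h) = G (bowtie H p h)" and "X \<in> vcarrier V"
  shows "F X = G X"
  by (rule lin_map_tensor_unique[of D H U F G X])
    (use assms in \<open>simp_all add: CT_space_def bowtie_def\<close>)

lemma V_map_ev_eqI:
  assumes F: "lin_map V V F" and G: "lin_map V V G" and X: "X \<in> vcarrier V"
    and eq: "\<And>p h x f. lin p \<Longrightarrow> lin f \<Longrightarrow> ev x f (F (bowtie H p h)) = ev x f (G (bowtie H p h))"
  shows "F X = G X"
  by (rule V_map_eqI[OF F G _ X])
    (intro V_eqI lin_map_carrier[OF F] lin_map_carrier[OF G] bowtie_in_V eq)

lemma CT_lift_bowtie:
  "vspace U \<Longrightarrow> bilin_map D H U b \<Longrightarrow> lin p \<Longrightarrow> CT_lift H U b (bowtie H p h) = b p h"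
  unfolding CT_lift_def bowtie_def by (rule tensor_lift_tensor) simp_all

lemma lin_map_CT_lift: "vspace U \<Longrightarrow> bilin_map D H U b \<Longrightarrow> lin_map V U (CT_lift H U b)"
  unfolding CT_lift_def CT_space_def by (rule lin_map_tensor_lift)

lemma lin_shift: "lin p \<Longrightarrow> lin (\<lambda>x. p (x * b))"
  by (rule lin_map_comp[of H H]) (intro lin_intros)

lemma lin_map_shift: "lin p \<Longrightarrow> lin_map H D (\<lambda>b x. p (x * b))"
  by (rule lin_map_dualI) (rule lin_map_comp[of H H _ ground p], rule lin_end_mult, rule lin_end_id,
      assumption)+

text \<open>When the three legs are expanded in the basis, the coefficients are the threefold
  convolution products of dual basis elements. Read from right to left, this absorbs the products
  \<open>h\<^sup>i h\<^sup>b h\<^sup>j\<close> that arise in the coproduct of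
  \<open>CT(H)\<close>.\<close>

lemma sw3_expand:
  assumes t: "\<And>y z. lin (\<lambda>x. t x y z)" "\<And>x z. lin (\<lambda>y. t x y z)" "\<And>x y. lin (\<lambda>z. t x y z)"
  shows "sw3 x t = (\<Sum>i\<in>B. \<Sum>b\<in>B. \<Sum>j\<in>B. conv H (conv H (e i) (e b)) (e j) x * t i b j)"
proof -
  have "t u v w = (\<Sum>i\<in>B. \<Sum>b\<in>B. \<Sum>j\<in>B. e i u * e b v * e j w * t i b j)" for u v w
  proof -
    have "t u v w = (\<Sum>i\<in>B. e i u * (\<Sum>b\<in>B. e b v * (\<Sum>j\<in>B. e j w * t i b j)))"
      by (simp add: lin_expand[OF t(1)] lin_expand[OF t(2)] lin_expand[OF t(3)])
    also have "\<dots> = (\<Sum>i\<in>B. \<Sum>b\<in>B. \<Sum>j\<in>B. e i u * e b v * e j w * t i b j)"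
      by (simp add: sum_distrib_left ac_simps)
    finally show ?thesis .
  qed
  then have "t = (\<lambda>u v w. \<Sum>i\<in>B. \<Sum>b\<in>B. \<Sum>j\<in>B. e i u * e b v * e j w * t i b j)"
    by blast
  then have "sw3 x t = sw3 x (\<lambda>u v w. \<Sum>i\<in>B. \<Sum>b\<in>B. \<Sum>j\<in>B. e i u * e b v * e j w * t i b j)"
    by (rule arg_cong)
  also have "\<dots> = (\<Sum>i\<in>B. \<Sum>b\<in>B. \<Sum>j\<in>B. conv H (conv H (e i) (e b)) (e j) x * t i b j)"
    by (simp add: conv3_sw lin_e flip: sw3_sum sw3_mult_right)
  finally show ?thesis .
qed

section \<open>The structure maps of \<open>CT(H)\<close>\<close>

lemma lin_app: "lin f \<Longrightarrow> lin_end g \<Longrightarrow> lin (\<lambda>x. f (g x))"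
  by (rule lin_map_comp)

abbreviation "VV \<equiv> tensor_space V V"

lemma vspace_VV: "vspace VV"
  by (rule vspace_tensor_space)

lemmas bilin_tensor_V = bilin_map_tensor[of V V]

lemma lin_map_tensor_bowtie:
  "Y \<in> vcarrier V \<Longrightarrow> lin_map D VV (\<lambda>p. tensor V V (bowtie H p h) Y)"
  "Y \<in> vcarrier V \<Longrightarrow> lin p \<Longrightarrow> lin_map H VV (\<lambda>h. tensor V V (bowtie H p h) Y)"
  "Y \<in> vcarrier V \<Longrightarrow> lin_map D VV (\<lambda>p. tensor V V Y (bowtie H p h))"
  "Y \<in> vcarrier V \<Longrightarrow> lin p \<Longrightarrow> lin_map H VV (\<lambda>h. tensor V V Y (bowtie H p h))"
  by (rule lin_map_comp[OF lin_map_bowtie(2) bilin_map_left[OF bilin_tensor_V]], assumption)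
    (rule lin_map_comp[OF lin_map_bowtie(1) bilin_map_left[OF bilin_tensor_V]], assumption+,
     rule lin_map_comp[OF lin_map_bowtie(2) bilin_map_right[OF bilin_tensor_V]], assumption,
     rule lin_map_comp[OF lin_map_bowtie(1) bilin_map_right[OF bilin_tensor_V]], assumption+)

section \<open>The comultiplication of \<open>CT(H)\<close>\<close>

context
  fixes \<alpha> \<beta> :: "'h \<Rightarrow> 'h"
  assumes \<alpha>: "\<alpha> \<in> Aut" and \<beta>: "\<beta> \<in> Aut"
begin

text \<open>The innermost layer of \<open>CT_comul\<close>, separated so that bilinearity can be
  proved layer by layer.\<close>

definition comul_term :: "('h \<Rightarrow> 'k) \<Rightarrow> ('h \<Rightarrow> 'k) \<Rightarrow> 'h \<Rightarrow> 'h \<Rightarrow> (('k, 'h) ct, ('k, 'h) ct, 'k) tensor" where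
  "comul_term p1 p2 h1 h2 = (\<Sum>i\<in>B. \<Sum>j\<in>B. tensor V V (bowtie H p1 (\<beta> j * h1 * S' (\<alpha> i)))
    (bowtie H (conv H (conv H (e i) p2) (e j)) h2))"

text \<open>Well-definedness: a lift is determined by its form only if the form is bilinear, so the
  term must be linear in both functionals and in both legs of h.\<close>

lemma lin_map_comul_term:
  "lin p2 \<Longrightarrow> lin_map D VV (\<lambda>p1. comul_term p1 p2 h1 h2)"
  "lin p1 \<Longrightarrow> lin_map D VV (\<lambda>p2. comul_term p1 p2 h1 h2)"
  "lin p1 \<Longrightarrow> lin p2 \<Longrightarrow> bilin_map H H VV (comul_term p1 p2)"
proof -
  show "lin_map D VV (\<lambda>p1. comul_term p1 p2 h1 h2)" if "lin p2"
    unfolding comul_term_def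
    by (intro lin_map_sums vspace_VV lin_map_tensor_bowtie(1) bowtie_in_V lin_conv lin_e that)
  show "lin_map D VV (\<lambda>p2. comul_term p1 p2 h1 h2)" if "lin p1"
    unfolding comul_term_def
    by (intro lin_map_sums vspace_VV lin_map_comp[OF lin_map_comp[OF lin_map_conv(2) lin_map_conv(1)]
          lin_map_tensor_bowtie(3)] bowtie_in_V lin_e that)
  show "bilin_map H H VV (comul_term p1 p2)" if "lin p1" "lin p2"
    unfolding comul_term_def
    by (intro bilin_mapI lin_map_sums vspace_VV lin_map_tensor_bowtie(4)
        lin_map_comp[OF lin_end_mult(2)[OF lin_end_mult(1)[OF lin_end_id]] lin_map_tensor_bowtie(2)]
        bowtie_in_V lin_conv lin_e that)
qed

definition comul_fun :: "('h \<Rightarrow> 'k) \<Rightarrow> 'h \<Rightarrow> (('k, 'h) ct, ('k, 'h) ct, 'k) tensor" where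
  "comul_fun p h = tensor_lift D D VV (\<lambda>p1 p2. tensor_lift H H VV (comul_term p1 p2) (comul H h))
      (dual_comul H p)"

lemma bilin_map_comul_fun:
  "bilin_map D D VV (\<lambda>p1 p2. tensor_lift H H VV (comul_term p1 p2) (comul H h))"
  "bilin_map D H VV comul_fun"
proof -
  have ch: "comul H h \<in> vcarrier (tensor_space H H)" for h by (rule lin_map_carrier[OF comul_lin]) simp
  show 1: "bilin_map D D VV (\<lambda>p1 p2. tensor_lift H H VV (comul_term p1 p2) (comul H h))" for h
    by (rule bilin_mapI)
      (rule lin_map_lift_param[OF vspace_VV lin_map_comul_term(3) lin_map_comul_term(1) ch vspace_dual],
          simp_all,
       rule lin_map_lift_param[OF vspace_VV lin_map_comul_term(3) lin_map_comul_term(2) ch vspace_dual],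
           simp_all)
  show "bilin_map D H VV comul_fun"
    unfolding comul_fun_def[abs_def]
  proof (rule bilin_mapI)
    show "lin_map D VV (\<lambda>p. tensor_lift D D VV (\<lambda>p1 p2. tensor_lift H H VV (comul_term p1 p2) (comul H
        h)) (dual_comul H p))" for h
      by (rule lin_map_comp[OF lin_map_dual_comul lin_map_tensor_lift[OF vspace_VV 1]])
    fix p assume "p \<in> vcarrier D"
    show "lin_map H VV (\<lambda>h. tensor_lift D D VV (\<lambda>p1 p2. tensor_lift H H VV (comul_term p1 p2) (comul H
        h)) (dual_comul H p))"
      by (rule lin_map_lift_param[OF vspace_VV 1 _ lin_map_carrier[OF lin_map_dual_comul \<open>p \<in> _\<close>] vspace_H])
        (rule lin_map_comp[OF comul_lin lin_map_tensor_lift[OF vspace_VV lin_map_comul_term(3)]], simp_all)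
  qed
qed

lemma CT_comul_eq: "CT_comul H B (\<alpha>, \<beta>) = CT_lift H VV comul_fun"
  by (simp add: CT_comul_def Let_def comul_fun_def[abs_def] comul_term_def[abs_def])

lemma lin_map_CT_comul: "lin_map V VV (CT_comul H B (\<alpha>, \<beta>))"
  unfolding CT_comul_eq by (rule lin_map_CT_lift[OF vspace_VV bilin_map_comul_fun(2)])

text \<open>
  The functionals \<open>h\<^sup>i p\<^sub>2 h\<^sup>j\<close> are expanded in the dual basis. If \<open>T\<close> depends on its second argument
  through evaluation at \<open>y\<close>, then the sum over \<open>c\<close> collapses to the term \<open>c = y\<close> by \<open>lin_expand\<close>.
\<close>

lemma CT_comul_bowtie:
  assumes p: "lin p" and T: "bilin_map V V ground T"
  shows "CT_comul H B (\<alpha>, \<beta>) (bowtie H p h) T = sw h (\<lambda>h1 h2. \<Sum>c\<in>B. sw3 c (\<lambda>c1 c2 c3.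
    T (bowtie H (\<lambda>x. p (x * c2)) (\<beta> c3 * h1 * S' (\<alpha> c1))) (bowtie H (e c) h2)))"
proof -
  have Tl: "lin_map V ground (\<lambda>X. T X Y)" if "Y \<in> vcarrier V" for Y by (rule bilin_map_left[OF T that])
  have Tr: "lin_map V ground (T X)" if "X \<in> vcarrier V" for X by (rule bilin_map_right[OF T that])
  have ch: "comul H h \<in> vcarrier (tensor_space H H)" by (rule lin_map_carrier[OF comul_lin]) simp
  let ?X = "\<lambda>a b i j h1 h2. T (bowtie H (e a) (\<beta> j * h1 * S' (\<alpha> i))) (bowtie H (conv H (conv H (e i) (e
      b)) (e j)) h2)"
  have trm: "comul_term p1 p2 h1 h2 T = (\<Sum>i\<in>B. \<Sum>j\<in>B. T (bowtie H p1 (\<beta> j * h1 * S' (\<alpha> i)))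
      (bowtie H (conv H (conv H (e i) p2) (e j)) h2))" for p1 p2 h1 h2
    by (simp add: comul_term_def sum_fun_apply tensor_apply[OF T])
  have "comul H h (\<lambda>h1 h2. comul_term p1 p2 h1 h2 T) = sw h (\<lambda>h1 h2. comul_term p1 p2 h1 h2 T)"
    if "lin p1" "lin p2" for p1 p2
  proof (rule comul_sw)
    note b = lin_map_comul_term(3)[OF that]
    show "lin (\<lambda>h1. comul_term p1 p2 h1 h2 T)" for h2
      by (rule lin_map_comp[OF bilin_map_left[OF b, of h2] lin_map_eval[of V V T]]) simp
    show "lin (\<lambda>h2. comul_term p1 p2 h1 h2 T)" for h1
      by (rule lin_map_comp[OF bilin_map_right[OF b, of h1] lin_map_eval[of V V T]]) simp
  qed
  moreover have "tensor_lift H H VV (comul_term p1 p2) (comul H h) T = comul H h (\<lambda>h1 h2. comul_term p1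
      p2 h1 h2 T)"
    if "lin p1" "lin p2" for p1 p2
    by (rule tensor_lift_eval[OF vspace_VV lin_map_comul_term(3)[OF that] lin_map_eval[of V V T] ch])
  ultimately have lift: "tensor_lift H H VV (comul_term (e a) (e b)) (comul H h) T
      = sw h (\<lambda>h1 h2. \<Sum>i\<in>B. \<Sum>j\<in>B. ?X a b i j h1 h2)" for a b
    by (simp add: lin_e trm)
  have "CT_comul H B (\<alpha>, \<beta>) (bowtie H p h) T
      = dual_comul H p (\<lambda>p1 p2. tensor_lift H H VV (comul_term p1 p2) (comul H h) T)"
    unfolding CT_comul_eq CT_lift_bowtie[OF vspace_VV bilin_map_comul_fun(2) p] comul_fun_def
    by (rule tensor_lift_eval[OF vspace_VV bilin_map_comul_fun(1) lin_map_eval[of V V T]])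
      (rule lin_map_carrier[OF lin_map_dual_comul], simp add: p)
  also have "\<dots> = (\<Sum>a\<in>B. \<Sum>b\<in>B. p (a * b) * sw h (\<lambda>h1 h2. \<Sum>i\<in>B. \<Sum>j\<in>B. ?X a b i j h1 h2))"
    unfolding dual_comul_form[OF p bilin_map_postcomp[OF bilin_map_comul_fun(1) lin_map_eval[of V V T]]] lift ..
  also have "\<dots> = sw h (\<lambda>h1 h2. \<Sum>a\<in>B. \<Sum>b\<in>B. \<Sum>i\<in>B. \<Sum>j\<in>B. p (a * b) * ?X a b i j h1 h2)"
    by (simp add: sw_mult_left sw_sum sum_distrib_left)
  also have "\<dots> = sw h (\<lambda>h1 h2. \<Sum>c\<in>B. sw3 c (\<lambda>c1 c2 c3.
    T (bowtie H (\<lambda>x. p (x * c2)) (\<beta> c3 * h1 * S' (\<alpha> c1))) (bowtie H (e c) h2)))"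
  proof (rule sw_cong)
    fix h1 h2
    let ?t = "\<lambda>Y c1 c2 c3. T (bowtie H (\<lambda>x. p (x * c2)) (\<beta> c3 * h1 * S' (\<alpha> c1))) Y"
    have t: "lin (\<lambda>c1. ?t Y c1 c2 c3)" "lin (\<lambda>c2. ?t Y c1 c2 c3)" "lin (\<lambda>c3. ?t Y c1 c2 c3)"
      if Y: "Y \<in> vcarrier V" for Y c1 c2 c3
    proof -
      note 1 = lin_map_comp[OF _ Tl[OF Y]] and 2 = lin_map_comp[OF _ lin_map_bowtie(1)[OF lin_shift[OF p]]]
      show "lin (\<lambda>c1. ?t Y c1 c2 c3)" "lin (\<lambda>c3. ?t Y c1 c2 c3)"
        by (intro 1 2 lin_intros3 lin_end_Aut[OF \<alpha>] lin_end_Aut[OF \<beta>])+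
      show "lin (\<lambda>c2. ?t Y c1 c2 c3)"
        by (intro 1 lin_map_comp[OF lin_map_shift[OF p] lin_map_bowtie(2)])
    qed
    have "(\<Sum>a\<in>B. \<Sum>b\<in>B. \<Sum>i\<in>B. \<Sum>j\<in>B. p (a * b) * ?X a b i j h1 h2)
        = (\<Sum>b\<in>B. \<Sum>i\<in>B. \<Sum>j\<in>B. \<Sum>a\<in>B. p (a * b) * ?X a b i j h1 h2)"
      by (subst sum.swap, rule sum.cong[OF refl], subst sum.swap, rule sum.cong[OF refl], rule sum.swap)
    \<comment> \<open>The sum over a rebuilds a functional from its values: \<Sum> p(a b)
      \<open>e a\<close> is the shift x \<mapsto> p(x b).\<close>
    also have "\<dots> = (\<Sum>b\<in>B. \<Sum>i\<in>B. \<Sum>j\<in>B. ?t (bowtie H (conv H (conv H (e i) (e b)) (e j)) h2) i b j)"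
    proof (intro sum.cong refl)
      fix b i j
      have Y: "bowtie H (conv H (conv H (e i) (e b)) (e j)) h2 \<in> vcarrier V"
        by (intro bowtie_in_V lin_conv lin_e)
      show "(\<Sum>a\<in>B. p (a * b) * ?X a b i j h1 h2) = ?t (bowtie H (conv H (conv H (e i) (e b)) (e j)) h2) i b j"
        using functional_dual[OF lin_map_comp[OF lin_map_bowtie(2) Tl[OF Y]] lin_shift[OF p]] by simp
    qed
    \<comment> \<open>The convolution product in the second leg is expanded in the dual basis; its
      values at c are the coefficients that \<open>sw3_expand\<close> recognizes.\<close>
    also have "\<dots> = (\<Sum>b\<in>B. \<Sum>i\<in>B. \<Sum>j\<in>B. \<Sum>c\<in>B. conv H (conv H (e i) (e b)) (e j) c * ?t (bowtie H (e c) h2) i b j)"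
      by (intro sum.cong refl functional_dual[OF lin_map_comp[OF lin_map_bowtie(2) Tr]] bowtie_in_V
          lin_conv lin_e lin_shift p)
    also have "\<dots> = (\<Sum>i\<in>B. \<Sum>b\<in>B. \<Sum>j\<in>B. \<Sum>c\<in>B. conv H (conv H (e i) (e b)) (e j) c * ?t (bowtie H (e c) h2) i b j)"
      by (rule sum.swap)
    also have "\<dots> = (\<Sum>c\<in>B. \<Sum>i\<in>B. \<Sum>b\<in>B. \<Sum>j\<in>B. conv H (conv H (e i) (e b)) (e j) c * ?t (bowtie H (e c) h2) i b j)"
      by (rule sym) (subst sum.swap, rule sum.cong[OF refl], subst sum.swap, rule sum.cong[OF refl],
          rule sum.swap)
    also have "\<dots> = (\<Sum>c\<in>B. sw3 c (?t (bowtie H (e c) h2)))"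
      by (intro sum.cong refl sw3_expand[symmetric] t bowtie_in_V lin_e)
    finally show "(\<Sum>a\<in>B. \<Sum>b\<in>B. \<Sum>i\<in>B. \<Sum>j\<in>B. p (a * b) * ?X a b i j h1 h2)
      = (\<Sum>c\<in>B. sw3 c (?t (bowtie H (e c) h2)))" .
  qed
  finally show ?thesis .
qed

end

section \<open>The counit, and the coproduct followed by an evaluation\<close>

lemma bilin_map_counit: "bilin_map D H ground (\<lambda>p h. p 1 * \<epsilon> h)"
  by (intro bilin_map_mult lin_eval counit_lin)

lemma CT_counit_ev: "X \<in> vcarrier V \<Longrightarrow> CT_counit H X = ev 1 \<epsilon> X"
  unfolding CT_counit_def CT_lift_def ev_def CT_space_def
  by (rule tensor_lift_ground[OF bilin_map_counit])

lemma lin_map_CT_counit: "lin_map V ground (CT_counit H)"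
  unfolding CT_counit_def by (rule lin_map_CT_lift[OF vspace_ground bilin_map_counit])

lemma CT_counit_bowtie: "lin p \<Longrightarrow> CT_counit H (bowtie H p h) = p 1 * \<epsilon> h"
  unfolding CT_counit_def by (rule CT_lift_bowtie[OF vspace_ground bilin_map_counit])

text \<open>Evaluating the second leg at y is what collapses the sum over the dual basis. The
  functional on the first leg stays arbitrary, so that a second coproduct or the counit can be
  inserted there.\<close>

lemma CT_comul_functional_ev:
  assumes "\<alpha> \<in> Aut" "\<beta> \<in> Aut" and p: "lin p" and \<phi>: "lin_map V ground \<phi>" and g: "lin g"
  shows "CT_comul H B (\<alpha>, \<beta>) (bowtie H p h) (\<lambda>X Y. \<phi> X * ev y g Y)
    = sw h (\<lambda>h1 h2. sw3 y (\<lambda>y1 y2 y3. \<phi> (bowtie H (\<lambda>x. p (x * y2)) (\<beta> y3 * h1 * S' (\<alpha> y1))) * g h2))"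
proof -
  have "sw3 c (\<lambda>c1 c2 c3. t c1 c2 c3 * (e c y * g h2)) = e c y * sw3 c (\<lambda>c1 c2 c3. t c1 c2 c3 * g h2)"
    for c t h2 by (simp add: sw3_mult_left ac_simps)
  then show ?thesis
    by (simp add: CT_comul_bowtie assms bilin_map_mult lin_map_ev ev_bowtie lin_e lin_expand lin_sw3[OF
        lin_end_id])
qed

lemma CT_comul_ev_ev:
  assumes "\<alpha> \<in> Aut" "\<beta> \<in> Aut" "lin p" "lin f" "lin g"
  shows "CT_comul H B (\<alpha>, \<beta>) (bowtie H p h) (\<lambda>X Y. ev x f X * ev y g Y)
    = sw h (\<lambda>h1 h2. sw3 y (\<lambda>y1 y2 y3. p (x * y2) * f (\<beta> y3 * h1 * S' (\<alpha> y1)) * g h2))"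
  by (simp add: CT_comul_functional_ev assms lin_map_ev ev_bowtie lin_shift)

section \<open>The multiplication of \<open>CT(H)\<close>\<close>

context
  fixes \<alpha> \<beta> \<gamma> \<delta> :: "'h \<Rightarrow> 'h"
  assumes \<alpha>: "\<alpha> \<in> Aut" and \<delta>: "\<delta> \<in> Aut"
begin

abbreviation (input) "tw \<equiv> \<delta> \<circ> \<alpha> \<circ> \<delta>\<^sup>-\<^sup>1"

lemma Aut_tw: "tw \<in> Aut"
  by (intro Aut_comp Aut_inv \<alpha> \<delta>)

abbreviation (input) "mult_term p h \<equiv> \<lambda>q h'. bowtie H (conv H q p) (\<delta> h * tw h')"

text \<open>Well-definedness of the nested lifts, from the inside out: in q and h', then in p and h
  with the right factor fixed, then in the two factors.\<close>

lemma bilin_map_mult_term: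
  "lin p \<Longrightarrow> bilin_map D H V (mult_term p h)"
  "y \<in> vcarrier V \<Longrightarrow> bilin_map D H V (\<lambda>p h. CT_lift H V (mult_term p h) y)"
  "bilin_map V V V (\<lambda>x y. CT_lift H V (\<lambda>p h. CT_lift H V (mult_term p h) y) x)"
proof -
  have l: "lin_map H V (\<lambda>h. bowtie H (conv H q p) (\<delta> h * c))" "lin_map H V (\<lambda>h'. bowtie H (conv H q p)
      (c * tw h'))"
    if "lin p" "lin q" for p q c
    by (rule lin_map_comp[OF _ lin_map_bowtie(1)[OF lin_conv[OF that(2,1)]]],
        intro lin_intros lin_end_Aut[OF \<delta>])
      (rule lin_map_comp[OF _ lin_map_bowtie(1)[OF lin_conv[OF that(2,1)]]],
        intro lin_intros lin_end_Aut[OF Aut_tw])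
  show 1: "bilin_map D H V (mult_term p h)" if "lin p" for p h
    by (rule bilin_mapI) (rule lin_map_comp[OF lin_map_conv(1)[OF that] lin_map_bowtie(2)],
        rule l(2)[OF that], simp)
  show 2: "bilin_map D H V (\<lambda>p h. CT_lift H V (mult_term p h) y)"
    if y: "y \<in> vcarrier V" for y
  proof (rule bilin_mapI)
    have y': "y \<in> vcarrier (tensor_space D H)" using y by (simp add: CT_space_def)
    show "lin_map D V (\<lambda>p. CT_lift H V (mult_term p h) y)" for h
      unfolding CT_lift_def
      by (rule lin_map_lift_param[OF vspace_V 1 lin_map_comp[OF lin_map_conv(2) lin_map_bowtie(2)] y'
          vspace_dual]) simp_all
    fix p assume "p \<in> vcarrier D"
    then have p: "lin p" by simp
    show "lin_map H V (\<lambda>h. CT_lift H V (mult_term p h) y)"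
      unfolding CT_lift_def
      by (rule lin_map_lift_param[OF vspace_V 1[OF p] l(1)[OF p] y' vspace_H]) simp_all
  qed
  show "bilin_map V V V (\<lambda>x y. CT_lift H V (\<lambda>p h. CT_lift H V (mult_term p h) y) x)"
  proof (rule bilin_mapI)
    show "lin_map V V (\<lambda>x. CT_lift H V (\<lambda>p h. CT_lift H V (mult_term p h) y) x)"
      if "y \<in> vcarrier V" for y
      by (rule lin_map_CT_lift[OF vspace_V 2[OF that]])
    fix x assume "x \<in> vcarrier V"
    then have x: "x \<in> vcarrier (tensor_space D H)" by (simp add: CT_space_def)
    show "lin_map V V (\<lambda>y. CT_lift H V (\<lambda>p h. CT_lift H V (mult_term p h) y) x)"
      unfolding CT_lift_def
      by (rule lin_map_lift_param[OF vspace_V 2[unfolded CT_lift_def]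
            lin_map_CT_lift[OF vspace_V 1, unfolded CT_lift_def] x vspace_V]) simp_all
  qed
qed

lemma lin_map_CT_mult: "lin_map VV V (CT_mult H (\<alpha>, \<beta>) (\<gamma>, \<delta>))"
  unfolding CT_mult_def prod.case by (rule lin_map_tensor_lift[OF vspace_V bilin_map_mult_term(3)])

lemma CT_mult_bowtie:
  assumes "lin p" "lin q"
  shows "CT_mult H (\<alpha>, \<beta>) (\<gamma>, \<delta>) (tensor V V (bowtie H p h) (bowtie H q h'))
    = bowtie H (conv H q p) (\<delta> h * tw h')"
  unfolding CT_mult_def prod.case
  by (simp only: tensor_lift_tensor[OF vspace_V bilin_map_mult_term(3)] bowtie_in_V assms
      CT_lift_bowtie[OF vspace_V bilin_map_mult_term(2)] CT_lift_bowtie[OF vspace_V bilin_map_mult_term(1)])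

text \<open>The factor Z is arbitrary because the antipode law puts an antipode value there, which
  is a sum of pure tensors. Since functionals multiply in the opposite order, Z receives the first
  leg of x.\<close>

lemma ev_CT_mult_left:
  assumes p: "lin p" and f: "lin f" and Z: "Z \<in> vcarrier V"
  shows "ev x f (CT_mult H (\<alpha>, \<beta>) (\<gamma>, \<delta>) (tensor V V (bowtie H p h) Z))
    = sw x (\<lambda>x1 x2. p x2 * ev x1 (\<lambda>w. f (\<delta> h * tw w)) Z)"
proof (rule V_map_eqI[OF _ _ _ Z])
  show "lin_map V ground (\<lambda>Z. ev x f (CT_mult H (\<alpha>, \<beta>) (\<gamma>, \<delta>) (tensor V V (bowtie H p h) Z)))"
    by (rule lin_map_comp[OF bilin_map_right[OF bilin_tensor_V bowtie_in_V[OF p]] lin_map_comp[OF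
        lin_map_CT_mult lin_map_ev]])
  show "lin_map V ground (\<lambda>Z. sw x (\<lambda>x1 x2. p x2 * ev x1 (\<lambda>w. f (\<delta> h * tw w)) Z))"
    unfolding sw_def by (intro lin_map_sums vspace_ground lin_map_mult_left lin_map_ev)
  have l: "lin (\<lambda>w. f (\<delta> h * tw w))" by (rule lin_app[OF f]) (intro lin_intros lin_end_Aut[OF Aut_tw])
  show "ev x f (CT_mult H (\<alpha>, \<beta>) (\<gamma>, \<delta>) (tensor V V (bowtie H p h) (bowtie H q h')))
    = sw x (\<lambda>x1 x2. p x2 * ev x1 (\<lambda>w. f (\<delta> h * tw w)) (bowtie H q h'))" if "lin q" for q h'
    by (simp add: CT_mult_bowtie p that ev_bowtie lin_conv f l conv_sw sw_mult_right del: o_apply)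
      (simp add: ac_simps)
qed

lemma ev_CT_mult_right:
  assumes q: "lin q" and f: "lin f" and Z: "Z \<in> vcarrier V"
  shows "ev x f (CT_mult H (\<alpha>, \<beta>) (\<gamma>, \<delta>) (tensor V V Z (bowtie H q h')))
    = sw x (\<lambda>x1 x2. q x1 * ev x2 (\<lambda>w. f (\<delta> w * tw h')) Z)"
proof (rule V_map_eqI[OF _ _ _ Z])
  show "lin_map V ground (\<lambda>Z. ev x f (CT_mult H (\<alpha>, \<beta>) (\<gamma>, \<delta>) (tensor V V Z (bowtie H q h'))))"
    by (rule lin_map_comp[OF bilin_map_left[OF bilin_tensor_V bowtie_in_V[OF q]] lin_map_comp[OF
        lin_map_CT_mult lin_map_ev]])
  show "lin_map V ground (\<lambda>Z. sw x (\<lambda>x1 x2. q x1 * ev x2 (\<lambda>w. f (\<delta> w * tw h')) Z))"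
    unfolding sw_def by (intro lin_map_sums vspace_ground lin_map_mult_left lin_map_ev)
  have l: "lin (\<lambda>w. f (\<delta> w * tw h'))" by (rule lin_app[OF f]) (intro lin_intros lin_end_Aut[OF \<delta>])
  show "ev x f (CT_mult H (\<alpha>, \<beta>) (\<gamma>, \<delta>) (tensor V V (bowtie H p h) (bowtie H q h')))
    = sw x (\<lambda>x1 x2. q x1 * ev x2 (\<lambda>w. f (\<delta> w * tw h')) (bowtie H p h))" if "lin p" for p h
    by (simp add: CT_mult_bowtie q that ev_bowtie lin_conv f l conv_sw sw_mult_right del: o_apply)
      (simp add: ac_simps)
qed

end

section \<open>The unit of \<open>CT(H)\<close>\<close>

lemma counit_in_D: "lin \<epsilon>"
  by (rule counit_lin)

lemma CT_unit_in_V: "CT_unit H c \<in> vcarrier V"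
  unfolding CT_unit_def using vspace_scale[OF vspace_V bowtie_in_V[OF counit_in_D]] by simp

lemma lin_map_CT_unit: "lin_map ground V (CT_unit H)"
  unfolding CT_unit_def[abs_def]
  using lin_map_functional[OF vspace_V lin_map_id bowtie_in_V[OF counit_in_D]] by simp

lemma CT_unit_1: "CT_unit H 1 = bowtie H \<epsilon> 1"
  by (simp add: CT_unit_def fun_scale_def)

lemma ev_CT_unit: "lin f \<Longrightarrow> ev x f (CT_unit H c) = c * (\<epsilon> x * f 1)"
  unfolding CT_unit_def
  using lin_map_scale[OF lin_map_ev bowtie_in_V[OF counit_in_D]] by (simp add: ev_bowtie counit_in_D)

section \<open>The antipode and the crossing\<close>

context
  fixes \<alpha> \<beta> :: "'h \<Rightarrow> 'h"
  assumes \<alpha>: "\<alpha> \<in> Aut" and \<beta>: "\<beta> \<in> Aut"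
begin

lemma lin_S'_comp: "lin p \<Longrightarrow> lin (p \<circ> S')" "lin_map D D (\<lambda>p. p \<circ> S')"
proof -
  show "lin (p \<circ> S')" if "lin p" for p
    unfolding o_def by (rule lin_app[OF that lin_end_S'[OF lin_end_id]])
  then show "lin_map D D (\<lambda>p. p \<circ> S')"
    by (intro lin_map_dualI) (simp_all add: lin_eval)
qed

lemma bilin_map_antipode_term:
  "bilin_map D H V (\<lambda>p h. \<Sum>i\<in>B. \<Sum>j\<in>B. bowtie H (conv H (conv H (e i) (p \<circ> S')) (e j \<circ> S'))
       (\<beta>\<^sup>-\<^sup>1 j * (\<beta>\<^sup>-\<^sup>1 \<circ> \<alpha>\<^sup>-\<^sup>1 \<circ> S) h * (inv_fst \<alpha> \<beta>) i))"
proof (intro bilin_mapI lin_map_sums vspace_V)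
  show "lin_map D V (\<lambda>p. bowtie H (conv H (conv H (e i) (p \<circ> S')) (e j \<circ> S')) c)" for i j c
    by (rule lin_map_comp[OF lin_map_comp[OF lin_map_comp[OF lin_S'_comp(2) lin_map_conv(2)] lin_map_conv(1)]
          lin_map_bowtie(2)]) (simp_all add: lin_e lin_S'_comp)
  fix p i j assume "p \<in> vcarrier D"
  then have "lin (conv H (conv H (e i) (p \<circ> S')) (e j \<circ> S'))"
    by (intro lin_conv lin_e lin_S'_comp) simp
  then show "lin_map H V (\<lambda>h. bowtie H (conv H (conv H (e i) (p \<circ> S')) (e j \<circ> S'))
       (\<beta>\<^sup>-\<^sup>1 j * (\<beta>\<^sup>-\<^sup>1 \<circ> \<alpha>\<^sup>-\<^sup>1 \<circ> S) h * (inv_fst \<alpha> \<beta>) i))"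
    unfolding o_apply
    by (intro lin_map_comp[OF _ lin_map_bowtie(1)] lin_intros lin_end_Aut[OF Aut_inv[OF \<alpha>]]
        lin_end_Aut[OF Aut_inv[OF \<beta>]])
qed

lemma lin_map_CT_antipode: "lin_map V V (CT_antipode H B (\<alpha>, \<beta>))"
  unfolding CT_antipode_def prod.case by (rule lin_map_CT_lift[OF vspace_V bilin_map_antipode_term])

text \<open>Both basis sums collapse: \<open>e i\<close> evaluated at x1 puts x1 in place of i, and
  \<open>e j\<close> evaluated at \<open>S'\<close> x3 puts \<open>S'\<close> x3 in place of
  j.\<close>

lemma ev_CT_antipode:
  assumes p: "lin p" and f: "lin f"
  shows "ev x f (CT_antipode H B (\<alpha>, \<beta>) (bowtie H p h))
    = sw3 x (\<lambda>x1 x2 x3. p (S' x2) * f (\<beta>\<^sup>-\<^sup>1 (S' x3) * \<beta>\<^sup>-\<^sup>1 (\<alpha>\<^sup>-\<^sup>1 (S h)) * \<beta>\<^sup>-\<^sup>1 (\<alpha>\<^sup>-\<^sup>1 (\<beta> x1))))"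
proof -
  let ?f = "\<lambda>j i. f (\<beta>\<^sup>-\<^sup>1 j * \<beta>\<^sup>-\<^sup>1 (\<alpha>\<^sup>-\<^sup>1 (S h)) * \<beta>\<^sup>-\<^sup>1 (\<alpha>\<^sup>-\<^sup>1 (\<beta> i)))"
  note l = lin_app[OF f] lin_intros lin_end_Aut[OF \<beta>] lin_end_Aut[OF Aut_inv[OF \<alpha>]] lin_end_Aut[OF
      Aut_inv[OF \<beta>]]
  have c: "lin (conv H (conv H (e i) (p \<circ> S')) (e j \<circ> S'))" for i j
    by (intro lin_conv lin_e lin_S'_comp p)
  have "ev x f (CT_antipode H B (\<alpha>, \<beta>) (bowtie H p h))
    = (\<Sum>i\<in>B. \<Sum>j\<in>B. conv H (conv H (e i) (p \<circ> S')) (e j \<circ> S') x * ?f j i)"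
    unfolding CT_antipode_def prod.case CT_lift_bowtie[OF vspace_V bilin_map_antipode_term p]
    by (simp add: lin_map_sum[OF vspace_V lin_map_ev] vspace_sum[OF vspace_V] bowtie_in_V[OF c]
        ev_bowtie[OF c f])
  also have "\<dots> = sw3 x (\<lambda>x1 x2 x3. \<Sum>i\<in>B. \<Sum>j\<in>B. e i x1 * p (S' x2) * e j (S' x3) * ?f j i)"
    by (simp add: conv3_sw lin_e lin_S'_comp p sw3_mult_right sw3_sum)
  also have "\<dots> = sw3 x (\<lambda>x1 x2 x3. p (S' x2) * ?f (S' x3) x1)"
  proof (rule sw3_cong)
    fix x1 x2 x3
    have 1: "(\<Sum>j\<in>B. e j (S' x3) * ?f j i) = ?f (S' x3) i" for i
      by (rule lin_expand) (intro l)
    have 2: "(\<Sum>i\<in>B. e i x1 * ?f (S' x3) i) = ?f (S' x3) x1"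
      by (rule lin_expand) (intro l)
    have "(\<Sum>i\<in>B. \<Sum>j\<in>B. e i x1 * p (S' x2) * e j (S' x3) * ?f j i)
        = p (S' x2) * (\<Sum>i\<in>B. e i x1 * (\<Sum>j\<in>B. e j (S' x3) * ?f j i))"
      by (simp add: sum_distrib_left ac_simps)
    then show "(\<Sum>i\<in>B. \<Sum>j\<in>B. e i x1 * p (S' x2) * e j (S' x3) * ?f j i) = p (S' x2) * ?f (S' x3) x1"
      by (simp only: 1 2)
  qed
  finally show ?thesis .
qed

lemma bilin_map_crossing_term:
  assumes \<delta>: "\<delta> \<in> Aut"
  shows "bilin_map D H V (\<lambda>p h. bowtie H (p \<circ> (\<alpha>\<^sup>-\<^sup>1 \<circ> \<beta>)) ((\<beta>\<^sup>-\<^sup>1 \<circ> \<delta> \<circ> \<alpha> \<circ> \<delta>\<^sup>-\<^sup>1) h))"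
proof (rule bilin_mapI)
  have l: "lin_end (\<alpha>\<^sup>-\<^sup>1 \<circ> \<beta>)" "lin_end (\<beta>\<^sup>-\<^sup>1 \<circ> \<delta> \<circ> \<alpha> \<circ> \<delta>\<^sup>-\<^sup>1)"
    unfolding o_def
    by (intro \<alpha>[THEN lin_end_Aut] \<beta>[THEN lin_end_Aut] \<delta>[THEN lin_end_Aut] \<alpha>[THEN Aut_inv, THEN lin_end_Aut]
        \<beta>[THEN Aut_inv, THEN lin_end_Aut] \<delta>[THEN Aut_inv, THEN lin_end_Aut] lin_end_id)+
  have p: "lin (p \<circ> (\<alpha>\<^sup>-\<^sup>1 \<circ> \<beta>))" if "lin p" for p
    using lin_app[OF that l(1)] by (simp add: o_def)
  show "lin_map D V (\<lambda>p. bowtie H (p \<circ> (\<alpha>\<^sup>-\<^sup>1 \<circ> \<beta>)) c)" for c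
    by (rule lin_map_comp[OF _ lin_map_bowtie(2)], rule lin_map_dualI) (simp_all add: p lin_eval)
  show "lin_map H V (\<lambda>h. bowtie H (p \<circ> (\<alpha>\<^sup>-\<^sup>1 \<circ> \<beta>)) ((\<beta>\<^sup>-\<^sup>1 \<circ> \<delta> \<circ> \<alpha> \<circ> \<delta>\<^sup>-\<^sup>1) h))" if "p \<in> vcarrier D" for p
    by (rule lin_map_comp[OF l(2) lin_map_bowtie(1)[OF p]]) (use that in simp)
qed

lemma lin_map_CT_crossing: "\<delta> \<in> Aut \<Longrightarrow> lin_map V V (CT_crossing H (\<alpha>, \<beta>) (\<gamma>, \<delta>))"
  unfolding CT_crossing_def prod.case by (rule lin_map_CT_lift[OF vspace_V bilin_map_crossing_term])

lemma CT_crossing_bowtie: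
  "\<delta> \<in> Aut \<Longrightarrow> lin p \<Longrightarrow> CT_crossing H (\<alpha>, \<beta>) (\<gamma>, \<delta>) (bowtie H p h)
    = bowtie H (p \<circ> (\<alpha>\<^sup>-\<^sup>1 \<circ> \<beta>)) ((\<beta>\<^sup>-\<^sup>1 \<circ> \<delta> \<circ> \<alpha> \<circ> \<delta>\<^sup>-\<^sup>1) h)"
  unfolding CT_crossing_def prod.case by (rule CT_lift_bowtie[OF vspace_V bilin_map_crossing_term])

text \<open>For F = (x \<mapsto> p(x) h), the crossing composes F with an automorphism on each side.
  This form applies to every element, not only to pure tensors.\<close>

lemma ev_CT_crossing:
  assumes \<delta>: "\<delta> \<in> Aut" and f: "lin f" and X: "X \<in> vcarrier V"
  shows "ev x f (CT_crossing H (\<alpha>, \<beta>) (\<gamma>, \<delta>) X) = ev (\<alpha>\<^sup>-\<^sup>1 (\<beta> x)) (\<lambda>w. f (\<beta>\<^sup>-\<^sup>1 (\<delta> (\<alpha> (\<delta>\<^sup>-\<^sup>1 w))))) X"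
proof (rule V_map_eqI[OF lin_map_comp[OF lin_map_CT_crossing[OF \<delta>] lin_map_ev] lin_map_ev _ X])
  fix p h assume p: "lin p"
  have "lin_end (\<alpha>\<^sup>-\<^sup>1 \<circ> \<beta>)"
    unfolding o_def by (intro \<alpha>[THEN Aut_inv, THEN lin_end_Aut] \<beta>[THEN lin_end_Aut] lin_end_id)
  then have "lin (p \<circ> (\<alpha>\<^sup>-\<^sup>1 \<circ> \<beta>))"
    using lin_app[OF p] by (simp add: o_def)
  moreover have "lin (\<lambda>w. f (\<beta>\<^sup>-\<^sup>1 (\<delta> (\<alpha> (\<delta>\<^sup>-\<^sup>1 w)))))"
    by (rule lin_app[OF f]) (intro \<alpha>[THEN lin_end_Aut] \<delta>[THEN lin_end_Aut]
        \<beta>[THEN Aut_inv, THEN lin_end_Aut] \<delta>[THEN Aut_inv, THEN lin_end_Aut] lin_end_id)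
  ultimately show "ev x f (CT_crossing H (\<alpha>, \<beta>) (\<gamma>, \<delta>) (bowtie H p h))
    = ev (\<alpha>\<^sup>-\<^sup>1 (\<beta> x)) (\<lambda>w. f (\<beta>\<^sup>-\<^sup>1 (\<delta> (\<alpha> (\<delta>\<^sup>-\<^sup>1 w))))) (bowtie H p h)"
    by (simp add: CT_crossing_bowtie[OF \<delta> p] ev_bowtie p f)
qed

end

section \<open>The axioms of a crossed Turaev algebra\<close>

lemma sw3_one:
  "(\<And>y z. lin (\<lambda>x. t x y z)) \<Longrightarrow> (\<And>x z. lin (\<lambda>y. t x y z)) \<Longrightarrow> (\<And>x y. lin (\<lambda>z. t x y z)) \<Longrightarrow> sw3 1 t = t 1 1 1"
  unfolding sw3_def by (simp add: sw_one lin_intros)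

text \<open>Two bracketings of the fivefold coproduct of z, its legs being the arguments of t in
  order. Grouping the two outer pairs is what splitting the first leg of the coproduct produces;
  grouping the inner triple is what splitting the second leg produces.\<close>

lemma sw3_regroup_ends:
  assumes "\<And>b c d e. lin (\<lambda>a. t a b c d e)" "\<And>a c d e. lin (\<lambda>b. t a b c d e)"
    "\<And>a b d e. lin (\<lambda>c. t a b c d e)" "\<And>a b c e. lin (\<lambda>d. t a b c d e)" "\<And>a b c d. lin (\<lambda>e. t a b c d e)"
  shows "sw3 z (\<lambda>z1 z2 z3. sw z3 (\<lambda>c d. sw z1 (\<lambda>a b. t a b z2 c d)))
    = sw3 z (\<lambda>z1 z2 z3. sw3 z2 (\<lambda>a b c. t z1 a b c z3))"
proof -
  note l = assms lin_intros
  have "sw3 z (\<lambda>z1 z2 z3. sw z3 (\<lambda>c d. sw z1 (\<lambda>a b. t a b z2 c d)))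
    = sw z (\<lambda>z1 r. sw r (\<lambda>z2 z3. sw z1 (\<lambda>a b. sw z3 (t a b z2))))"
    unfolding sw3_def by (intro sw_cong sw_swap)
  also have "\<dots> = sw z (\<lambda>z1 r. sw z1 (\<lambda>a b. sw r (\<lambda>z2 z3. sw z3 (t a b z2))))"
    by (intro sw_cong sw_swap)
  also have "\<dots> = sw3 z (\<lambda>z1 z2 z3. sw3 z2 (\<lambda>a b c. t z1 a b c z3))"
    unfolding sw3_def by (simp add: sw_coassoc l)
  finally show ?thesis .
qed

text \<open>Regroupings of the sixfold coproduct that make suitable legs neighbours. In the first,
  the innermost pair is (c, d), enclosed by b and x, then by a and y. In the second, d and x are
  innermost, enclosed by c and y, while a and b form a separate pair.\<close>

lemma
  assumes t: "\<And>b c d x y. lin (\<lambda>a. t a b c d x y)" "\<And>a c d x y. lin (\<lambda>b. t a b c d x y)"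
    "\<And>a b d x y. lin (\<lambda>c. t a b c d x y)" "\<And>a b c x y. lin (\<lambda>d. t a b c d x y)"
    "\<And>a b c d y. lin (\<lambda>x. t a b c d x y)" "\<And>a b c d x. lin (\<lambda>y. t a b c d x y)"
  shows sw_regroup_inner: "sw z (\<lambda>z1 z2. sw3 z1 (\<lambda>a b c. sw3 z2 (t a b c)))
    = sw3 z (\<lambda>a u y. sw u (\<lambda>b v. sw v (\<lambda>m x. sw m (\<lambda>c d. t a b c d x y))))"
    and sw_regroup_outer: "sw z (\<lambda>z1 y. sw3 z1 (\<lambda>a u x. sw3 u (\<lambda>b c d. t a b c d x y)))
    = sw z (\<lambda>u v. sw u (\<lambda>a b. sw v (\<lambda>c w. sw w (\<lambda>m y. sw m (\<lambda>d x. t a b c d x y)))))"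
  unfolding sw3_def by (simp_all add: sw_coassoc t lin_intros)

section \<open>The components are coalgebras\<close>

context
  fixes \<alpha> \<beta> :: "'h \<Rightarrow> 'h"
  assumes \<alpha>: "\<alpha> \<in> Aut" and \<beta>: "\<beta> \<in> Aut"
begin

lemma lin_map_CT_comul_form: "lin_map V ground (\<lambda>X. CT_comul H B (\<alpha>, \<beta>) X T)"
  by (rule lin_map_comp[OF lin_map_CT_comul[OF \<alpha> \<beta>] lin_map_eval])

text \<open>\<open>S'\<close> reverses the coproduct, so the legs of u appear in the opposite order
  to those of v and h.\<close>

lemma sw_twist:
  assumes "\<And>y. lin (\<lambda>x. b x y)" "\<And>x. lin (\<lambda>y. b x y)"
  shows "sw (\<beta> v * h * S' (\<alpha> u)) b = sw v (\<lambda>v1 v2. sw h (\<lambda>h1 h2. sw u (\<lambda>u1 u2.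
    b (\<beta> v1 * h1 * S' (\<alpha> u2)) (\<beta> v2 * h2 * S' (\<alpha> u1)))))"
  by (simp add: sw_mult sw_Aut[OF \<alpha>] sw_Aut[OF \<beta>] sw_S' assms lin_intros3 lin_end_Aut[OF \<alpha>] lin_end_Aut[OF \<beta>]
      assms[THEN lin_app])

text \<open>Both sides reduce to \<open>Q\<close> on the threefold coproduct of h. The five legs of
  z arise on the left by splitting the twisted product \<beta>(z3) h1
  \<open>S'\<close>(\<alpha>(z1)), on the right by splitting the argument y z2 of a shifted
  evaluation.\<close>

lemma CT_coassoc:
  assumes f: "lin f" and g: "lin g" and k: "lin k" and X: "X \<in> vcarrier V"
  shows "CT_comul H B (\<alpha>, \<beta>) X (\<lambda>X Y. CT_comul H B (\<alpha>, \<beta>) X (\<lambda>X Y. ev x f X * ev y g Y) * ev z k Y)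
    = CT_comul H B (\<alpha>, \<beta>) X (\<lambda>X Y. ev x f X * CT_comul H B (\<alpha>, \<beta>) Y (\<lambda>X Y. ev y g X * ev z k Y))"
    (is "?L X = ?R X")
proof (rule V_map_eqI[OF lin_map_CT_comul_form lin_map_CT_comul_form _ X])
  fix p h assume p: "lin p"
  note l = lin_intros3 lin_end_Aut[OF \<alpha>] lin_end_Aut[OF \<beta>] lin_app[OF f] lin_app[OF g] lin_app[OF k]
      lin_app[OF p] f g k p
  \<comment> \<open>\<open>N\<close> collects everything that involves the legs of y, which are the
    same on both sides; only h and z have to be rearranged.\<close>
  define N where "N c u = sw3 y (\<lambda>y1 y2 y3. p (x * y2 * c) * f (\<beta> y3 * u * S' (\<alpha> y1)))" for c u
  have N: "lin_end w \<Longrightarrow> lin (\<lambda>c. N (w c) u)" "lin_end w \<Longrightarrow> lin (\<lambda>u. N c (w u))" for c u w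
    unfolding N_def by (intro l; assumption)+
  define Q where "Q a b c = sw3 z (\<lambda>z1 z2 z3. sw3 z2 (\<lambda>u v w.
      N v (\<beta> w * a * S' (\<alpha> u)) * g (\<beta> z3 * b * S' (\<alpha> z1)) * k c))" for a b c
  have Q: "lin (\<lambda>a. Q a b c)" "lin (\<lambda>b. Q a b c)" "lin (\<lambda>c. Q a b c)" for a b c
    unfolding Q_def by (intro l N)+
  have "?L (bowtie H p h) = sw h (\<lambda>h1 h2. sw3 z (\<lambda>z1 z2 z3.
      sw (\<beta> z3 * h1 * S' (\<alpha> z1)) (\<lambda>u v. N z2 u * g v * k h2)))"
    by (simp add: CT_comul_functional_ev[OF \<alpha> \<beta> p lin_map_CT_comul_form k] CT_comul_ev_ev[OF \<alpha> \<beta>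
        lin_shift[OF p] f g]
        sw_mult_right sw3_mult_right N_def mult.assoc)
  also have "\<dots> = sw h (\<lambda>h1 h2. sw3 z (\<lambda>z1 z2 z3. sw z3 (\<lambda>c d. sw h1 (\<lambda>a b. sw z1 (\<lambda>u v.
      N z2 (\<beta> c * a * S' (\<alpha> v)) * g (\<beta> d * b * S' (\<alpha> u)) * k h2)))))"
    by (simp add: sw_twist l N)
  also have "\<dots> = sw h (\<lambda>h1 h2. sw h1 (\<lambda>a b. sw3 z (\<lambda>z1 z2 z3. sw z3 (\<lambda>c d. sw z1 (\<lambda>u v.
      N z2 (\<beta> c * a * S' (\<alpha> v)) * g (\<beta> d * b * S' (\<alpha> u)) * k h2)))))"
    by (rule sw_cong) (subst sw_sw3, intro sw3_cong sw_swap)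
  also have "\<dots> = sw h (\<lambda>h1 h2. sw h1 (\<lambda>a b. Q a b h2))"
    unfolding Q_def by (intro sw_cong sw3_regroup_ends) (intro l N)+
  also have "\<dots> = sw h (\<lambda>h1 h2. sw h2 (Q h1))"
    by (rule sw_coassoc) (intro Q)+
  also have "\<dots> = ?R (bowtie H p h)"
  proof -
    let ?M = "\<lambda>h1 c. sw3 c (\<lambda>c1 c2 c3. p (x * c2) * f (\<beta> c3 * h1 * S' (\<alpha> c1)))"
    \<comment> \<open>\<beta> preserves products while \<open>S'\<close> \<circ> \<alpha> reverses
      them, so the legs of y and c nest symmetrically around h1.\<close>
    have M: "?M h1 (y * c) = sw3 c (\<lambda>u v w. N v (\<beta> w * h1 * S' (\<alpha> u)))" for h1 c
      unfolding N_def
      by (subst sw3_mult) (intro l | simp add: Aut_mult[OF \<alpha>] Aut_mult[OF \<beta>] S'_mult mult.assoc)+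
    \<comment> \<open>The second leg carries another coproduct and not a single evaluation, so the
      sum over c survives until \<open>e c\<close> has been evaluated at y z2.\<close>
    have "?R (bowtie H p h) = sw h (\<lambda>h1 h2. \<Sum>c\<in>B. ?M h1 c * sw h2 (\<lambda>u1 u2. sw3 z (\<lambda>z1 z2 z3.
        e c (y * z2) * g (\<beta> z3 * u1 * S' (\<alpha> z1)) * k u2)))"
      by (simp add: CT_comul_bowtie[OF \<alpha> \<beta> p bilin_map_mult[OF lin_map_ev lin_map_CT_comul_form]]
          CT_comul_ev_ev[OF \<alpha> \<beta> lin_e g k] ev_bowtie lin_shift p f sw3_mult_right)
    also have "\<dots> = sw h (\<lambda>h1 h2. sw h2 (\<lambda>u1 u2. sw3 z (\<lambda>z1 z2 z3.
        (\<Sum>c\<in>B. e c (y * z2) * ?M h1 c) * g (\<beta> z3 * u1 * S' (\<alpha> z1)) * k u2)))"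
      by (simp add: sw_mult_left[of "sw3 _ _"] sw3_mult_left[of "sw3 _ _"] sw_sum sw3_sum
          sum_distrib_left sum_distrib_right ac_simps)
    also have "\<dots> = sw h (\<lambda>h1 h2. sw h2 (Q h1))"
      unfolding Q_def by (simp only: lin_expand[OF lin_sw3[OF lin_end_id]] M sw3_mult_right)
    finally show ?thesis ..
  qed
  finally show "?L (bowtie H p h) = ?R (bowtie H p h)" .
qed

lemma CT_counit_left:
  assumes f: "lin f" and X: "X \<in> vcarrier V"
  shows "CT_comul H B (\<alpha>, \<beta>) X (\<lambda>X Y. CT_counit H X * ev x f Y) = ev x f X"
proof (rule V_map_eqI[OF lin_map_CT_comul_form lin_map_ev _ X])
  fix p h assume p: "lin p"
  note l = lin_intros3 lin_end_Aut[OF \<alpha>] lin_end_Aut[OF \<beta>] lin_app[OF f] lin_app[OF p] f p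
  have "CT_comul H B (\<alpha>, \<beta>) (bowtie H p h) (\<lambda>X Y. CT_counit H X * ev x f Y)
      = sw h (\<lambda>h1 h2. sw3 x (\<lambda>x1 x2 x3. \<epsilon> x1 * (p x2 * (\<epsilon> x3 * (\<epsilon> h1 * f h2)))))"
    by (simp add: CT_comul_functional_ev[OF \<alpha> \<beta> p lin_map_CT_counit f] CT_counit_bowtie lin_shift p
        counit_mult Aut_counit[OF \<alpha>] Aut_counit[OF \<beta>] ac_simps)
  also have "\<dots> = sw h (\<lambda>h1 h2. p x * (\<epsilon> h1 * f h2))"
  proof (rule sw_cong)
    fix h1 h2
    have "sw3 x (\<lambda>x1 x2 x3. \<epsilon> x1 * (p x2 * \<epsilon> x3)) = p x"
      unfolding sw3_def by (simp add: sw_counit_left sw_counit_right p flip: sw_mult_left)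
    then show "sw3 x (\<lambda>x1 x2 x3. \<epsilon> x1 * (p x2 * (\<epsilon> x3 * (\<epsilon> h1 * f h2)))) = p x * (\<epsilon> h1 * f h2)"
      using sw3_mult_right[of x "\<lambda>x1 x2 x3. \<epsilon> x1 * (p x2 * \<epsilon> x3)" "\<epsilon> h1 * f h2"] by (simp add: mult.assoc)
  qed
  finally show "CT_comul H B (\<alpha>, \<beta>) (bowtie H p h) (\<lambda>X Y. CT_counit H X * ev x f Y) = ev x f (bowtie H p h)"
    by (simp add: ev_bowtie p f sw_counit_left flip: sw_mult_left)
qed

lemma CT_counit_right:
  assumes f: "lin f" and X: "X \<in> vcarrier V"
  shows "CT_comul H B (\<alpha>, \<beta>) X (\<lambda>X Y. ev x f X * CT_counit H Y) = ev x f X"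
proof (rule V_map_eqI[OF lin_map_CT_comul_form lin_map_ev _ X])
  fix p h assume p: "lin p"
  note l = lin_intros3 lin_end_Aut[OF \<alpha>] lin_end_Aut[OF \<beta>] lin_app[OF f] lin_app[OF p] f p
  \<comment> \<open>The counit is the evaluation at 1, whose three legs are all 1; the twist by
    \<alpha> and \<beta> then disappears.\<close>
  have "CT_comul H B (\<alpha>, \<beta>) (bowtie H p h) (\<lambda>X Y. ev x f X * CT_counit H Y)
      = CT_comul H B (\<alpha>, \<beta>) (bowtie H p h) (\<lambda>X Y. ev x f X * ev 1 \<epsilon> Y)"
    by (rule tensor_form_cong[OF vspace_V vspace_V lin_map_carrier[OF lin_map_CT_comul[OF \<alpha> \<beta>]
        bowtie_in_V[OF p]]])
      (simp add: CT_counit_ev)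
  also have "\<dots> = sw h (\<lambda>h1 h2. p x * f h1 * \<epsilon> h2)"
    by (simp add: CT_comul_ev_ev[OF \<alpha> \<beta> p f counit_in_D] sw3_one l counit_in_D Aut_one[OF \<alpha>] Aut_one[OF \<beta>])
  finally show "CT_comul H B (\<alpha>, \<beta>) (bowtie H p h) (\<lambda>X Y. ev x f X * CT_counit H Y) = ev x f (bowtie H p h)"
    by (simp add: ev_bowtie p f sw_counit_right l)
qed

end

lemma sw3_middle_counit:
  assumes "\<And>z. lin (\<lambda>x. t x z)" "\<And>x. lin (\<lambda>z. t x z)"
  shows "sw3 x (\<lambda>a m c. \<epsilon> m * t a c) = sw x t"
  unfolding sw3_def by (simp add: sw_counit_left assms)

section \<open>The multiplication is a coalgebra map\<close>

context
  fixes \<alpha> \<beta> \<gamma> \<delta> :: "'h \<Rightarrow> 'h" and p q f g :: "'h \<Rightarrow> 'k"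
  assumes \<alpha>: "\<alpha> \<in> Aut" and \<beta>: "\<beta> \<in> Aut" and \<gamma>: "\<gamma> \<in> Aut" and \<delta>: "\<delta> \<in> Aut"
    and p: "lin p" and q: "lin q" and f: "lin f" and g: "lin g"
begin

text \<open>The twist \<tau> = \<delta> \<alpha> \<delta>^-1 in the product satisfies \<tau>
  \<delta> = \<delta> \<alpha>, so the adjacent factors from the two coproducts are both images
  under \<delta> \<alpha>. They combine to the image of \<open>S'\<close>(d1) c3 and cancel, leaving
  the coproduct for the component of the product.\<close>

lemma CT_comul_CT_mult:
  shows "CT_comul H B (mult_fst \<alpha> \<gamma> \<delta>, \<delta> \<circ> \<beta>)
      (CT_mult H (\<alpha>, \<beta>) (\<gamma>, \<delta>) (tensor V V (bowtie H p h) (bowtie H q h'))) (\<lambda>X Y. ev x f X * ev y g Y)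
    = CT_comul H B (\<alpha>, \<beta>) (bowtie H p h) (\<lambda>X X'. CT_comul H B (\<gamma>, \<delta>) (bowtie H q h') (\<lambda>Y Y'.
        ev x f (CT_mult H (\<alpha>, \<beta>) (\<gamma>, \<delta>) (tensor V V X Y))
        * ev y g (CT_mult H (\<alpha>, \<beta>) (\<gamma>, \<delta>) (tensor V V X' Y'))))"
    (is "?L = CT_comul H B (\<alpha>, \<beta>) (bowtie H p h) ?T")
proof -
  let ?m = "\<lambda>X Y. CT_mult H (\<alpha>, \<beta>) (\<gamma>, \<delta>) (tensor V V X Y)"
  define \<tau> where "\<tau> = \<delta> \<circ> \<alpha> \<circ> \<delta>\<^sup>-\<^sup>1"
  have \<tau>: "\<tau> \<in> Aut" unfolding \<tau>_def by (rule Aut_tw[OF \<alpha> \<delta>])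
  have \<tau>\<delta>: "\<tau> (\<delta> c) = \<delta> (\<alpha> c)" for c by (simp add: \<tau>_def Aut_inv1[OF \<delta>])
  note A = \<alpha>[THEN lin_end_Aut] \<beta>[THEN lin_end_Aut] \<gamma>[THEN lin_end_Aut] \<delta>[THEN lin_end_Aut] \<tau>[THEN lin_end_Aut]
  note M = Aut_mult[OF \<alpha>] Aut_mult[OF \<beta>] Aut_mult[OF \<gamma>] Aut_mult[OF \<delta>] Aut_mult[OF \<tau>]
  note l = lin_intros3 A lin_app[OF f] lin_app[OF g] lin_app[OF p] lin_app[OF q] f g p q
  have m: "?m (bowtie H p' u) (bowtie H q' v) = bowtie H (conv H q' p') (\<delta> u * \<tau> v)"
    if "lin p'" "lin q'" for p' q' u v
    unfolding \<tau>_def by (rule CT_mult_bowtie[OF \<alpha> \<delta> that])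
  have evm: "ev x f (?m (bowtie H p' u) (bowtie H q' v)) = conv H q' p' x * f (\<delta> u * \<tau> v)"
    if "lin p'" "lin q'" "lin f" for p' q' u v x f
    by (simp add: m ev_bowtie lin_conv that)
  have mr: "lin_map V ground (\<lambda>Y. ev x f (?m X Y))" "lin_map V ground (\<lambda>Y. ev x f (?m Y X))"
    if X: "X \<in> vcarrier V" for X x f
    by (rule lin_map_comp[OF bilin_map_right[OF bilin_tensor_V X] lin_map_comp[OF lin_map_CT_mult[OF \<alpha>
        \<delta>] lin_map_ev]]
        lin_map_comp[OF bilin_map_left[OF bilin_tensor_V X] lin_map_comp[OF lin_map_CT_mult[OF \<alpha> \<delta>]
            lin_map_ev]])+
  have b1: "bilin_map V V ground (\<lambda>Y Y'. ev x f (?m X Y) * ev y g (?m X' Y'))"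
    if "X \<in> vcarrier V" "X' \<in> vcarrier V" for X X'
    by (rule bilin_map_mult[OF mr(1)[OF that(1)] mr(1)[OF that(2)]])
  have bT: "bilin_map V V ground ?T"
  proof (rule bilin_mapI)
    note s = lin_map_carrier[OF lin_map_CT_comul[OF \<gamma> \<delta>] bowtie_in_V[OF q]]
    fix X assume X: "X \<in> vcarrier V"
    show "lin_map V ground (\<lambda>X'. ?T X' X)"
      by (rule lin_map_form_param[OF b1 lin_map_mult_right[OF mr(2)] s vspace_V]) (use X in simp_all)
    show "lin_map V ground (?T X)"
      by (rule lin_map_form_param[OF b1 lin_map_mult_left[OF mr(2)] s vspace_V]) (use X in simp_all)
  qed
  have T: "?T (bowtie H p1 u) (bowtie H p2 v) = sw h' (\<lambda>k1 k2. sw y (\<lambda>y1 y2. sw3 y1 (\<lambda>c1 c2 c3.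
      conv H (\<lambda>x. q (x * c2)) p1 x * f (\<delta> u * \<tau> (\<delta> c3 * k1 * S' (\<gamma> c1)))) * (p2 y2 * g (\<delta> v * \<tau> k2))))"
    if p1: "lin p1" and p2: "lin p2" for p1 p2 u v
  proof -
    let ?r = "\<lambda>c k2. sw y (\<lambda>y1 y2. e c y1 * p2 y2) * g (\<delta> v * \<tau> k2)"
    let ?G = "\<lambda>k1 c1 c2 c3. conv H (\<lambda>x. q (x * c2)) p1 x * f (\<delta> u * \<tau> (\<delta> c3 * k1 * S' (\<gamma> c1)))"
    have "?T (bowtie H p1 u) (bowtie H p2 v) = sw h' (\<lambda>k1 k2. \<Sum>c\<in>B. sw3 c (\<lambda>c1 c2 c3.
        ?G k1 c1 c2 c3 * ?r c k2))"
      by (simp add: CT_comul_bowtie[OF \<gamma> \<delta> q b1[OF bowtie_in_V[OF p1] bowtie_in_V[OF p2]]]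
          evm p1 p2 f g lin_shift q lin_e conv_sw[OF lin_e p2])
    also have "\<dots> = sw h' (\<lambda>k1 k2. sw y (\<lambda>y1 y2. (\<Sum>c\<in>B. e c y1 * sw3 c (?G k1)) * (p2 y2 * g (\<delta> v * \<tau> k2))))"
    proof (rule sw_cong)
      fix k1 k2
      have "sw3 c (\<lambda>c1 c2 c3. ?G k1 c1 c2 c3 * ?r c k2)
          = sw y (\<lambda>y1 y2. e c y1 * sw3 c (?G k1) * (p2 y2 * g (\<delta> v * \<tau> k2)))" for c
      proof -
        have "sw3 c (\<lambda>c1 c2 c3. ?G k1 c1 c2 c3 * ?r c k2)
            = sw3 c (?G k1) * ?r c k2"
          by (rule sw3_mult_right[symmetric])
        then show ?thesis by (simp add: sw_mult_left sw_mult_right ac_simps)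
      qed
      then show "(\<Sum>c\<in>B. sw3 c (\<lambda>c1 c2 c3. ?G k1 c1 c2 c3 * ?r c k2))
          = sw y (\<lambda>y1 y2. (\<Sum>c\<in>B. e c y1 * sw3 c (?G k1)) * (p2 y2 * g (\<delta> v * \<tau> k2)))"
        by (simp add: sw_sum sum_distrib_right)
    qed
    finally show ?thesis by (simp only: lin_expand[OF lin_sw3[OF lin_end_id]])
  qed
  let ?G = "\<lambda>h1 k1 c1 c2 c3 d1 d2 d3. conv H (\<lambda>x. q (x * c2)) (\<lambda>x. p (x * d2)) x *
      f (\<delta> (\<beta> d3 * h1 * S' (\<alpha> d1)) * \<tau> (\<delta> c3 * k1 * S' (\<gamma> c1)))"
  \<comment> \<open>The legs of d are moved below the sums over h' and y, where \<open>e d\<close>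
    meets its argument y2 and the sum over d replaces d by y2.\<close>
  have collapse: "(\<Sum>d\<in>B. sw3 d (\<lambda>d1 d2 d3. sw h' (\<lambda>k1 k2. sw y (\<lambda>y1 y2.
      sw3 y1 (\<lambda>c1 c2 c3. G k1 c1 c2 c3 d1 d2 d3) * (e d y2 * g' k2)))))
    = sw h' (\<lambda>k1 k2. sw y (\<lambda>y1 y2. sw3 y1 (\<lambda>c1 c2 c3. sw3 y2 (\<lambda>d1 d2 d3. G k1 c1 c2 c3 d1 d2 d3 * g' k2))))"
    for G g'
  proof -
    have "(\<Sum>d\<in>B. sw3 d (\<lambda>d1 d2 d3. sw h' (\<lambda>k1 k2. sw y (\<lambda>y1 y2.
        sw3 y1 (\<lambda>c1 c2 c3. G k1 c1 c2 c3 d1 d2 d3) * (e d y2 * g' k2)))))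
      = sw h' (\<lambda>k1 k2. sw y (\<lambda>y1 y2. \<Sum>d\<in>B. e d y2 * sw3 d (\<lambda>d1 d2 d3.
        sw3 y1 (\<lambda>c1 c2 c3. G k1 c1 c2 c3 d1 d2 d3 * g' k2))))"
      by (simp add: sw_sw3[symmetric] sw_sum sw3_mult_left sw3_mult_right ac_simps)
    also have "\<dots> = sw h' (\<lambda>k1 k2. sw y (\<lambda>y1 y2. sw3 y1 (\<lambda>c1 c2 c3. sw3 y2 (\<lambda>d1 d2 d3. G k1 c1 c2 c3 d1
        d2 d3 * g' k2))))"
      unfolding lin_expand[OF lin_sw3[OF lin_end_id]] by (intro sw_cong sw3_sw3)
    finally show ?thesis .
  qed
  have "CT_comul H B (\<alpha>, \<beta>) (bowtie H p h) ?T = sw h (\<lambda>h1 h2. \<Sum>d\<in>B. sw3 d (\<lambda>d1 d2 d3.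
      sw h' (\<lambda>k1 k2. sw y (\<lambda>y1 y2. sw3 y1 (\<lambda>c1 c2 c3. ?G h1 k1 c1 c2 c3 d1 d2 d3) * (e d y2 * g (\<delta> h2 *
          \<tau> k2))))))"
    unfolding CT_comul_bowtie[OF \<alpha> \<beta> p bT] T[OF lin_shift[OF p] lin_e] ..
  also have "\<dots> = sw h (\<lambda>h1 h2. sw h' (\<lambda>k1 k2. sw y (\<lambda>y1 y2. sw3 y1 (\<lambda>c1 c2 c3. sw3 y2 (\<lambda>d1 d2 d3.
      ?G h1 k1 c1 c2 c3 d1 d2 d3 * g (\<delta> h2 * \<tau> k2))))))"
    by (simp only: collapse)
  also have "\<dots> = sw h (\<lambda>h1 h2. sw h' (\<lambda>k1 k2. sw3 y (\<lambda>y1 y2 y3. conv H q p (x * y2)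
      * f (\<delta> (\<beta> y3) * (\<delta> h1 * \<tau> k1) * S' (\<tau> (\<gamma> y1))) * g (\<delta> h2 * \<tau> k2))))"
  proof (intro sw_cong)
    fix h1 h2 k1 k2
    let ?c = "\<lambda>c2 d2. conv H (\<lambda>x. q (x * c2)) (\<lambda>x. p (x * d2)) x"
    let ?f = "\<lambda>d3 w c1. f (\<delta> (\<beta> d3) * (\<delta> h1 * (\<delta> (\<alpha> w) * (\<tau> k1 * S' (\<tau> (\<gamma> c1))))))"
    have c: "?c c2 d2 = sw x (\<lambda>x1 x2. q (x1 * c2) * p (x2 * d2))" for c2 d2
      by (rule conv_sw[OF lin_shift[OF q] lin_shift[OF p]])
    have G: "?G h1 k1 c1 c2 c3 d1 d2 d3 = ?c c2 d2 * ?f d3 (S' d1 * c3) c1" for c1 c2 c3 d1 d2 d3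
      by (simp add: M \<tau>\<delta> Aut_S'[OF \<alpha>] Aut_S'[OF \<delta>] Aut_S'[OF \<tau>] mult.assoc)
    have 1: "sw m (\<lambda>c3 d1. ?c c2 d2 * ?f d3 (S' d1 * c3) c1 * G) = \<epsilon> m * (?c c2 d2 * ?f d3 1 c1 * G)"
        for m c1 c2 d2 d3 G
      by (rule sw_S'_left[of "\<lambda>w. ?c c2 d2 * ?f d3 w c1 * G"]) (intro l)
    have 2: "sw v (\<lambda>m d2. \<epsilon> m * (?c c2 d2 * ?f d3 1 c1 * G)) = ?c c2 v * ?f d3 1 c1 * G" for v c1 c2 d3 G
      by (rule sw_counit_left) (unfold c, intro l)
    \<comment> \<open>The shifted functionals recombine because the coproduct of H is
      multiplicative: q(x1 u1) p(x2 u2) = (q p)(x u).\<close>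
    have 3: "sw u ?c = conv H q p (x * u)" for u
    proof -
      have "sw u ?c = sw x (\<lambda>x1 x2. sw u (\<lambda>c2 d2. q (x1 * c2) * p (x2 * d2)))"
        unfolding c by (rule sw_swap)
      also have "\<dots> = conv H q p (x * u)"
        unfolding conv_sw[OF q p] by (rule sw_mult[symmetric]) (intro l)+
      finally show ?thesis .
    qed
    have "sw y (\<lambda>y1 y2. sw3 y1 (\<lambda>c1 c2 c3. sw3 y2 (\<lambda>d1 d2 d3. ?G h1 k1 c1 c2 c3 d1 d2 d3 * g (\<delta> h2 * \<tau> k2))))
      = sw3 y (\<lambda>c1 u d3. sw u (\<lambda>c2 v. sw v (\<lambda>m d2. sw m (\<lambda>c3 d1. ?G h1 k1 c1 c2 c3 d1 d2 d3 * g (\<delta> h2 *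
          \<tau> k2)))))"
      by (rule sw_regroup_inner; unfold c; intro l)
    also have "\<dots> = sw3 y (\<lambda>c1 u d3. conv H q p (x * u) * ?f d3 1 c1 * g (\<delta> h2 * \<tau> k2))"
      by (simp only: G 1 2 3 flip: sw_mult_right)
    finally show "sw y (\<lambda>y1 y2. sw3 y1 (\<lambda>c1 c2 c3. sw3 y2 (\<lambda>d1 d2 d3. ?G h1 k1 c1 c2 c3 d1 d2 d3 * g (\<delta>
        h2 * \<tau> k2))))
      = sw3 y (\<lambda>y1 y2 y3. conv H q p (x * y2)
      * f (\<delta> (\<beta> y3) * (\<delta> h1 * \<tau> k1) * S' (\<tau> (\<gamma> y1))) * g (\<delta> h2 * \<tau> k2))"
      by (simp add: Aut_one[OF \<alpha>] Aut_one[OF \<delta>] mult.assoc)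
  qed
  also have "\<dots> = ?L"
  proof -
    have "?L = sw (\<delta> h * \<tau> h') (\<lambda>h1 h2. sw3 y (\<lambda>y1 y2 y3. conv H q p (x * y2)
        * f (\<delta> (\<beta> y3) * h1 * S' (\<tau> (\<gamma> y1))) * g h2))"
      unfolding m[OF p q] \<tau>_def[symmetric]
        CT_comul_ev_ev[OF Aut_comp[OF \<tau> \<gamma>] Aut_comp[OF \<delta> \<beta>] lin_conv[OF q p] f g] o_apply ..
    then show ?thesis
      by (simp add: sw_mult sw_Aut[OF \<delta>] sw_Aut[OF \<tau>] l)
  qed
  finally show ?thesis ..
qed

end

text \<open>The functional is the counit, which removes the middle leg of y; the outer legs then
  meet as y3 \<open>S'\<close>(y1) and cancel.\<close>

lemma CT_comul_CT_unit:
  assumes f: "lin f" and g: "lin g"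
  shows "CT_comul H B (id, id) (CT_unit H c) (\<lambda>X Y. ev x f X * ev y g Y) = ev x f (CT_unit H c) * ev y g
      (CT_unit H 1)"
proof -
  note l = lin_intros3 lin_app[OF f] lin_app[OF g] f g counit_in_D
  have "CT_comul H B (id, id) (bowtie H \<epsilon> 1) (\<lambda>X Y. ev x f X * ev y g Y)
      = sw3 y (\<lambda>y1 y2 y3. \<epsilon> y2 * (\<epsilon> x * f (y3 * S' y1) * g 1))"
    by (simp add: CT_comul_ev_ev[OF Aut_id Aut_id counit_in_D f g] sw_one l counit_mult ac_simps)
  also have "\<dots> = \<epsilon> x * f 1 * (\<epsilon> y * g 1)"
    using sw_S'_right[of "\<lambda>w. \<epsilon> x * f w * g 1" y] by (simp add: sw3_middle_counit l)
  finally show ?thesis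
    using lin_map_scale[OF lin_map_CT_comul_form[OF Aut_id Aut_id] bowtie_in_V[OF counit_in_D]]
    by (simp add: ev_CT_unit f g) (simp add: CT_unit_def)
qed

section \<open>The antipode laws\<close>

context
  fixes \<alpha> \<beta> :: "'h \<Rightarrow> 'h" and p f :: "'h \<Rightarrow> 'k"
  assumes \<alpha>: "\<alpha> \<in> Aut" and \<beta>: "\<beta> \<in> Aut" and p: "lin p" and f: "lin f"
begin

text \<open>The legs of x cancel from the inside: y3 with \<open>S'\<close>(w3) between the two
  parts of h, then x2 with \<open>S'\<close>(w2) inside p, which leaves p(1). Only then are h1 and
  S(h2) neighbours; their cancellation brings \<open>S'\<close>(w1) next to y1.\<close>

lemma CT_antipode_right:
  "CT_comul H B (\<alpha>, \<beta>) (bowtie H p h) (\<lambda>X Y. ev x f (CT_mult H (\<alpha>, \<beta>) (inv_fst \<alpha> \<beta>, \<beta>\<^sup>-\<^sup>1)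
      (tensor V V X (CT_antipode H B (\<alpha>, \<beta>) Y)))) = \<epsilon> x * f 1 * (p 1 * \<epsilon> h)"
  (is "CT_comul H B (\<alpha>, \<beta>) (bowtie H p h) ?T = _")
proof -
  let ?ia = "\<alpha>\<^sup>-\<^sup>1" and ?ib = "\<beta>\<^sup>-\<^sup>1"
  note ia = Aut_inv[OF \<alpha>] and ib = Aut_inv[OF \<beta>]
  note A = \<alpha>[THEN lin_end_Aut] \<beta>[THEN lin_end_Aut] ia[THEN lin_end_Aut] ib[THEN lin_end_Aut]
  note M = Aut_mult[OF \<alpha>] Aut_mult[OF \<beta>] Aut_mult[OF ia] Aut_mult[OF ib] Aut_inv1[OF \<alpha>] Aut_inv2[OF \<alpha>]
    Aut_inv1[OF \<beta>] Aut_inv2[OF \<beta>] Aut_S'[OF \<alpha>] Aut_S'[OF \<beta>] Aut_S'[OF ib] Aut_S[OF ib] inv_inv_eq[OF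
        Aut_bij[OF \<beta>]]
    Aut_one[OF \<alpha>] Aut_one[OF ib]
  note l = lin_intros3 A lin_app[OF f] lin_app[OF p] f p
  have bT: "bilin_map V V ground ?T"
    by (rule bilin_map_postcomp[OF bilin_map_comp[OF bilin_tensor_V lin_map_id lin_map_CT_antipode[OF \<alpha> \<beta>]]
          lin_map_comp[OF lin_map_CT_mult[OF \<alpha> ib] lin_map_ev]])
  have T: "?T (bowtie H p1 u) (bowtie H q k) = sw x (\<lambda>x1 x2. p1 x2 * sw3 x1 (\<lambda>y1 y2 y3.
      q (S' y2) * f (?ib u * (?ib (\<alpha> (S' y3)) * (?ib (S k) * y1)))))" if "lin p1" "lin q" for p1 q u k
  proof -
    have f': "lin (\<lambda>w. f (?ib u * (?ib \<circ> \<alpha> \<circ> (?ib)\<^sup>-\<^sup>1) w))" unfolding o_apply M by (intro l)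
    have q: "bowtie H q k \<in> vcarrier V" by (rule bowtie_in_V[OF that(2)])
    show ?thesis
      unfolding ev_CT_mult_left[OF \<alpha> ib that(1) f lin_map_carrier[OF lin_map_CT_antipode[OF \<alpha> \<beta>] q]]
        ev_CT_antipode[OF \<alpha> \<beta> that(2) f'] by (simp add: M mult.assoc)
  qed
  \<comment> \<open>The antipode evaluates \<open>e c\<close> at \<open>S'\<close> y2, so the legs
    of c become those of \<open>S'\<close> y2.\<close>
  have collapse: "(\<Sum>c\<in>B. sw3 c (\<lambda>c1 c2 c3. sw x (\<lambda>x1 x2. P c2 x2 * sw3 x1 (\<lambda>y1 y2 y3. e c (S' y2) * G y1
      y3 c1 c3))))
    = sw x (\<lambda>x1 x2. sw3 x1 (\<lambda>y1 y2 y3. sw3 (S' y2) (\<lambda>c1 c2 c3. P c2 x2 * G y1 y3 c1 c3)))" for P G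
  proof -
    have "(\<Sum>c\<in>B. sw3 c (\<lambda>c1 c2 c3. sw x (\<lambda>x1 x2. P c2 x2 * sw3 x1 (\<lambda>y1 y2 y3. e c (S' y2) * G y1 y3 c1 c3))))
      = (\<Sum>c\<in>B. sw x (\<lambda>x1 x2. sw3 x1 (\<lambda>y1 y2 y3. sw3 c (\<lambda>c1 c2 c3. e c (S' y2) * (P c2 x2 * G y1 y3 c1 c3)))))"
    proof (rule sum.cong[OF refl])
      fix c
      have "sw3 c (\<lambda>c1 c2 c3. sw x (\<lambda>x1 x2. P c2 x2 * sw3 x1 (\<lambda>y1 y2 y3. e c (S' y2) * G y1 y3 c1 c3)))
        = sw x (\<lambda>x1 x2. sw3 c (\<lambda>c1 c2 c3. sw3 x1 (\<lambda>y1 y2 y3. e c (S' y2) * (P c2 x2 * G y1 y3 c1 c3))))"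
        by (simp add: sw_sw3[symmetric] sw3_mult_left ac_simps)
      also have "\<dots> = sw x (\<lambda>x1 x2. sw3 x1 (\<lambda>y1 y2 y3. sw3 c (\<lambda>c1 c2 c3. e c (S' y2) * (P c2 x2 * G y1 y3
          c1 c3))))"
        by (intro sw_cong sw3_sw3)
      finally show "sw3 c (\<lambda>c1 c2 c3. sw x (\<lambda>x1 x2. P c2 x2 * sw3 x1 (\<lambda>y1 y2 y3. e c (S' y2) * G y1 y3 c1 c3)))
        = sw x (\<lambda>x1 x2. sw3 x1 (\<lambda>y1 y2 y3. sw3 c (\<lambda>c1 c2 c3. e c (S' y2) * (P c2 x2 * G y1 y3 c1 c3))))" .
    qed
    also have "\<dots> = sw x (\<lambda>x1 x2. sw3 x1 (\<lambda>y1 y2 y3. \<Sum>c\<in>B. e c (S' y2) * sw3 c (\<lambda>c1 c2 c3. P c2 x2 * G y1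
        y3 c1 c3)))"
      by (simp only: sw_sum sw3_sum sw3_mult_left)
    finally show ?thesis by (simp only: lin_expand[OF lin_sw3[OF lin_end_id]])
  qed
  let ?F = "\<lambda>b h1 w h2 a. f (S' b * (?ib h1 * (?ib (\<alpha> (S' w)) * (?ib (S h2) * a))))"
  have "CT_comul H B (\<alpha>, \<beta>) (bowtie H p h) ?T = sw h (\<lambda>h1 h2. sw x (\<lambda>x1 x2. sw3 x1 (\<lambda>y1 y2 y3. sw3 (S'
      y2) (\<lambda>c1 c2 c3.
      p (x2 * c2) * f (?ib (\<beta> c3 * h1 * S' (\<alpha> c1)) * (?ib (\<alpha> (S' y3)) * (?ib (S h2) * y1)))))))"
    unfolding CT_comul_bowtie[OF \<alpha> \<beta> p bT] T[OF lin_shift[OF p] lin_e] collapse ..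
  also have "\<dots> = sw h (\<lambda>h1 h2. sw x (\<lambda>x1 x2. sw3 x1 (\<lambda>y1 y2 y3. sw3 y2 (\<lambda>w1 w2 w3.
      p (x2 * S' w2) * ?F w1 h1 (y3 * S' w3) h2 y1))))"
  proof (intro sw_cong sw3_cong)
    fix h1 h2 x2 y1 y2 y3
    \<comment> \<open>Reversing the legs puts \<open>S'\<close> w3 in place of c1. The iterated
      inverse antipode merges with its neighbour: \<open>S'\<close>(\<open>S'\<close>(w3))
      \<open>S'\<close>(y3) = \<open>S'\<close>(y3 \<open>S'\<close>(w3)), which cancels by a law
      for a single \<open>S'\<close>.\<close>
    show "sw3 (S' y2) (\<lambda>c1 c2 c3. p (x2 * c2) * f (?ib (\<beta> c3 * h1 * S' (\<alpha> c1)) * (?ib (\<alpha> (S' y3)) * (?ib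
        (S h2) * y1))))
      = sw3 y2 (\<lambda>w1 w2 w3. p (x2 * S' w2) * ?F w1 h1 (y3 * S' w3) h2 y1)"
      by (subst sw3_S') (intro l | simp add: M S'_mult mult.assoc)+
  qed
  also have "\<dots> = sw h (\<lambda>h1 h2. sw x (\<lambda>u v. sw u (\<lambda>a b. sw v (\<lambda>c w. sw w (\<lambda>m y. sw m (\<lambda>d z.
      p (y * S' c) * ?F b h1 (z * S' d) h2 a))))))"
    by (rule sw_cong, rule sw_regroup_outer) (intro l)+
  also have "\<dots> = sw h (\<lambda>h1 h2. sw x (\<lambda>u v. sw u (\<lambda>a b. \<epsilon> v * p 1 * ?F b h1 1 h2 a)))"
  proof (intro sw_cong)
    fix h1 h2 v a b
    have 1: "sw m (\<lambda>d z. p (y * S' c) * ?F b h1 (z * S' d) h2 a) = \<epsilon> m * (p (y * S' c) * ?F b h1 1 h2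
        a)" for m y c
      by (rule sw_S'_right) (intro l)
    have 2: "sw w (\<lambda>m y. \<epsilon> m * (p (y * S' c) * ?F b h1 1 h2 a)) = p (w * S' c) * ?F b h1 1 h2 a" for w c
      by (rule sw_counit_left) (intro l)
    have 3: "sw v (\<lambda>c w. p (w * S' c)) = \<epsilon> v * p 1"
      by (rule sw_S'_right[OF p])
    show "sw v (\<lambda>c w. sw w (\<lambda>m y. sw m (\<lambda>d z. p (y * S' c) * ?F b h1 (z * S' d) h2 a))) = \<epsilon> v * p 1 * ?F
        b h1 1 h2 a"
      by (simp only: 1 2 3 flip: sw_mult_right)
  qed
  also have "\<dots> = sw x (\<lambda>u v. sw u (\<lambda>a b. \<epsilon> v * p 1 * sw h (\<lambda>h1 h2. ?F b h1 1 h2 a)))"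
    unfolding sw_mult_left by (subst sw_swap) (intro sw_cong sw_swap)
  also have "\<dots> = sw x (\<lambda>u v. sw u (\<lambda>a b. \<epsilon> v * p 1 * (\<epsilon> h * f (S' b * a))))"
  proof -
    have "sw h (\<lambda>h1 h2. ?F b h1 1 h2 a) = \<epsilon> h * f (S' b * a)" for a b
      using sw_antipode_right[of "\<lambda>w. f (S' b * (?ib w * a))" h] by (simp add: l M mult.assoc)
    then show ?thesis by (simp only:)
  qed
  also have "\<dots> = \<epsilon> x * f 1 * (p 1 * \<epsilon> h)"
  proof -
    have "sw u (\<lambda>a b. \<epsilon> v * p 1 * (\<epsilon> h * f (S' b * a))) = (\<epsilon> u * \<epsilon> v) * (p 1 * \<epsilon> h * f 1)" for u v
      using sw_S'_left[OF f, of u] by (simp add: ac_simps flip: sw_mult_left)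
    then have "sw x (\<lambda>u v. sw u (\<lambda>a b. \<epsilon> v * p 1 * (\<epsilon> h * f (S' b * a)))) = sw x (\<lambda>u v. \<epsilon> u * \<epsilon> v) * (p
        1 * \<epsilon> h * f 1)"
      by (simp only: sw_mult_right)
    then show ?thesis by (simp add: sw_counit_left[OF counit_in_D] ac_simps)
  qed
  finally show ?thesis .
qed

text \<open>S turns the twisted product \<beta>(c3) h1 \<open>S'\<close>(\<alpha>(c1)) into
  \<alpha>(c1) S(h1) S(\<beta>(c3)). Hence S(c3) meets y1, then the legs inside p cancel, then S(h1)
  meets h2, and finally \<open>S'\<close>(y3) meets c1.\<close>

lemma CT_antipode_left:
  "CT_comul H B (\<alpha>, \<beta>) (bowtie H p h) (\<lambda>X Y. ev x f (CT_mult H (inv_fst \<alpha> \<beta>, \<beta>\<^sup>-\<^sup>1) (\<alpha>, \<beta>)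
      (tensor V V (CT_antipode H B (\<alpha>, \<beta>) X) Y))) = \<epsilon> x * f 1 * (p 1 * \<epsilon> h)"
  (is "CT_comul H B (\<alpha>, \<beta>) (bowtie H p h) ?T = _")
proof -
  let ?ia = "\<alpha>\<^sup>-\<^sup>1" and ?ib = "\<beta>\<^sup>-\<^sup>1"
  note ia = Aut_inv[OF \<alpha>] and ib = Aut_inv[OF \<beta>]
  note A = \<alpha>[THEN lin_end_Aut] \<beta>[THEN lin_end_Aut] ia[THEN lin_end_Aut] ib[THEN lin_end_Aut]
  have iab: "?ib \<circ> ?ia \<circ> \<beta> \<in> Aut" by (intro Aut_comp ia ib \<beta>)
  note M = Aut_mult[OF \<alpha>] Aut_mult[OF \<beta>] Aut_mult[OF ia] Aut_mult[OF ib] Aut_inv1[OF \<alpha>] Aut_inv2[OF \<alpha>]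
    Aut_inv1[OF \<beta>] Aut_inv2[OF \<beta>] Aut_S[OF ia] Aut_S[OF \<beta>] Aut_S[OF \<alpha>] Aut_one[OF ia] Aut_one[OF \<beta>]
        antipode_mult
  note l = lin_intros3 A lin_app[OF f] lin_app[OF p] f p
  have bT: "bilin_map V V ground ?T"
    by (rule bilin_map_postcomp[OF bilin_map_comp[OF bilin_tensor_V lin_map_CT_antipode[OF \<alpha> \<beta>] lin_map_id]
          lin_map_comp[OF lin_map_CT_mult[OF iab \<beta>] lin_map_ev]])
  have T: "?T (bowtie H p1 u) (bowtie H q k) = sw x (\<lambda>x1 x2. q x1 * sw3 x2 (\<lambda>y1 y2 y3.
      p1 (S' y2) * f (S' y3 * (?ia (S u) * (?ia (\<beta> y1) * ?ia k)))))" if "lin p1" "lin q" for p1 q u k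
  proof -
    have f': "lin (\<lambda>w. f (\<beta> w * (\<beta> \<circ> (?ib \<circ> ?ia \<circ> \<beta>) \<circ> ?ib) k))" unfolding o_apply M by (intro l)
    have p1: "bowtie H p1 u \<in> vcarrier V" by (rule bowtie_in_V[OF that(1)])
    show ?thesis
      unfolding ev_CT_mult_right[OF iab \<beta> that(2) f lin_map_carrier[OF lin_map_CT_antipode[OF \<alpha> \<beta>] p1]]
        ev_CT_antipode[OF \<alpha> \<beta> that(1) f'] by (simp add: M mult.assoc del: antipode_mult)
  qed
  have collapse: "(\<Sum>c\<in>B. sw3 c (\<lambda>c1 c2 c3. sw x (\<lambda>x1 x2. e c x1 * G x2 c1 c2 c3)))
    = sw x (\<lambda>x1 x2. sw3 x1 (G x2))" for G
  proof -
    have "(\<Sum>c\<in>B. sw3 c (\<lambda>c1 c2 c3. sw x (\<lambda>x1 x2. e c x1 * G x2 c1 c2 c3)))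
      = sw x (\<lambda>x1 x2. \<Sum>c\<in>B. e c x1 * sw3 c (G x2))"
      by (simp add: sw_sw3[symmetric] sw_sum sw3_mult_left)
    then show ?thesis by (simp only: lin_expand[OF lin_sw3[OF lin_end_id]])
  qed
  let ?F = "\<lambda>y3 c1 h1 w h2. f (S' y3 * (c1 * (?ia (S h1) * (?ia (\<beta> w) * ?ia h2))))"
  have "CT_comul H B (\<alpha>, \<beta>) (bowtie H p h) ?T = sw h (\<lambda>h1 h2. sw x (\<lambda>x1 x2. sw3 x1 (\<lambda>c1 c2 c3. sw3 x2
      (\<lambda>y1 y2 y3.
      p (S' y2 * c2) * f (S' y3 * (?ia (S (\<beta> c3 * h1 * S' (\<alpha> c1))) * (?ia (\<beta> y1) * ?ia h2)))))))"
    unfolding CT_comul_bowtie[OF \<alpha> \<beta> p bT] T[OF lin_shift[OF p] lin_e] collapse ..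
  also have "\<dots> = sw h (\<lambda>h1 h2. sw x (\<lambda>x1 x2. sw3 x1 (\<lambda>c1 c2 c3. sw3 x2 (\<lambda>y1 y2 y3.
      p (S' y2 * c2) * ?F y3 c1 h1 (S c3 * y1) h2))))"
    by (simp add: M mult.assoc)
  also have "\<dots> = sw h (\<lambda>h1 h2. sw3 x (\<lambda>c1 u y3. sw u (\<lambda>c2 v. sw v (\<lambda>m y2. sw m (\<lambda>c3 y1.
      p (S' y2 * c2) * ?F y3 c1 h1 (S c3 * y1) h2)))))"
    by (rule sw_cong, rule sw_regroup_inner) (intro l)+
  also have "\<dots> = sw h (\<lambda>h1 h2. sw x (\<lambda>c1 y3. p 1 * ?F y3 c1 h1 1 h2))"
  proof (rule sw_cong)
    fix h1 h2
    have 1: "sw m (\<lambda>c3 y1. p (S' y2 * c2) * ?F y3 c1 h1 (S c3 * y1) h2) = \<epsilon> m * (p (S' y2 * c2) * ?F y3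
        c1 h1 1 h2)"
      for m y2 c2 y3 c1 by (rule sw_antipode_left) (intro l)
    have 2: "sw v (\<lambda>m y2. \<epsilon> m * (p (S' y2 * c2) * ?F y3 c1 h1 1 h2)) = p (S' v * c2) * ?F y3 c1 h1 1 h2"
        for v c2 y3 c1
      by (rule sw_counit_left) (intro l)
    have 3: "sw u (\<lambda>c2 v. p (S' v * c2)) = \<epsilon> u * p 1" for u
      by (rule sw_S'_left[OF p])
    show "sw3 x (\<lambda>c1 u y3. sw u (\<lambda>c2 v. sw v (\<lambda>m y2. sw m (\<lambda>c3 y1. p (S' y2 * c2) * ?F y3 c1 h1 (S c3 *
        y1) h2))))
      = sw x (\<lambda>c1 y3. p 1 * ?F y3 c1 h1 1 h2)"
      unfolding 1 2 3 sw_mult_right[symmetric] mult.assoc[of "\<epsilon> _"]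
      by (rule sw3_middle_counit) (intro l)+
  qed
  also have "\<dots> = sw x (\<lambda>c1 y3. p 1 * sw h (\<lambda>h1 h2. ?F y3 c1 h1 1 h2))"
    unfolding sw_mult_left by (rule sw_swap)
  also have "\<dots> = sw x (\<lambda>c1 y3. p 1 * (\<epsilon> h * f (S' y3 * c1)))"
  proof -
    have "sw h (\<lambda>h1 h2. ?F y3 c1 h1 1 h2) = \<epsilon> h * f (S' y3 * c1)" for y3 c1
      using sw_antipode_left[of "\<lambda>w. f (S' y3 * (c1 * ?ia w))" h] by (simp add: l M mult.assoc)
    then show ?thesis by (simp only:)
  qed
  also have "\<dots> = \<epsilon> x * f 1 * (p 1 * \<epsilon> h)"
    using sw_S'_left[OF f, of x] by (simp add: ac_simps flip: sw_mult_left)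
  finally show ?thesis .
qed

end

text \<open>The crossing is F \<mapsto> \<theta> \<circ> F \<circ> \<phi> for the automorphisms
  defined in the proof. It carries the twists \<gamma> and \<delta> to \<theta> \<gamma> \<phi> and
  \<theta> \<delta> \<phi>, which are exactly the components of the conjugated pair.\<close>

lemma CT_comul_CT_crossing:
  assumes \<alpha>: "\<alpha> \<in> Aut" and \<beta>: "\<beta> \<in> Aut" and \<gamma>: "\<gamma> \<in> Aut" and \<delta>: "\<delta> \<in> Aut"
    and \<gamma>': "\<gamma>' \<in> Aut" "\<And>w. \<gamma>' w = \<beta>\<^sup>-\<^sup>1 (\<delta> (\<alpha> (\<delta>\<^sup>-\<^sup>1 (\<gamma> (\<alpha>\<^sup>-\<^sup>1 (\<beta> w))))))"
    and \<delta>': "\<delta>' \<in> Aut" "\<And>w. \<delta>' w = \<beta>\<^sup>-\<^sup>1 (\<delta> (\<beta> w))"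
    and p: "lin p" and f: "lin f" and g: "lin g"
  shows "CT_comul H B (\<gamma>', \<delta>') (CT_crossing H (\<alpha>, \<beta>) (\<gamma>, \<delta>) (bowtie H p h)) (\<lambda>X Y. ev x f X * ev y g Y)
    = CT_comul H B (\<gamma>, \<delta>) (bowtie H p h)
      (\<lambda>X Y. ev x f (CT_crossing H (\<alpha>, \<beta>) (\<gamma>, \<delta>) X) * ev y g (CT_crossing H (\<alpha>, \<beta>) (\<gamma>, \<delta>) Y))"
    (is "?L = ?R")
proof -
  define \<phi> where "\<phi> = \<alpha>\<^sup>-\<^sup>1 \<circ> \<beta>"
  define \<theta> where "\<theta> = \<beta>\<^sup>-\<^sup>1 \<circ> \<delta> \<circ> \<alpha> \<circ> \<delta>\<^sup>-\<^sup>1"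
  have \<phi>: "\<phi> \<in> Aut" and \<theta>: "\<theta> \<in> Aut"
    unfolding \<phi>_def \<theta>_def by (intro Aut_comp Aut_inv \<alpha> \<beta> \<delta>)+
  note A = \<phi>[THEN lin_end_Aut] \<theta>[THEN lin_end_Aut] \<gamma>[THEN lin_end_Aut] \<delta>[THEN lin_end_Aut]
    \<gamma>'(1)[THEN lin_end_Aut] \<delta>'(1)[THEN lin_end_Aut]
  note l = lin_intros3 A lin_app[OF f] lin_app[OF g] lin_app[OF p] f g p
  have \<theta>\<delta>: "\<theta> (\<delta> (\<phi> w)) = \<delta>' w" "\<theta> (\<gamma> (\<phi> w)) = \<gamma>' w" for w
    by (simp_all add: \<theta>_def \<phi>_def \<gamma>'(2) \<delta>'(2) Aut_inv1[OF \<delta>] Aut_inv2[OF \<alpha>])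
  have p': "lin (p \<circ> \<phi>)" "lin (\<lambda>w. f (\<theta> w))" "lin (\<lambda>w. g (\<theta> w))" unfolding o_def by (intro l)+
  have ev\<theta>: "ev x f (CT_crossing H (\<alpha>, \<beta>) (\<gamma>, \<delta>) X) = ev (\<phi> x) (\<lambda>w. f (\<theta> w)) X"
    if "X \<in> vcarrier V" "lin f" for x f X
    using ev_CT_crossing[OF \<alpha> \<beta> \<delta> that(2,1)] by (simp add: \<phi>_def \<theta>_def)
  have "?R = CT_comul H B (\<gamma>, \<delta>) (bowtie H p h) (\<lambda>X Y. ev (\<phi> x) (\<lambda>w. f (\<theta> w)) X * ev (\<phi> y) (\<lambda>w. g (\<theta> w)) Y)"
    by (rule tensor_form_cong[OF vspace_V vspace_V lin_map_carrier[OF lin_map_CT_comul[OF \<gamma> \<delta>]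
        bowtie_in_V[OF p]]])
      (simp add: ev\<theta> f g)
  also have "\<dots> = sw h (\<lambda>h1 h2. sw3 (\<phi> y) (\<lambda>y1 y2 y3. p (\<phi> x * y2) * f (\<theta> (\<delta> y3 * h1 * S' (\<gamma> y1))) * g (\<theta> h2)))"
    by (rule CT_comul_ev_ev[OF \<gamma> \<delta> p p'(2,3)])
  also have "\<dots> = sw h (\<lambda>h1 h2. sw3 y (\<lambda>y1 y2 y3. p (\<phi> (x * y2)) * f (\<delta>' y3 * \<theta> h1 * S' (\<gamma>' y1)) * g (\<theta> h2)))"
    by (simp add: sw3_Aut[OF _ _ _ \<phi>] l Aut_mult[OF \<phi>] Aut_mult[OF \<theta>] Aut_S'[OF \<theta>] \<theta>\<delta>)
  also have "\<dots> = ?L"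
    unfolding CT_crossing_bowtie[OF \<alpha> \<beta> \<delta> p] \<phi>_def[symmetric] \<theta>_def[symmetric]
      CT_comul_ev_ev[OF \<gamma>'(1) \<delta>'(1) p'(1) f g]
    by (simp add: sw_Aut[OF \<theta>] l)
  finally show ?thesis ..
qed

lemma conv_assoc: "lin p \<Longrightarrow> lin q \<Longrightarrow> lin r \<Longrightarrow> conv H (conv H p q) r = conv H p (conv H q r)"
  by (rule ext) (simp add: conv3_sw conv_sw[of p] conv_sw[of q] lin_conv sw_mult_left sw3_def mult.assoc)

lemma conv_counit: "lin p \<Longrightarrow> conv H \<epsilon> p = p" "lin p \<Longrightarrow> conv H p \<epsilon> = p"
  by (rule ext, simp add: conv_sw counit_in_D sw_counit_left sw_counit_right)+

lemma conv_Aut: "\<alpha> \<in> Aut \<Longrightarrow> lin p \<Longrightarrow> lin q \<Longrightarrow> conv H (p \<circ> \<alpha>) (q \<circ> \<alpha>) = conv H p q \<circ> \<alpha>"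
proof (rule ext)
  fix x assume \<alpha>: "\<alpha> \<in> Aut" and p: "lin p" and q: "lin q"
  note l = lin_app[OF p] lin_app[OF q] lin_end_Aut[OF \<alpha>] lin_intros p q
  have "lin (p \<circ> \<alpha>)" "lin (q \<circ> \<alpha>)" unfolding o_def by (intro l)+
  then show "conv H (p \<circ> \<alpha>) (q \<circ> \<alpha>) x = (conv H p q \<circ> \<alpha>) x"
    by (simp add: conv_sw p q sw_Aut[OF \<alpha>] l)
qed

lemma lin_comp_Aut: "\<alpha> \<in> Aut \<Longrightarrow> lin p \<Longrightarrow> lin (p \<circ> \<alpha>)"
  unfolding o_def by (rule lin_app, assumption, rule lin_end_Aut[OF _ lin_end_id])

lemma conjugate_aut_pairs:
  assumes "\<alpha> \<in> Aut" "\<beta> \<in> Aut"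
  shows "(\<alpha>, \<beta>) \<otimes>\<^bsub>aut_pairs H\<^esub> (\<gamma>, \<delta>) \<otimes>\<^bsub>aut_pairs H\<^esub> inv\<^bsub>aut_pairs H\<^esub> (\<alpha>, \<beta>)
    = (conj_fst \<alpha> \<beta> \<gamma> \<delta>, conj_snd \<beta> \<delta>)"
  by (simp add: inv_aut_pairs assms fun_eq_iff inv_inv_eq[OF Aut_bij] Aut_inv2)

section \<open>Assembling the Turaev algebra\<close>

abbreviation "CT_comp \<equiv> turaev.comp (CT H B)"

lemma comp_CT_simps [simp]:
  "vcarrier (CT_comp a) = vcarrier V" "vscale (CT_comp a) = fun_scale"
  "comul (CT_comp a) = CT_comul H B a" "counit (CT_comp a) = CT_counit H"
  "tmult (CT H B) = CT_mult H" "tunit (CT H B) = CT_unit H" "tantip (CT H B) = CT_antipode H B"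
  by (simp_all add: CT_def)

text \<open>All components share one vector space, so spaces of maps and tensor products lose their
  dependence on the group element; only the coproduct retains it.\<close>

lemma comp_CT_space_simps [simp]:
  "lin_map (CT_comp a) W = lin_map V W"
  "lin_map U (CT_comp a) = lin_map U V"
  "tensor (CT_comp a) (CT_comp b) = tensor V V"
  "tensor_space (CT_comp a) (CT_comp b) = VV"
  by (rule lin_map_space_cong tensor_cong tensor_space_cong; simp)+

lemma comp_CT_tensor_map [simp]:
  "tensor_map (CT_comp a) (CT_comp b) (CT_comp c) (CT_comp d)
    = tensor_map V V V V"
  by (intro ext) (simp add: tensor_map_def tensor_lift_cong[of "CT_comp _" V "CT_comp _" V])

lemma vspace_comp_CT: "vspace (CT_comp a)"
  using vspace_V by (simp add: vspace_def)

lemma coords_comp_CT: "coords (CT_comp a) (B \<times> B) (\<lambda>(i, j). bowtie H (e i) j) coord_V"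
  using coords_V by (simp add: coords_def)

text \<open>Pure tensors of pure tensors suffice, by linearity first in the right and then in the
  left factor.\<close>

lemma VV_map_eqI:
  assumes "lin_map VV U F" "lin_map VV U G"
    and "\<And>p h q h'. lin p \<Longrightarrow> lin q \<Longrightarrow>
      F (tensor V V (bowtie H p h) (bowtie H q h')) = G (tensor V V (bowtie H p h) (bowtie H q h'))"
    and "t \<in> vcarrier VV"
  shows "F t = G t"
proof (rule lin_map_tensor_unique[OF assms(1,2) _ assms(4)])
  fix X Y assume X: "X \<in> vcarrier V" and Y: "Y \<in> vcarrier V"
  have "F (tensor V V (bowtie H p h) Y) = G (tensor V V (bowtie H p h) Y)" if p: "lin p" for p h
    by (rule V_map_eqI[OF lin_map_comp[OF bilin_map_right[OF bilin_tensor_V bowtie_in_V[OF p]] assms(1)]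
          lin_map_comp[OF bilin_map_right[OF bilin_tensor_V bowtie_in_V[OF p]] assms(2)] assms(3)[OF p] Y])
  then show "F (tensor V V X Y) = G (tensor V V X Y)"
    by (rule V_map_eqI[OF lin_map_comp[OF bilin_map_left[OF bilin_tensor_V Y] assms(1)]
          lin_map_comp[OF bilin_map_left[OF bilin_tensor_V Y] assms(2)] _ X])
qed

lemma coalgebra_comp_CT:
  assumes \<alpha>: "\<alpha> \<in> Aut" and \<beta>: "\<beta> \<in> Aut"
  shows "coalgebra (CT_comp (\<alpha>, \<beta>))"
proof (rule coalgebraI[OF vspace_comp_CT coords_comp_CT])
  show "lin_map (CT_comp (\<alpha>, \<beta>))
      (tensor_space (CT_comp (\<alpha>, \<beta>)) (CT_comp (\<alpha>, \<beta>))) (comul (CT_comp (\<alpha>, \<beta>)))"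
    by (simp add: lin_map_CT_comul[OF \<alpha> \<beta>])
  show "lin_map (CT_comp (\<alpha>, \<beta>)) ground (counit (CT_comp (\<alpha>, \<beta>)))"
    by (simp add: lin_map_CT_counit)
qed (auto simp: CT_coassoc[OF \<alpha> \<beta> lin_e lin_e lin_e] CT_counit_left[OF \<alpha> \<beta> lin_e] CT_counit_right[OF \<alpha> \<beta> lin_e])

context
  fixes \<alpha> \<beta> \<gamma> \<delta> :: "'h \<Rightarrow> 'h"
  assumes \<alpha>: "\<alpha> \<in> Aut" and \<beta>: "\<beta> \<in> Aut" and \<gamma>: "\<gamma> \<in> Aut" and \<delta>: "\<delta> \<in> Aut"
begin

lemma CT_mult_coalgebra_map:
  "coalgebra_map (tensor_coalg (CT_comp (\<alpha>, \<beta>)) (CT_comp (\<gamma>, \<delta>)))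
    (CT_comp (mult_fst \<alpha> \<gamma> \<delta>, \<delta> \<circ> \<beta>)) (CT_mult H (\<alpha>, \<beta>) (\<gamma>, \<delta>))"
    (is "coalgebra_map (tensor_coalg ?C ?D) ?E ?m")
proof (rule coalgebra_mapI[OF coords_comp_CT _ vspace_comp_CT])
  have sp: "tensor_space (tensor_coalg ?C ?D) (tensor_coalg ?C ?D) = tensor_space VV VV"
    by (rule tensor_space_cong) simp_all
  have A: "mult_fst \<alpha> \<gamma> \<delta> \<in> Aut" "\<delta> \<circ> \<beta> \<in> Aut"
    by (intro Aut_comp Aut_inv \<alpha> \<beta> \<gamma> \<delta>)+
  note m = lin_map_CT_mult[OF \<alpha> \<delta>, of \<beta> \<gamma>]
  have lC: "lin_map ?C (tensor_space ?C ?C) (comul ?C)" and lD: "lin_map ?D (tensor_space ?D ?D) (comul ?D)"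
    by (simp_all add: lin_map_CT_comul \<alpha> \<beta> \<gamma> \<delta>)
  note lt = lin_map_comul_tensor_coalg[OF vspace_comp_CT vspace_comp_CT lC lD, unfolded comp_CT_space_simps]
  show "vspace (tensor_coalg ?C ?D)"
    using vspace_VV by (simp add: vspace_def)
  have lt': "lin_map (tensor_coalg ?C ?D) (tensor_space VV VV) = lin_map VV (tensor_space VV VV)"
    by (rule lin_map_space_cong) simp_all
  show "lin_map (tensor_coalg ?C ?D) (tensor_space (tensor_coalg ?C ?D) (tensor_coalg ?C ?D)) (comul
      (tensor_coalg ?C ?D))"
    unfolding sp lt' by (rule lt)
  show "lin_map ?E (tensor_space ?E ?E) (comul ?E)"
    by (simp add: lin_map_CT_comul A)
  have "lin_map (tensor_coalg ?C ?D) V = lin_map VV V"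
    by (rule lin_map_space_cong) simp_all
  then show "lin_map (tensor_coalg ?C ?D) ?E ?m" by (simp add: m)
  fix t assume "t \<in> vcarrier (tensor_coalg ?C ?D)"
  then have t: "t \<in> vcarrier VV" by simp
  show "comul ?E (?m t) (\<lambda>u v. coord_V i u * coord_V j v)
      = comul (tensor_coalg ?C ?D) t (\<lambda>u v. coord_V i (?m u) * coord_V j (?m v))"
    for i j :: "'h \<times> 'h"
  proof (rule VV_map_eqI[OF lin_map_comp[OF m] lin_map_comp[OF lt lin_map_eval] _ t])
    obtain x f y g where ij: "i = (x, f)" "j = (y, g)" by (metis surj_pair)
    show "lin_map V ground (\<lambda>X. comul ?E X (\<lambda>u v. coord_V i u * coord_V j v))"
      using lin_map_CT_comul_form[OF A] by simp
    fix p h q h' assume p: "lin p" and q: "lin q"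
    have b: "bilin_map (tensor_space ?C ?D) (tensor_space ?C ?D) ground (\<lambda>u v. ev x (e f) (?m u) * ev y
        (e g) (?m v))"
      by (simp add: bilin_map_mult[OF lin_map_comp[OF m lin_map_ev] lin_map_comp[OF m lin_map_ev]])
    show "comul ?E (?m (tensor V V (bowtie H p h) (bowtie H q h')))
        (\<lambda>u v. coord_V i u * coord_V j v)
      = comul (tensor_coalg ?C ?D) (tensor V V (bowtie H p h) (bowtie H q h'))
        (\<lambda>u v. coord_V i (?m u) * coord_V j (?m v))"
      using comul_tensor_coalg_form[OF vspace_comp_CT vspace_comp_CT lC lD _ _ b, of "bowtie H p h"
          "bowtie H q h'"]
      by (simp add: ij bowtie_in_V p q CT_comul_CT_mult[OF \<alpha> \<beta> \<gamma> \<delta> p q lin_e lin_e])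
  qed
  have cl: "bilin_map V V ground (\<lambda>X Y. CT_counit H X * CT_counit H Y)"
    by (intro bilin_map_mult lin_map_CT_counit)
  have "counit (tensor_coalg ?C ?D) = tensor_lift V V ground (\<lambda>X Y. CT_counit H X * CT_counit H Y)"
    by (simp add: tensor_coalg_def tensor_lift_cong[of ?C V ?D V])
  moreover have "CT_counit H (?m t) = tensor_lift V V ground (\<lambda>X Y. CT_counit H X * CT_counit H Y) t"
  proof (rule VV_map_eqI[OF lin_map_comp[OF m lin_map_CT_counit] lin_map_tensor_lift[OF vspace_ground cl] _ t])
    fix p h q h' assume p: "lin p" and q: "lin q"
    show "CT_counit H (?m (tensor V V (bowtie H p h) (bowtie H q h')))
        = tensor_lift V V ground (\<lambda>X Y. CT_counit H X * CT_counit H Y) (tensor V V (bowtie H p h)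
            (bowtie H q h'))"
      by (simp add: tensor_lift_tensor[OF vspace_ground cl] bowtie_in_V p q CT_mult_bowtie \<alpha> \<delta> CT_counit_bowtie
          lin_conv conv_sw sw_one lin_intros counit_mult Aut_counit Aut_inv)
  qed
  ultimately show "counit ?E (?m t) = counit (tensor_coalg ?C ?D) t" by simp
qed

end

lemma CT_unit_coalgebra_map: "coalgebra_map ground_coalg (CT_comp (id, id)) (CT_unit H)"
proof (rule coalgebra_mapI[OF coords_comp_CT _ vspace_comp_CT lin_map_ground_coalg_comul])
  have G: "lin_map (ground_coalg :: ('k, 'k) coalg) V = lin_map ground V"
    by (rule lin_map_space_cong) (simp_all add: ground_coalg_simps)
  show "vspace (ground_coalg :: ('k, 'k) coalg)"
    using vspace_ground[where 'k='k] by (simp add: vspace_def ground_coalg_simps)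
  show "lin_map (CT_comp (id, id)) (tensor_space (CT_comp (id, id)) (CT_comp (id, id)))
      (comul (CT_comp (id, id)))"
    by (simp add: lin_map_CT_comul Aut_id)
  show "lin_map ground_coalg (CT_comp (id, id)) (CT_unit H)"
    by (simp add: G lin_map_CT_unit)
  show "comul (CT_comp (id, id)) (CT_unit H c) (\<lambda>u v. coord_V i u * coord_V j v)
      = comul ground_coalg c (\<lambda>u v. coord_V i (CT_unit H u) * coord_V j (CT_unit H v))"
    for c and i j :: "'h \<times> 'h"
    by (cases i; cases j)
      (simp add: CT_comul_CT_unit lin_e bilin_map_mult ground_coalg_comul_form lin_map_comp[OF
          lin_map_CT_unit lin_map_ev])
  show "counit (CT_comp (id, id)) (CT_unit H c) = counit ground_coalg c" for c
    by (simp add: ground_coalg_simps CT_counit_ev CT_unit_in_V ev_CT_unit counit_in_D)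
qed

lemma bilin_map_CT_mult:
  "\<alpha> \<in> Aut \<Longrightarrow> \<delta> \<in> Aut \<Longrightarrow> bilin_map V V V (\<lambda>X Y. CT_mult H (\<alpha>, \<beta>) (\<gamma>, \<delta>) (tensor V V X Y))"
  by (rule bilin_map_postcomp[OF bilin_tensor_V lin_map_CT_mult])

text \<open>On pure tensors the claim splits into associativity of convolution and a comparison of
  twists, where conjugation by \<nu> \<circ> \<delta> decomposes into successive conjugations. It is
  extended by linearity to Z in \<open>2\<close>, to Y in \<open>3\<close> and finally to X.\<close>

lemma CT_mult_assoc:
  assumes \<alpha>: "\<alpha> \<in> Aut" and \<gamma>: "\<gamma> \<in> Aut" and \<delta>: "\<delta> \<in> Aut" and \<nu>: "\<nu> \<in> Aut"
    and X: "X \<in> vcarrier V" and Y: "Y \<in> vcarrier V" and Z: "Z \<in> vcarrier V"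
  shows "CT_mult H (mult_fst \<alpha> \<gamma> \<delta>, \<delta> \<circ> \<beta>) (\<mu>, \<nu>) (tensor V V (CT_mult H (\<alpha>, \<beta>) (\<gamma>, \<delta>) (tensor V V X Y)) Z)
    = CT_mult H (\<alpha>, \<beta>) (mult_fst \<gamma> \<mu> \<nu>, \<nu> \<circ> \<delta>) (tensor V V X (CT_mult H (\<gamma>, \<delta>) (\<mu>, \<nu>) (tensor V V Y Z)))"
proof -
  let ?m1 = "\<lambda>X Y. CT_mult H (mult_fst \<alpha> \<gamma> \<delta>, \<delta> \<circ> \<beta>) (\<mu>, \<nu>) (tensor V V X Y)"
  let ?m2 = "\<lambda>X Y. CT_mult H (\<alpha>, \<beta>) (\<gamma>, \<delta>) (tensor V V X Y)"
  let ?m3 = "\<lambda>X Y. CT_mult H (\<alpha>, \<beta>) (mult_fst \<gamma> \<mu> \<nu>, \<nu> \<circ> \<delta>) (tensor V V X Y)"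
  let ?m4 = "\<lambda>X Y. CT_mult H (\<gamma>, \<delta>) (\<mu>, \<nu>) (tensor V V X Y)"
  have A: "mult_fst \<alpha> \<gamma> \<delta> \<in> Aut" "\<nu> \<circ> \<delta> \<in> Aut" by (intro Aut_comp Aut_inv \<alpha> \<gamma> \<delta> \<nu>)+
  have b: "bilin_map V V V ?m1" "bilin_map V V V ?m2" "bilin_map V V V ?m3" "bilin_map V V V ?m4"
    by (intro bilin_map_CT_mult \<alpha> \<gamma> \<delta> \<nu> A)+
  have b4: "?m4 Y Z \<in> vcarrier V" if "Y \<in> vcarrier V" for Y
    by (rule lin_map_carrier[OF bilin_map_left[OF b(4) Z] that])
  have 1: "?m1 (?m2 (bowtie H p h) (bowtie H q h')) (bowtie H r h'') = ?m3 (bowtie H p h) (?m4 (bowtie H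
      q h') (bowtie H r h''))"
    if "lin p" "lin q" "lin r" for p q r h h' h''
    by (simp add: CT_mult_bowtie that \<alpha> \<gamma> \<delta> \<nu> A lin_conv conv_assoc Aut_mult[OF \<alpha>] Aut_mult[OF \<nu>] Aut_mult[OF \<delta>]
        Aut_mult[OF Aut_inv[OF \<nu>]] Aut_mult[OF Aut_inv[OF \<delta>]] Aut_inv1 o_inv_distrib Aut_bij mult.assoc)
  have 2: "?m1 (?m2 (bowtie H p h) (bowtie H q h')) Z = ?m3 (bowtie H p h) (?m4 (bowtie H q h') Z)"
    if p: "lin p" and q: "lin q" for p q h h'
  proof -
    note P = bowtie_in_V[OF p, of h] and Q = bowtie_in_V[OF q, of h']
    have m: "?m2 (bowtie H p h) (bowtie H q h') \<in> vcarrier V"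
      by (rule lin_map_carrier[OF bilin_map_left[OF b(2) Q] P])
    show ?thesis
      by (rule V_map_eqI[OF bilin_map_right[OF b(1) m]
            lin_map_comp[OF bilin_map_right[OF b(4) Q] bilin_map_right[OF b(3) P]] _ Z]) (rule 1[OF p q])
  qed
  have 3: "?m1 (?m2 (bowtie H p h) Y) Z = ?m3 (bowtie H p h) (?m4 Y Z)" if p: "lin p" for p h
  proof -
    note P = bowtie_in_V[OF p, of h]
    show ?thesis
      by (rule V_map_eqI[OF lin_map_comp[OF bilin_map_right[OF b(2) P] bilin_map_left[OF b(1) Z]]
            lin_map_comp[OF bilin_map_left[OF b(4) Z] bilin_map_right[OF b(3) P]] _ Y]) (rule 2[OF p])
  qed
  show ?thesis
    by (rule V_map_eqI[OF lin_map_comp[OF bilin_map_left[OF b(2) Y] bilin_map_left[OF b(1) Z]]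
          bilin_map_left[OF b(3) b4[OF Y]] _ X]) (rule 3)
qed

lemma CT_mult_unit:
  assumes \<alpha>: "\<alpha> \<in> Aut" and \<beta>: "\<beta> \<in> Aut" and X: "X \<in> vcarrier V"
  shows "CT_mult H (id, id) (\<alpha>, \<beta>) (tensor V V (CT_unit H 1) X) = X"
    and "CT_mult H (\<alpha>, \<beta>) (id, id) (tensor V V X (CT_unit H 1)) = X"
proof -
  show "CT_mult H (id, id) (\<alpha>, \<beta>) (tensor V V (CT_unit H 1) X) = X"
    by (rule V_map_eqI[OF bilin_map_right[OF bilin_map_CT_mult[OF Aut_id \<beta>] CT_unit_in_V] lin_map_id _ X])
      (simp add: CT_unit_1 CT_mult_bowtie Aut_id \<beta> counit_in_D conv_counit Aut_one Aut_inv2)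
  show "CT_mult H (\<alpha>, \<beta>) (id, id) (tensor V V X (CT_unit H 1)) = X"
    by (rule V_map_eqI[OF bilin_map_left[OF bilin_map_CT_mult[OF \<alpha> Aut_id] CT_unit_in_V] lin_map_id _ X])
      (simp add: CT_unit_1 CT_mult_bowtie Aut_id \<alpha> counit_in_D conv_counit Aut_one)
qed

text \<open>Under an evaluation, \<open>tensor_map_eval\<close> converts the left sides into the
  forms computed in \<open>CT_antipode_right\<close> and \<open>CT_antipode_left\<close>.\<close>

lemma CT_antipode_convolution:
  assumes \<alpha>: "\<alpha> \<in> Aut" and \<beta>: "\<beta> \<in> Aut" and X: "X \<in> vcarrier V"
  shows "CT_mult H (\<alpha>, \<beta>) (inv_fst \<alpha> \<beta>, \<beta>\<^sup>-\<^sup>1)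
      (tensor_map V V V V id (CT_antipode H B (\<alpha>, \<beta>)) (CT_comul H B (\<alpha>, \<beta>) X)) = CT_unit H (CT_counit H X)"
    and "CT_mult H (inv_fst \<alpha> \<beta>, \<beta>\<^sup>-\<^sup>1) (\<alpha>, \<beta>)
      (tensor_map V V V V (CT_antipode H B (\<alpha>, \<beta>)) id (CT_comul H B (\<alpha>, \<beta>) X)) = CT_unit H (CT_counit H X)"
proof -
  let ?L = "\<lambda>X. CT_mult H (\<alpha>, \<beta>) (inv_fst \<alpha> \<beta>, \<beta>\<^sup>-\<^sup>1)
      (tensor_map V V V V id (CT_antipode H B (\<alpha>, \<beta>)) (CT_comul H B (\<alpha>, \<beta>) X))"
  let ?R = "\<lambda>X. CT_mult H (inv_fst \<alpha> \<beta>, \<beta>\<^sup>-\<^sup>1) (\<alpha>, \<beta>)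
      (tensor_map V V V V (CT_antipode H B (\<alpha>, \<beta>)) id (CT_comul H B (\<alpha>, \<beta>) X))"
  have A: "inv_fst \<alpha> \<beta> \<in> Aut" "\<beta>\<^sup>-\<^sup>1 \<in> Aut" by (intro Aut_comp Aut_inv \<alpha> \<beta>)+
  note c = lin_map_CT_comul[OF \<alpha> \<beta>] and s = lin_map_CT_antipode[OF \<alpha> \<beta>]
  have id: "lin_map V V id" using lin_map_id[of V] by (simp add: id_def)
  note m1 = lin_map_CT_mult[OF \<alpha> A(2), of \<beta> "inv_fst \<alpha> \<beta>"] and m2 = lin_map_CT_mult[OF A(1) \<beta>, of "\<beta>\<^sup>-\<^sup>1" \<alpha>]
  have u: "lin_map V V (\<lambda>X. CT_unit H (CT_counit H X))" by (rule lin_map_comp[OF lin_map_CT_counit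
      lin_map_CT_unit])
  note F1 = lin_map_comp[OF c lin_map_comp[OF lin_map_tensor_map[OF id s] m1]]
    and F2 = lin_map_comp[OF c lin_map_comp[OF lin_map_tensor_map[OF s id] m2]]
  show "?L X = CT_unit H (CT_counit H X)"
  proof (rule V_map_ev_eqI[OF F1 u X])
    fix p f x h assume p: "lin p" and f: "lin f"
    show "ev x f (?L (bowtie H p h)) = ev x f (CT_unit H (CT_counit H (bowtie H p h)))"
      using tensor_map_eval[OF id s lin_map_comp[OF m1 lin_map_ev] lin_map_carrier[OF c bowtie_in_V[OF
          p]], of x f]
      by (simp add: CT_antipode_right[OF \<alpha> \<beta> p f] ev_CT_unit[OF f] CT_counit_bowtie[OF p] ac_simps)
  qed
  show "?R X = CT_unit H (CT_counit H X)"
  proof (rule V_map_ev_eqI[OF F2 u X])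
    fix p f x h assume p: "lin p" and f: "lin f"
    show "ev x f (?R (bowtie H p h)) = ev x f (CT_unit H (CT_counit H (bowtie H p h)))"
      using tensor_map_eval[OF s id lin_map_comp[OF m2 lin_map_ev] lin_map_carrier[OF c bowtie_in_V[OF
          p]], of x f]
      by (simp add: CT_antipode_left[OF \<alpha> \<beta> p f] ev_CT_unit[OF f] CT_counit_bowtie[OF p] ac_simps)
  qed
qed

lemma turaev_algebra_CT: "turaev_algebra (aut_pairs H) (CT H B)"
  by (intro turaev_algebra.intro[OF group_aut_pairs] turaev_algebra_axioms.intro)
    (auto simp: coalgebra_comp_CT CT_mult_coalgebra_map CT_unit_coalgebra_map CT_mult_assoc CT_mult_unit
      lin_map_CT_antipode CT_antipode_convolution inv_aut_pairs)

section \<open>The axioms of the crossing\<close>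

lemma Aut_inv_comp: "\<alpha> \<in> Aut \<Longrightarrow> \<beta> \<in> Aut \<Longrightarrow> (\<alpha> \<circ> \<beta>)\<^sup>-\<^sup>1 = \<beta>\<^sup>-\<^sup>1 \<circ> \<alpha>\<^sup>-\<^sup>1"
  by (intro o_inv_distrib Aut_bij)

lemma Aut_inv_inv: "\<alpha> \<in> Aut \<Longrightarrow> (\<alpha>\<^sup>-\<^sup>1)\<^sup>-\<^sup>1 = \<alpha>"
  by (intro inv_inv_eq Aut_bij)

lemmas Aut_simps = Aut_comp Aut_inv Aut_id Aut_inv_comp Aut_inv_inv Aut_inv1 Aut_inv2

text \<open>Composition telescopes: on the functional side, (\<beta>2 \<alpha>1 \<beta>2^-1
  \<alpha>2)^-1 \<beta>2 \<beta>1 equals \<alpha>2^-1 \<beta>2 \<alpha>1^-1 \<beta>1, and the two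
  conjugations by \<beta>2 cancel likewise on the side of H.\<close>

lemma CT_crossing_CT_crossing:
  assumes \<alpha>1: "\<alpha>1 \<in> Aut" and \<beta>1: "\<beta>1 \<in> Aut" and \<alpha>2: "\<alpha>2 \<in> Aut" and \<beta>2: "\<beta>2 \<in> Aut"
    and \<delta>: "\<delta> \<in> Aut" and X: "X \<in> vcarrier V"
  shows "CT_crossing H (\<alpha>1, \<beta>1) (\<gamma>', \<beta>2\<^sup>-\<^sup>1 \<circ> \<delta> \<circ> \<beta>2) (CT_crossing H (\<alpha>2, \<beta>2) (\<gamma>, \<delta>) X)
    = CT_crossing H (mult_fst \<alpha>1 \<alpha>2 \<beta>2, \<beta>2 \<circ> \<beta>1) (\<gamma>, \<delta>) X"
proof -
  note A = \<alpha>1 \<beta>1 \<alpha>2 \<beta>2 \<delta>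
  have \<delta>': "\<beta>2\<^sup>-\<^sup>1 \<circ> \<delta> \<circ> \<beta>2 \<in> Aut" and A': "mult_fst \<alpha>1 \<alpha>2 \<beta>2 \<in> Aut" "\<beta>2 \<circ> \<beta>1 \<in> Aut"
    by (intro Aut_comp Aut_inv A)+
  note c = lin_map_carrier[OF lin_map_CT_crossing[OF \<alpha>2 \<beta>2 \<delta>] X]
  show ?thesis
  proof (rule V_eqI[OF lin_map_carrier[OF lin_map_CT_crossing[OF \<alpha>1 \<beta>1 \<delta>'] c]
        lin_map_carrier[OF lin_map_CT_crossing[OF A' \<delta>] X]])
    fix x f assume f: "lin f"
    let ?f = "\<lambda>w. f (\<beta>1\<^sup>-\<^sup>1 ((\<beta>2\<^sup>-\<^sup>1 \<circ> \<delta> \<circ> \<beta>2) (\<alpha>1 ((\<beta>2\<^sup>-\<^sup>1 \<circ> \<delta> \<circ> \<beta>2)\<^sup>-\<^sup>1 w))))"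
    have "lin ?f"
      by (rule lin_app[OF f]) (intro lin_end_Aut[OF Aut_inv[OF \<beta>1]] lin_end_Aut[OF \<alpha>1] lin_end_Aut[OF \<delta>']
          lin_end_Aut[OF Aut_inv[OF \<delta>']] lin_end_id)
    then show "ev x f (CT_crossing H (\<alpha>1, \<beta>1) (\<gamma>', \<beta>2\<^sup>-\<^sup>1 \<circ> \<delta> \<circ> \<beta>2) (CT_crossing H (\<alpha>2, \<beta>2) (\<gamma>, \<delta>) X))
      = ev x f (CT_crossing H (mult_fst \<alpha>1 \<alpha>2 \<beta>2, \<beta>2 \<circ> \<beta>1) (\<gamma>, \<delta>) X)"
      unfolding ev_CT_crossing[OF \<alpha>1 \<beta>1 \<delta>' f c] ev_CT_crossing[OF A' \<delta> f X] ev_CT_crossing[OF \<alpha>2 \<beta>2 \<delta>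
          \<open>lin ?f\<close> X]
      by (simp add: Aut_simps A)
  qed
qed

lemma CT_crossing_id: "\<delta> \<in> Aut \<Longrightarrow> X \<in> vcarrier V \<Longrightarrow> CT_crossing H (id, id) (\<gamma>, \<delta>) X = X"
  by (rule V_eqI[OF lin_map_carrier[OF lin_map_CT_crossing[OF Aut_id Aut_id]]])
    (simp_all add: ev_CT_crossing Aut_id Aut_inv2)

context
  fixes \<alpha> \<beta> \<gamma> \<delta> :: "'h \<Rightarrow> 'h"
  assumes \<alpha>: "\<alpha> \<in> Aut" and \<beta>: "\<beta> \<in> Aut" and \<gamma>: "\<gamma> \<in> Aut" and \<delta>: "\<delta> \<in> Aut"
begin

text \<open>The inverse is the crossing by the inverse group element: by the composition rule, both
  composites are crossings by the identity.\<close>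

lemma bij_betw_CT_crossing: "bij_betw (CT_crossing H (\<alpha>, \<beta>) (\<gamma>, \<delta>)) (vcarrier V) (vcarrier V)"
proof -
  have A: "inv_fst \<alpha> \<beta> \<in> Aut" "\<beta>\<^sup>-\<^sup>1 \<in> Aut" "conj_snd \<beta> \<delta> \<in> Aut" by (intro Aut_comp Aut_inv \<alpha> \<beta> \<delta>)+
  let ?i = "CT_crossing H (inv_fst \<alpha> \<beta>, \<beta>\<^sup>-\<^sup>1) (\<gamma>, conj_snd \<beta> \<delta>)"
  have eq: "\<beta> \<circ> (inv_fst \<alpha> \<beta>) \<circ> \<beta>\<^sup>-\<^sup>1 \<circ> \<alpha> = id" "\<beta> \<circ> \<beta>\<^sup>-\<^sup>1 = id"
    "\<beta>\<^sup>-\<^sup>1 \<circ> \<alpha> \<circ> \<beta> \<circ> (inv_fst \<alpha> \<beta>) = id" "\<beta>\<^sup>-\<^sup>1 \<circ> \<beta> = id"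
    "\<beta> \<circ> (conj_snd \<beta> \<delta>) \<circ> \<beta>\<^sup>-\<^sup>1 = \<delta>"
    by (simp_all add: fun_eq_iff Aut_simps \<alpha> \<beta>)
  show ?thesis
  proof (rule bij_betw_byWitness[where f' = ?i])
    show "\<forall>X\<in>vcarrier V. ?i (CT_crossing H (\<alpha>, \<beta>) (\<gamma>, \<delta>) X) = X"
      using CT_crossing_CT_crossing[OF A(1,2) \<alpha> \<beta> \<delta>] by (simp add: eq CT_crossing_id \<delta>)
    show "\<forall>X\<in>vcarrier V. CT_crossing H (\<alpha>, \<beta>) (\<gamma>, \<delta>) (?i X) = X"
      using CT_crossing_CT_crossing[OF \<alpha> \<beta> A] by (simp add: Aut_inv_inv[OF \<beta>] eq CT_crossing_id A)
    show "CT_crossing H (\<alpha>, \<beta>) (\<gamma>, \<delta>) ` vcarrier V \<subseteq> vcarrier V" "?i ` vcarrier V \<subseteq> vcarrier V"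
      using lin_map_carrier[OF lin_map_CT_crossing] \<alpha> \<beta> \<delta> A by blast+
  qed
qed

lemma CT_crossing_coalgebra_iso:
  "coalgebra_iso (CT_comp (\<gamma>, \<delta>))
    (CT_comp (conj_fst \<alpha> \<beta> \<gamma> \<delta>, conj_snd \<beta> \<delta>)) (CT_crossing H (\<alpha>, \<beta>) (\<gamma>, \<delta>))"
    (is "coalgebra_iso ?C ?E _")
proof -
  have A: "conj_fst \<alpha> \<beta> \<gamma> \<delta> \<in> Aut" "conj_snd \<beta> \<delta> \<in> Aut"
    by (intro Aut_comp Aut_inv \<alpha> \<beta> \<gamma> \<delta>)+
  note c = lin_map_CT_crossing[OF \<alpha> \<beta> \<delta>, of \<gamma>]
  have "coalgebra_map ?C ?E (CT_crossing H (\<alpha>, \<beta>) (\<gamma>, \<delta>))"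
  proof (rule coalgebra_mapI[OF coords_comp_CT vspace_comp_CT vspace_comp_CT])
    show "lin_map ?C (tensor_space ?C ?C) (comul ?C)" "lin_map ?E (tensor_space ?E ?E) (comul ?E)"
      by (simp_all add: lin_map_CT_comul A \<gamma> \<delta>)
    show "lin_map ?C ?E (CT_crossing H (\<alpha>, \<beta>) (\<gamma>, \<delta>))" by (simp add: c)
    fix X assume "X \<in> vcarrier ?C"
    then have X: "X \<in> vcarrier V" by simp
    show "comul ?E (CT_crossing H (\<alpha>, \<beta>) (\<gamma>, \<delta>) X) (\<lambda>u v. coord_V i u * coord_V j v)
      = comul ?C X (\<lambda>u v. coord_V i (CT_crossing H (\<alpha>, \<beta>) (\<gamma>, \<delta>) u)
        * coord_V j (CT_crossing H (\<alpha>, \<beta>) (\<gamma>, \<delta>) v))" for i j :: "'h \<times> 'h"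
      unfolding comp_CT_simps
      by (rule V_map_eqI[OF lin_map_comp[OF c lin_map_CT_comul_form[OF A]] lin_map_CT_comul_form[OF \<gamma> \<delta>] _ X])
        (cases i; cases j; simp add: CT_comul_CT_crossing[OF \<alpha> \<beta> \<gamma> \<delta> A(1) _ A(2) _ _ lin_e lin_e])
    have "ev (\<alpha>\<^sup>-\<^sup>1 (\<beta> 1)) (\<lambda>w. \<epsilon> (\<beta>\<^sup>-\<^sup>1 (\<delta> (\<alpha> (\<delta>\<^sup>-\<^sup>1 w))))) X = ev 1 \<epsilon> X"
      by (simp add: Aut_one Aut_counit Aut_inv \<alpha> \<beta> \<delta>)
    then show "counit ?E (CT_crossing H (\<alpha>, \<beta>) (\<gamma>, \<delta>) X) = counit ?C X"
      by (simp add: CT_counit_ev X lin_map_carrier[OF c X] ev_CT_crossing[OF \<alpha> \<beta> \<delta> counit_in_D X])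
  qed
  then show ?thesis
    using bij_betw_CT_crossing by (simp add: coalgebra_iso_def)
qed

lemma CT_crossing_CT_unit: "CT_crossing H (\<alpha>, \<beta>) (id, id) (CT_unit H r) = CT_unit H r"
proof (rule V_eqI[OF lin_map_carrier[OF lin_map_CT_crossing[OF \<alpha> \<beta> Aut_id] CT_unit_in_V] CT_unit_in_V])
  fix x f assume f: "lin f"
  have "lin (\<lambda>w. f (\<beta>\<^sup>-\<^sup>1 (id (\<alpha> (id\<^sup>-\<^sup>1 w)))))"
    by (rule lin_app[OF f]) (simp add: lin_end_Aut[OF Aut_inv[OF \<beta>]] lin_end_Aut[OF \<alpha>] lin_end_id)
  then show "ev x f (CT_crossing H (\<alpha>, \<beta>) (id, id) (CT_unit H r)) = ev x f (CT_unit H r)"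
    unfolding ev_CT_crossing[OF \<alpha> \<beta> Aut_id f CT_unit_in_V]
    by (simp add: ev_CT_unit f Aut_counit Aut_one Aut_inv \<alpha> \<beta>)
qed

text \<open>The automorphism \<alpha>^-1 \<circ> \<beta> can be moved through the three legs of x.
  What then remains is an equation between words in automorphisms, which commute with S and
  \<open>S'\<close>.\<close>

lemma CT_crossing_CT_antipode:
  assumes X: "X \<in> vcarrier V"
  shows "CT_crossing H (\<alpha>, \<beta>) (inv_fst \<gamma> \<delta>, \<delta>\<^sup>-\<^sup>1) (CT_antipode H B (\<gamma>, \<delta>) X)
    = CT_antipode H B (conj_fst \<alpha> \<beta> \<gamma> \<delta>, conj_snd \<beta> \<delta>) (CT_crossing H (\<alpha>, \<beta>) (\<gamma>, \<delta>) X)"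
proof -
  let ?L = "\<lambda>X. CT_crossing H (\<alpha>, \<beta>) (inv_fst \<gamma> \<delta>, \<delta>\<^sup>-\<^sup>1) (CT_antipode H B (\<gamma>, \<delta>) X)"
  let ?R = "\<lambda>X. CT_antipode H B (conj_fst \<alpha> \<beta> \<gamma> \<delta>, conj_snd \<beta> \<delta>) (CT_crossing H (\<alpha>, \<beta>) (\<gamma>, \<delta>) X)"
  have A: "conj_fst \<alpha> \<beta> \<gamma> \<delta> \<in> Aut" "conj_snd \<beta> \<delta> \<in> Aut"
    by (intro Aut_comp Aut_inv \<alpha> \<beta> \<gamma> \<delta>)+
  note i = \<alpha>[THEN Aut_inv] \<beta>[THEN Aut_inv] \<gamma>[THEN Aut_inv] \<delta>[THEN Aut_inv]
  have \<phi>: "\<alpha>\<^sup>-\<^sup>1 \<circ> \<beta> \<in> Aut" by (intro Aut_comp i \<beta>)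
  note c = lin_map_CT_crossing[OF \<alpha> \<beta> \<delta>, of \<gamma>] and s = lin_map_CT_antipode[OF \<gamma> \<delta>]
    and F = lin_map_comp[OF lin_map_CT_antipode[OF \<gamma> \<delta>] lin_map_CT_crossing[OF \<alpha> \<beta> i(4), of "inv_fst \<gamma> \<delta>"]]
    and G = lin_map_comp[OF lin_map_CT_crossing[OF \<alpha> \<beta> \<delta>, of \<gamma>] lin_map_CT_antipode[OF A]]
  show ?thesis
  proof (rule V_map_ev_eqI[OF F G X])
    fix p f x h assume p: "lin p" and f: "lin f"
    note b = bowtie_in_V[OF p, of h]
    note A' = \<alpha>[THEN lin_end_Aut] \<beta>[THEN lin_end_Aut] \<gamma>[THEN lin_end_Aut] \<delta>[THEN lin_end_Aut] i[THEN
        lin_end_Aut]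
    note l = lin_intros3 A' lin_app[OF f] lin_app[OF p]
    let ?f = "\<lambda>w. f (\<beta>\<^sup>-\<^sup>1 (\<delta>\<^sup>-\<^sup>1 (\<alpha> ((\<delta>\<^sup>-\<^sup>1)\<^sup>-\<^sup>1 w))))"
    have f': "lin ?f" unfolding Aut_inv_inv[OF \<delta>] by (intro l)
    note M = Aut_mult[OF \<alpha>] Aut_mult[OF \<beta>] Aut_mult[OF \<gamma>] Aut_mult[OF \<delta>] i[THEN Aut_mult]
      Aut_S[OF \<alpha>] Aut_S[OF \<beta>] Aut_S[OF \<gamma>] Aut_S[OF \<delta>] i[THEN Aut_S]
      Aut_S'[OF \<alpha>] Aut_S'[OF \<beta>] Aut_S'[OF \<gamma>] Aut_S'[OF \<delta>] i[THEN Aut_S']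
    have "ev x f (?L (bowtie H p h)) = sw3 ((\<alpha>\<^sup>-\<^sup>1 \<circ> \<beta>) x) (\<lambda>x1 x2 x3. p (S' x2) * ?f (\<delta>\<^sup>-\<^sup>1 (S' x3) * \<delta>\<^sup>-\<^sup>1
        (\<gamma>\<^sup>-\<^sup>1 (S h)) * \<delta>\<^sup>-\<^sup>1 (\<gamma>\<^sup>-\<^sup>1 (\<delta> x1))))"
      unfolding ev_CT_crossing[OF \<alpha> \<beta> i(4) f lin_map_carrier[OF s b]] ev_CT_antipode[OF \<gamma> \<delta> p f'] by simp
    also have "\<dots> = sw3 x (\<lambda>x1 x2 x3. p (S' ((\<alpha>\<^sup>-\<^sup>1 \<circ> \<beta>) x2)) * ?f (\<delta>\<^sup>-\<^sup>1 (S' ((\<alpha>\<^sup>-\<^sup>1 \<circ> \<beta>) x3)) *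
        \<delta>\<^sup>-\<^sup>1 (\<gamma>\<^sup>-\<^sup>1 (S h)) * \<delta>\<^sup>-\<^sup>1 (\<gamma>\<^sup>-\<^sup>1 (\<delta> ((\<alpha>\<^sup>-\<^sup>1 \<circ> \<beta>) x1)))))"
      unfolding Aut_inv_inv[OF \<delta>] by (rule sw3_Aut[OF _ _ _ \<phi>]) (intro l)+
    also have "\<dots> = ev x f (?R (bowtie H p h))"
      unfolding CT_crossing_bowtie[OF \<alpha> \<beta> \<delta> p] ev_CT_antipode[OF A lin_comp_Aut[OF \<phi> p] f]
      by (simp add: Aut_simps \<alpha> \<beta> \<gamma> \<delta> M)
    finally show "ev x f (?L (bowtie H p h)) = ev x f (?R (bowtie H p h))" .
  qed
qed

text \<open>Precomposition with \<alpha>^-1 \<circ> \<beta> respects convolution because that map is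
  a coalgebra map; on the side of H the twists on the two sides are equal words in
  automorphisms.\<close>

lemma CT_crossing_CT_mult:
  assumes \<nu>: "\<nu> \<in> Aut" and t: "t \<in> vcarrier VV"
  shows "CT_mult H (conj_fst \<alpha> \<beta> \<gamma> \<delta>, conj_snd \<beta> \<delta>) (\<mu>', conj_snd \<beta> \<nu>)
      (tensor_map V V V V (CT_crossing H (\<alpha>, \<beta>) (\<gamma>, \<delta>)) (CT_crossing H (\<alpha>, \<beta>) (\<mu>, \<nu>)) t)
    = CT_crossing H (\<alpha>, \<beta>) (mult_fst \<gamma> \<mu> \<nu>, \<nu> \<circ> \<delta>) (CT_mult H (\<gamma>, \<delta>) (\<mu>, \<nu>) t)"
proof -
  have A: "conj_fst \<alpha> \<beta> \<gamma> \<delta> \<in> Aut" "conj_snd \<beta> \<nu> \<in> Aut" "\<nu> \<circ> \<delta> \<in> Aut"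
    and \<phi>: "\<alpha>\<^sup>-\<^sup>1 \<circ> \<beta> \<in> Aut"
    by (intro Aut_comp Aut_inv \<alpha> \<beta> \<gamma> \<delta> \<nu>)+
  note i = \<alpha>[THEN Aut_inv] \<beta>[THEN Aut_inv] \<gamma>[THEN Aut_inv] \<delta>[THEN Aut_inv] \<nu>[THEN Aut_inv]
  note M = Aut_mult[OF \<alpha>] Aut_mult[OF \<beta>] Aut_mult[OF \<gamma>] Aut_mult[OF \<delta>] Aut_mult[OF \<nu>] i[THEN Aut_mult]
  note c = lin_map_CT_crossing[OF \<alpha> \<beta> \<delta>, of \<gamma>] lin_map_CT_crossing[OF \<alpha> \<beta> \<nu>, of \<mu>]
  show ?thesis
  proof (rule VV_map_eqI[OF lin_map_comp[OF lin_map_tensor_map[OF c] lin_map_CT_mult[OF A(1,2)]]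
        lin_map_comp[OF lin_map_CT_mult[OF \<gamma> \<nu>] lin_map_CT_crossing[OF \<alpha> \<beta> A(3)]] _ t])
    fix p h q h' assume p: "lin p" and q: "lin q"
    show "CT_mult H (conj_fst \<alpha> \<beta> \<gamma> \<delta>, conj_snd \<beta> \<delta>) (\<mu>', conj_snd \<beta> \<nu>)
        (tensor_map V V V V (CT_crossing H (\<alpha>, \<beta>) (\<gamma>, \<delta>)) (CT_crossing H (\<alpha>, \<beta>) (\<mu>, \<nu>))
          (tensor V V (bowtie H p h) (bowtie H q h')))
      = CT_crossing H (\<alpha>, \<beta>) (mult_fst \<gamma> \<mu> \<nu>, \<nu> \<circ> \<delta>) (CT_mult H (\<gamma>, \<delta>) (\<mu>, \<nu>) (tensor V V (bowtie H p h)
          (bowtie H q h')))"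
      unfolding tensor_map_tensor[OF c bowtie_in_V[OF p] bowtie_in_V[OF q]] CT_mult_bowtie[OF \<gamma> \<nu> p q]
        CT_crossing_bowtie[OF \<alpha> \<beta> \<delta> p] CT_crossing_bowtie[OF \<alpha> \<beta> \<nu> q] CT_crossing_bowtie[OF \<alpha> \<beta> A(3)
            lin_conv[OF q p]]
        CT_mult_bowtie[OF A(1,2) lin_comp_Aut[OF \<phi> p] lin_comp_Aut[OF \<phi> q]] conv_Aut[OF \<phi> q p]
      by (simp add: Aut_simps \<alpha> \<beta> \<gamma> \<delta> \<nu> M)
  qed
qed

end

lemma crossed_turaev_algebra_CT: "crossed_turaev_algebra (aut_pairs H) (CT H B) (CT_crossing H)"
  by (intro crossed_turaev_algebra.intro[OF turaev_algebra_CT] crossed_turaev_algebra_axioms.intro;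
      clarsimp simp: conjugate_aut_pairs simp del: aut_pairs_simps(2))
    (simp_all add: CT_crossing_coalgebra_iso CT_crossing_CT_crossing CT_crossing_CT_mult Aut_id
      CT_crossing_CT_unit CT_crossing_CT_antipode inv_aut_pairs)

end

theorem proposition3p11:
  fixes H :: "('k::field, 'h::ring_1) hopf"
    and B :: "'h set"
  assumes "hopf_algebra H"
    and "finite_dimensional_vector_space (vscale H) B"
  shows "crossed_turaev_algebra (aut_pairs H) (CT H B) (CT_crossing H)"
proof -
  interpret fin_hopf H B using assms by (rule fin_hopf.intro)
  show ?thesis by (rule crossed_turaev_algebra_CT)
qed

end
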